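(* Let $n=2$ and let $F$ be the geometric Brownian motion on $\mathbf{SL}(2)$ defined in the context. For any $p\ge1$ there is a constant $C=C(p)\in[1,\infty)$ such that $$C^{-1}e^{\frac12p(p+1)\tau}\le\mathbb{E}|F_\tau|^{2p}\le C\,e^{\frac12p(p+1)\tau}\qquad\text{for all }\tau\ge0.$$
   Context: $\mathfrak{sl}(2)$ is the space of trace-free endomorphisms of $\mathbb{R}^2$. $B$ is the Brownian motion on $\mathfrak{sl}(2)$, unique in law, such that the solution $F$ of the Stratonovich equation $dF=F_\tau\circ dB$, $F_{\tau=0}=\mathrm{id}$ satisfies: (i) $OFO^{-1}=_{\mathrm{law}}F$ for all $O\in\mathbf{O}(2)$; (ii) $F_\tau\circ dB=F_\tau dB$, i.e. Itô and Stratonovich products coincide; (iii) $\mathbb{E}F_\tau F_\tau^*=e^\tau\mathrm{id}$. (Equivalently: $OBO^{-1}=_{\mathrm{law}}B$ for all $O\in\mathbf{O}(2)$, $\mathbb{E}B_\tau B_\tau=0$, $\mathbb{E}B_\tau B_\tau^*=\tau\,\mathrm{id}$.) $|F|^2=\mathrm{tr}\,FF^*$ is the Frobenius norm. *)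

theory Defs
  imports "HOL-Probability.Probability"
begin

type_synonym mat2 = "real^2^2"

definition sl2 :: "mat2 set" where
  "sl2 = {A. trace A = 0}"

definition frobenius_norm :: "mat2 \<Rightarrow> real" where
  "frobenius_norm A = sqrt (trace (A ** transpose A))"

text \<open>The centred normal law of variance \<open>v \<ge> 0\<close>. For \<open>v = 0\<close> it is the point mass at 0,
  where \<^const>\<open>normal_density\<close> is not meaningful.\<close>

definition normal_law :: "real \<Rightarrow> real measure" where
  "normal_law v = (if v = 0 then return borel 0 else density lborel (normal_density 0 (sqrt v)))"

definition same_law :: "'w measure \<Rightarrow> (real \<Rightarrow> 'w \<Rightarrow> mat2) \<Rightarrow> (real \<Rightarrow> 'w \<Rightarrow> mat2) \<Rightarrow> bool" where
  "same_law M X Y \<longleftrightarrow>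
     distr M (Pi\<^sub>M {0..} (\<lambda>_. borel)) (\<lambda>w. \<lambda>t\<in>{0..}. X t w) =
     distr M (Pi\<^sub>M {0..} (\<lambda>_. borel)) (\<lambda>w. \<lambda>t\<in>{0..}. Y t w)"

text \<open>Time is \<open>[0,\<infinity>)\<close>; the values of filtrations and processes at negative times play no role.
  No completeness of the filtration is required.\<close>

locale filtered_prob_space = prob_space M for M :: "'w measure" +
  fixes G :: "real \<Rightarrow> 'w measure"
  assumes subalg: "0 \<le> t \<Longrightarrow> subalgebra M (G t)"
    and G_mono: "0 \<le> s \<Longrightarrow> s \<le> t \<Longrightarrow> sets (G s) \<subseteq> sets (G t)"

definition continuous_adapted ::
  "'w measure \<Rightarrow> (real \<Rightarrow> 'w measure) \<Rightarrow> (real \<Rightarrow> 'w \<Rightarrow> mat2) \<Rightarrow> bool" where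
  "continuous_adapted M G X \<longleftrightarrow>
     (\<forall>t\<ge>0. X t \<in> borel_measurable (G t)) \<and> (AE w in M. continuous_on {0..} (\<lambda>t. X t w))"

text \<open>A Brownian motion on the vector space \<^const>\<open>sl2\<close> with respect to a filtration, with
  arbitrary (possibly degenerate) covariance: the law of an increment is fixed by the laws of its
  one-dimensional projections, the inner product being \<open>A \<bullet> X = tr (A\<^sup>T X)\<close>.\<close>

locale sl2_brownian_motion = filtered_prob_space M G
  for M :: "'w measure" and G :: "real \<Rightarrow> 'w measure" +
  fixes B :: "real \<Rightarrow> 'w \<Rightarrow> mat2"
  assumes B_cont_adapted: "continuous_adapted M G B"
    and B_sl2: "0 \<le> t \<Longrightarrow> w \<in> space M \<Longrightarrow> B t w \<in> sl2"
    and B_0: "AE w in M. B 0 w = 0"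
    and B_indep: "0 \<le> s \<Longrightarrow> s \<le> t \<Longrightarrow>
      indep_set (sets (G s)) (sets (vimage_algebra (space M) (\<lambda>w. B t w - B s w) borel))"
    and B_normal: "\<exists>v\<ge>0. \<forall>s t. 0 \<le> s \<longrightarrow> s \<le> t \<longrightarrow>
      distr M borel (\<lambda>w. A \<bullet> (B t w - B s w)) = normal_law (v * (t - s))"

definition partition_pts :: "real \<Rightarrow> nat \<Rightarrow> (nat \<Rightarrow> real) \<Rightarrow> bool" where
  "partition_pts t N s \<longleftrightarrow> s 0 = 0 \<and> s N = t \<and> (\<forall>i<N. s i \<le> s (Suc i))"

text \<open>\<open>Y\<close> is the limit in probability of the sums \<open>S N s\<close> over partitions
  \<open>0 = s 0 \<le> \<dots> \<le> s N = t\<close> as the mesh tends to zero.\<close>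

definition partition_limit ::
  "'w measure \<Rightarrow> real \<Rightarrow> (nat \<Rightarrow> (nat \<Rightarrow> real) \<Rightarrow> 'w \<Rightarrow> mat2) \<Rightarrow> ('w \<Rightarrow> mat2) \<Rightarrow> bool" where
  "partition_limit M t S Y \<longleftrightarrow> Y \<in> borel_measurable M \<and>
     (\<forall>\<epsilon>>0. \<exists>\<delta>>0. \<forall>N s. partition_pts t N s \<and> (\<forall>i<N. s (Suc i) - s i < \<delta>) \<longrightarrow>
        measure M {w \<in> space M. \<epsilon> < norm (S N s w - Y w)} < \<epsilon>)"

text \<open>Ito and Stratonovich integrals of a continuous adapted integrand \<open>X\<close> over \<open>[0,t]\<close>, as limits
  in probability of left-point and of trapezoidal sums; these are relations, since the limit \<open>Y\<close> is
  only determined almost surely.\<close>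

definition has_ito_integral ::
  "'w measure \<Rightarrow> (real \<Rightarrow> 'w \<Rightarrow> mat2) \<Rightarrow> (real \<Rightarrow> 'w \<Rightarrow> mat2) \<Rightarrow> real \<Rightarrow> ('w \<Rightarrow> mat2) \<Rightarrow> bool" where
  "has_ito_integral M X B t Y \<longleftrightarrow>
     partition_limit M t (\<lambda>N s w. \<Sum>i<N. X (s i) w ** (B (s (Suc i)) w - B (s i) w)) Y"

definition has_stratonovich_integral ::
  "'w measure \<Rightarrow> (real \<Rightarrow> 'w \<Rightarrow> mat2) \<Rightarrow> (real \<Rightarrow> 'w \<Rightarrow> mat2) \<Rightarrow> real \<Rightarrow> ('w \<Rightarrow> mat2) \<Rightarrow> bool" where
  "has_stratonovich_integral M X B t Y \<longleftrightarrow>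
     partition_limit M t (\<lambda>N s w. \<Sum>i<N.
       ((1/2) *\<^sub>R (X (s i) w + X (s (Suc i)) w)) ** (B (s (Suc i)) w - B (s i) w)) Y"

locale stratonovich_solution = sl2_brownian_motion M G B
  for M :: "'w measure" and G :: "real \<Rightarrow> 'w measure" and B :: "real \<Rightarrow> 'w \<Rightarrow> mat2" +
  fixes F :: "real \<Rightarrow> 'w \<Rightarrow> mat2"
  assumes F_cont_adapted: "continuous_adapted M G F"
    and F_0: "AE w in M. F 0 w = mat 1"
    and F_sde: "0 \<le> t \<Longrightarrow> has_stratonovich_integral M F B t (\<lambda>w. F t w - mat 1)"

locale geometric_brownian_motion_SL2 = stratonovich_solution M G B F
  for M :: "'w measure" and G :: "real \<Rightarrow> 'w measure"
    and B :: "real \<Rightarrow> 'w \<Rightarrow> mat2" and F :: "real \<Rightarrow> 'w \<Rightarrow> mat2" +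
  assumes F_isotropic: "orthogonal_matrix Q \<Longrightarrow> same_law M (\<lambda>t w. Q ** F t w ** matrix_inv Q) F"
    and ito_eq_stratonovich: "0 \<le> t \<Longrightarrow>
      has_stratonovich_integral M F B t Y \<longleftrightarrow> has_ito_integral M F B t Y"
    and F_second_moment: "0 \<le> t \<Longrightarrow>
      has_bochner_integral M (\<lambda>w. F t w ** transpose (F t w)) (exp t *\<^sub>R mat 1)"

end

(*
  Each row x of F satisfies dx = x dB. The three normalisations determine the covariance of B: for a
  unit vector n with orthogonal n', the components n.(dB^T n) and n'.(dB^T n) have variances dt/4 and
  3dt/4, so that log |x|^2 is a Brownian motion with drift 1/2 and E|x_t|^(2p) = exp(p(p+1)t/2).
  Since |F|^2 is the sum of the squared norms of two rows, this gives the claim.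
  No stochastic calculus is used: the Euler scheme F_(i+1) = F_i (1 + dB_i) converges to F in L^2 (the
  second moment of F is known, so there is nothing to localise), and for it the moments of a row
  multiply up over independent increments. The covariance of B is read off from the second moments
  of F_t - 1 as t tends to 0, and from the vanishing of the difference between the trapezoidal and
  the left-point sums.
*)
theory Submission
  imports Defs
begin

section \<open>Matrices\<close>

text \<open>Let a and b be the variance rates of the entries 11 and 12 of \<open>B\<close>. Isotropy
  gives rate b to entry 21 and rate 4a to the sum of entries 12 and 21. The second moment of
  \<open>F\<close> gives a + b = 1, and the equality of both integrals forces E dB dB = 0, which
  reads 3a - b = 0. The growth exponent is then p(a + b) + 2p(p-1)a = p(p+1)/2. The obstacle is that
  the integrals are known only as limits in probability, while second moments are wanted. A coarse
  sum is therefore compared with sums over refinements of its own grid: the difference is again a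
  discrete integral, its second moment is bounded uniformly in the refinement, and Fatou's lemma
  hands the bound to the limit. Isotropy, too, is assumed for \<open>F\<close> alone and has to be
  carried to \<open>B\<close> through small-time second moments. Convergence of the Euler scheme in
  L^2 does not by itself give convergence of the moments of order 2p; the Euler moments of order 4p,
  bounded by the same computation with 2p for p, supply the uniform integrability.\<close>

lemma matrix_mult_nth: "(A ** B) $ i = A $ i v* B"
  for A :: "'a::comm_semiring_1^'n^'m"
  by (simp add: vec_eq_iff matrix_matrix_mult_def vector_matrix_mult_def mult.commute)

lemma norm_vector_matrix_mult_le: "norm (x v* B) \<le> norm x * norm B" for B :: "real^'n^'m"
proof -
  have "x v* B = (\<Sum>k\<in>UNIV. x $ k *\<^sub>R B $ k)"
    by (simp add: vec_eq_iff vector_matrix_mult_def mult.commute)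
  also have "norm \<dots> \<le> (\<Sum>k\<in>UNIV. \<bar>x $ k\<bar> * \<bar>norm (B $ k)\<bar>)"
    by (rule sum_norm_le) simp
  also have "\<dots> \<le> norm x * norm B"
    by (rule order_trans[OF L2_set_mult_ineq]) (simp add: norm_vec_def L2_set_def)
  finally show ?thesis .
qed

lemma norm_matrix_mult_le: "norm (A ** B) \<le> norm A * norm B"
  for A :: "real^'n^'m" and B :: "real^'k^'n"
proof -
  have "norm (A ** B) = L2_set (\<lambda>i. norm (A $ i v* B)) UNIV"
    by (simp add: norm_vec_def[of "A ** B"] matrix_mult_nth)
  also have "\<dots> \<le> L2_set (\<lambda>i. norm (A $ i) * norm B) UNIV"
    by (intro L2_set_mono norm_vector_matrix_mult_le) auto
  also have "\<dots> = norm A * norm B"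
    by (simp add: L2_set_left_distrib norm_vec_def[of A])
  finally show ?thesis .
qed

lemma bounded_bilinear_matrix_mult:
  "bounded_bilinear ((**) :: real^'n^'m \<Rightarrow> real^'k^'n \<Rightarrow> real^'k^'m)"
proof (standard, goal_cases)
  case 5 show ?case by (rule exI[of _ 1]) (simp add: norm_matrix_mult_le)
qed (simp_all add: matrix_add_ldistrib matrix_matrix_mult_def vec_eq_iff scaleR_sum_right
       sum.distrib sum_distrib_left algebra_simps)

lemma borel_measurable_matrix_mult [measurable (raw)]:
  fixes X :: "'a \<Rightarrow> real^'n^'m" and Y :: "'a \<Rightarrow> real^'k^'n"
  assumes "X \<in> borel_measurable M" "Y \<in> borel_measurable M"
  shows "(\<lambda>w. X w ** Y w) \<in> borel_measurable M"
  by (rule borel_measurable_continuous_Pair[OF assms])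
     (intro bounded_bilinear.continuous_on[OF bounded_bilinear_matrix_mult] continuous_intros)

lemma borel_measurable_vec_component [measurable (raw)]:
  fixes X :: "'a \<Rightarrow> 'b::second_countable_topology^'m"
  assumes "X \<in> borel_measurable M"
  shows "(\<lambda>w. X w $ i) \<in> borel_measurable M"
  by (rule measurable_compose[OF assms borel_measurable_continuous_onI])
     (intro continuous_on_component continuous_on_id)

lemma inner_mat2: "A \<bullet> X = A$1$1 * X$1$1 + A$1$2 * X$1$2 + A$2$1 * X$2$1 + A$2$2 * X$2$2"
  for A :: mat2
  by (simp add: inner_vec_def sum_2)

lemma norm_mat2_squared: "(norm A)\<^sup>2 = (A$1$1)\<^sup>2 + (A$1$2)\<^sup>2 + (A$2$1)\<^sup>2 + (A$2$2)\<^sup>2"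
  for A :: mat2
  unfolding power2_norm_eq_inner inner_mat2 by (simp add: power2_eq_square)

lemma frobenius_norm_eq_norm: "frobenius_norm A = norm A"
  by (simp add: frobenius_norm_def norm_eq_sqrt_inner trace_def transpose_def
      matrix_matrix_mult_def inner_vec_def)

lemma power2_norm_rows: "(norm A)\<^sup>2 = (norm (A $ 1))\<^sup>2 + (norm (A $ 2))\<^sup>2" for A :: mat2
  by (simp add: norm_vec_def[of A] L2_set_def sum_2)

lemma norm_transpose_mat2: "norm (transpose A) = norm A" for A :: mat2
  by (rule power2_eq_imp_eq) (simp_all add: norm_mat2_squared transpose_def)

lemma inner_matrix_mult: "S \<bullet> (X ** Y) = (transpose X ** S) \<bullet> Y" for S X Y :: mat2
  by (simp add: inner_mat2 matrix_matrix_mult_def transpose_def sum_2 algebra_simps)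

lemma inner_matrix_mult_right: "S \<bullet> (X ** Y) = (S ** transpose Y) \<bullet> X" for S X Y :: mat2
  by (simp add: inner_mat2 matrix_matrix_mult_def transpose_def sum_2 algebra_simps)

lemma matrix_inv_orthogonal:
  fixes Q :: "real^'n^'n"
  assumes "orthogonal_matrix Q"
  shows "matrix_inv Q = transpose Q"
proof -
  have Q: "Q ** transpose Q = mat 1" "transpose Q ** Q = mat 1"
    using assms by (auto simp: orthogonal_matrix_def)
  then have "Q ** matrix_inv Q = mat 1 \<and> matrix_inv Q ** Q = mat 1"
    unfolding matrix_inv_def by (rule_tac someI_ex) blast
  then have "transpose Q ** (Q ** matrix_inv Q) = transpose Q" by simp
  then show ?thesis by (simp add: matrix_mul_assoc Q)
qed

lemma bounded_linear_matrix_entry: "bounded_linear (\<lambda>A::real^'n^'m. A $ i $ j)"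
  by (rule bounded_linear_compose[OF bounded_linear_vec_nth bounded_linear_vec_nth])

text \<open>An entry becomes an inner product with a fixed matrix, which is the form in which
  \<open>B_normal\<close> describes the increments.\<close>

definition unit_mat :: "2 \<Rightarrow> 2 \<Rightarrow> mat2" where
  "unit_mat i j = axis i (axis j 1)"

lemma unit_mat_inner [simp]: "unit_mat i j \<bullet> A = A $ i $ j"
  by (simp add: unit_mat_def inner_axis')

lemma borel_measurable_transpose [measurable (raw)]:
  fixes X :: "'a \<Rightarrow> real^'n^'m"
  assumes "X \<in> borel_measurable M"
  shows "(\<lambda>w. transpose (X w)) \<in> borel_measurable M"
proof (rule measurable_compose[OF assms borel_measurable_continuous_onI])
  show "continuous_on UNIV (transpose :: real^'n^'m \<Rightarrow> _)"
    by (intro linear_continuous_on linear_conv_bounded_linear[THEN iffD1] linearI)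
      (simp_all add: transpose_def vec_eq_iff)
qed

section \<open>Convergence in probability and bounded second moments\<close>

lemma power2_norm_add_le: "(norm (x + y))\<^sup>2 \<le> 2 * (norm x)\<^sup>2 + 2 * (norm y)\<^sup>2"
  for x :: "'a::real_inner"
proof -
  have "(norm (x + y))\<^sup>2 \<le> (norm x + norm y)\<^sup>2"
    by (intro power_mono norm_triangle_ineq) auto
  also have "\<dots> \<le> 2 * (norm x)\<^sup>2 + 2 * (norm y)\<^sup>2"
    using sum_squares_bound[of "norm x" "norm y"] by (simp add: power2_sum)
  finally show ?thesis .
qed

text \<open>As in \<open>partition_limit\<close>, one \<epsilon> bounds both the deviation and its
  probability; since \<epsilon> is arbitrary this is ordinary convergence in probability.\<close>

definition tends_prob_0 :: "'w measure \<Rightarrow> (nat \<Rightarrow> 'w \<Rightarrow> 'b::real_normed_vector) \<Rightarrow> bool" where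
  "tends_prob_0 M Z \<longleftrightarrow>
     (\<forall>\<epsilon>>0. \<forall>\<^sub>F m in sequentially. measure M {w \<in> space M. \<epsilon> < norm (Z m w)} < \<epsilon>)"

context prob_space begin

lemma tends_prob_0_diff:
  fixes X Y :: "nat \<Rightarrow> 'a \<Rightarrow> 'b::euclidean_space"
  assumes X: "tends_prob_0 M X" and Y: "tends_prob_0 M Y"
    and [measurable]: "\<And>m. X m \<in> borel_measurable M" "\<And>m. Y m \<in> borel_measurable M"
  shows "tends_prob_0 M (\<lambda>m w. X m w - Y m w)"
  unfolding tends_prob_0_def
proof (intro allI impI)
  fix \<epsilon> :: real assume "0 < \<epsilon>"
  then have h: "0 < \<epsilon> / 2" by simp
  have "\<forall>\<^sub>F m in sequentially. prob {w \<in> space M. \<epsilon> / 2 < norm (X m w)} < \<epsilon> / 2"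
    "\<forall>\<^sub>F m in sequentially. prob {w \<in> space M. \<epsilon> / 2 < norm (Y m w)} < \<epsilon> / 2"
    using X Y h unfolding tends_prob_0_def by blast+
  then show "\<forall>\<^sub>F m in sequentially. prob {w \<in> space M. \<epsilon> < norm (X m w - Y m w)} < \<epsilon>"
  proof eventually_elim
    case (elim m)
    have "prob {w \<in> space M. \<epsilon> < norm (X m w - Y m w)}
      \<le> prob ({w \<in> space M. \<epsilon> / 2 < norm (X m w)} \<union> {w \<in> space M. \<epsilon> / 2 < norm (Y m w)})"
    proof (rule finite_measure_mono)
      show "{w \<in> space M. \<epsilon> < norm (X m w - Y m w)}
        \<subseteq> {w \<in> space M. \<epsilon> / 2 < norm (X m w)} \<union> {w \<in> space M. \<epsilon> / 2 < norm (Y m w)}"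
      proof
        fix w assume "w \<in> {w \<in> space M. \<epsilon> < norm (X m w - Y m w)}"
        then show "w \<in> {w \<in> space M. \<epsilon> / 2 < norm (X m w)} \<union> {w \<in> space M. \<epsilon> / 2 < norm (Y m w)}"
          using norm_triangle_ineq4[of "X m w" "Y m w"] by auto
      qed
    qed measurable
    also have "\<dots> \<le> prob {w \<in> space M. \<epsilon> / 2 < norm (X m w)} + prob {w \<in> space M. \<epsilon> / 2 < norm (Y m w)}"
      by (rule measure_Un_le) measurable
    finally show ?case using elim by linarith
  qed
qed

text \<open>Borel-Cantelli: the index \<open>r k\<close> is chosen so late that a deviation above
  2^(-k) has probability below 2^(-k), and these probabilities are summable.\<close>

lemma tends_prob_0_AE_subseq:
  fixes Z :: "nat \<Rightarrow> 'a \<Rightarrow> 'b::euclidean_space"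
  assumes Z: "tends_prob_0 M Z" and [measurable]: "\<And>m. Z m \<in> borel_measurable M"
  shows "\<exists>r. strict_mono r \<and> (AE w in M. (\<lambda>k. Z (r k) w) \<longlonglongrightarrow> 0)"
proof -
  define P where "P k m \<longleftrightarrow> prob {w \<in> space M. (1/2)^k < norm (Z m w)} < (1/2)^k" for k :: nat and m
  have ev: "\<forall>\<^sub>F m in sequentially. P k m" for k
    using Z unfolding tends_prob_0_def P_def by simp
  have "\<exists>r. \<forall>k. P k (r k) \<and> r k < r (Suc k)"
  proof (rule dependent_nat_choice)
    show "\<exists>m. P 0 m" using ev[of 0] by (auto simp: eventually_sequentially)
    show "\<exists>m'. P (Suc k) m' \<and> m < m'" for m k
      using eventually_conj[OF ev[of "Suc k"] eventually_gt_at_top[of m]]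
      by (auto simp: eventually_sequentially)
  qed
  then obtain r where r: "\<And>k. P k (r k)" "\<And>k. r k < r (Suc k)" by blast
  define A where "A k = {w \<in> space M. (1/2)^k < norm (Z (r k) w)}" for k :: nat
  have "AE w in M. \<forall>\<^sub>F k in sequentially. w \<in> space M - A k"
  proof (rule borel_cantelli_AE1)
    show "A k \<in> sets M" for k unfolding A_def by measurable
    show "summable (\<lambda>k. prob (A k))"
    proof (rule summable_comparison_test'[OF summable_geometric, of "1/2" 0])
      show "norm (prob (A k)) \<le> (1/2)^k" for k
        using r(1)[of k] by (simp add: P_def A_def)
    qed auto
  qed (simp add: less_top[symmetric])
  then have "AE w in M. (\<lambda>k. Z (r k) w) \<longlonglongrightarrow> 0"
  proof (rule AE_mp, intro AE_I2 impI)
    fix w assume "w \<in> space M" and "\<forall>\<^sub>F k in sequentially. w \<in> space M - A k"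
    then have "\<forall>\<^sub>F k in sequentially. norm (Z (r k) w) \<le> (1/2)^k"
      by (auto elim!: eventually_mono simp: A_def)
    moreover have "(\<lambda>k. (1/2::real)^k) \<longlonglongrightarrow> 0" by (rule LIMSEQ_power_zero) simp
    ultimately show "(\<lambda>k. Z (r k) w) \<longlonglongrightarrow> 0" by (rule Lim_null_comparison)
  qed
  with r(2) show ?thesis by (auto simp: strict_mono_Suc_iff)
qed

lemma partition_limitD:
  assumes lim: "partition_limit M t S Y"
    and pts: "\<forall>\<^sub>F m in sequentially. partition_pts t (N m) (s m)"
    and mesh: "\<And>\<delta>. 0 < \<delta> \<Longrightarrow> \<forall>\<^sub>F m in sequentially. \<forall>i<N m. s m (Suc i) - s m i < \<delta>"
  shows "tends_prob_0 M (\<lambda>m w. S (N m) (s m) w - Y w)"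
  unfolding tends_prob_0_def
proof (intro allI impI)
  fix \<epsilon> :: real assume "0 < \<epsilon>"
  then obtain \<delta> where "\<delta> > 0" and \<delta>: "\<And>N s. partition_pts t N s \<Longrightarrow> (\<forall>i<N. s (Suc i) - s i < \<delta>) \<Longrightarrow>
      prob {w \<in> space M. \<epsilon> < norm (S N s w - Y w)} < \<epsilon>"
    using lim unfolding partition_limit_def by meson
  show "\<forall>\<^sub>F m in sequentially. prob {w \<in> space M. \<epsilon> < norm (S (N m) (s m) w - Y w)} < \<epsilon>"
    using pts mesh[OF \<open>\<delta> > 0\<close>] by eventually_elim (rule \<delta>)
qed

text \<open>This carries L^2 bounds from discrete sums to their almost sure limits, where
  integrability of the limit is not known beforehand.\<close>

lemma Fatou_second_moment:
  fixes Z :: "nat \<Rightarrow> 'a \<Rightarrow> 'b::euclidean_space"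
  assumes [measurable]: "\<And>k. Z k \<in> borel_measurable M" "Y \<in> borel_measurable M"
    and lim: "AE w in M. (\<lambda>k. Z k w) \<longlonglongrightarrow> Y w"
    and int: "\<And>k. integrable M (\<lambda>w. (norm (Z k w))\<^sup>2)"
    and le: "\<And>k. (\<integral>w. (norm (Z k w))\<^sup>2 \<partial>M) \<le> K"
  shows "integrable M (\<lambda>w. (norm (Y w))\<^sup>2)" "(\<integral>w. (norm (Y w))\<^sup>2 \<partial>M) \<le> K"
proof -
  have K: "0 \<le> K" using le[of 0] by (meson Bochner_Integration.integral_nonneg order_trans zero_le_power2)
  have "(\<integral>\<^sup>+w. ennreal ((norm (Y w))\<^sup>2) \<partial>M) = (\<integral>\<^sup>+w. liminf (\<lambda>k. ennreal ((norm (Z k w))\<^sup>2)) \<partial>M)"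
  proof (rule nn_integral_cong_AE, use lim in eventually_elim)
    case (elim w)
    then have "(\<lambda>k. ennreal ((norm (Z k w))\<^sup>2)) \<longlonglongrightarrow> ennreal ((norm (Y w))\<^sup>2)"
      by (intro tendsto_intros)
    then show ?case by (metis lim_imp_Liminf trivial_limit_sequentially)
  qed
  also have "\<dots> \<le> liminf (\<lambda>k. \<integral>\<^sup>+w. ennreal ((norm (Z k w))\<^sup>2) \<partial>M)"
    by (rule nn_integral_liminf) measurable
  also have "\<dots> \<le> ennreal K"
    using le int by (intro Liminf_le) (auto simp: nn_integral_eq_integral intro!: ennreal_leI always_eventually)
  finally have *: "(\<integral>\<^sup>+w. ennreal ((norm (Y w))\<^sup>2) \<partial>M) \<le> ennreal K" .
  then show "integrable M (\<lambda>w. (norm (Y w))\<^sup>2)"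
    by (intro integrableI_bounded) (auto simp: less_top[symmetric] top_unique)
  then show "(\<integral>w. (norm (Y w))\<^sup>2 \<partial>M) \<le> K"
    using * K by (simp add: nn_integral_eq_integral)
qed

text \<open>Bounded second moments give uniform integrability. Truncation at level L changes an
  expectation by at most K/L, because the error at x is at most x^2/L, and the truncated variables
  converge by dominated convergence.\<close>

lemma tendsto_integral_bounded_second_moment:
  fixes Z :: "nat \<Rightarrow> 'a \<Rightarrow> real"
  assumes [measurable]: "\<And>k. Z k \<in> borel_measurable M" "Y \<in> borel_measurable M"
    and lim: "AE w in M. (\<lambda>k. Z k w) \<longlonglongrightarrow> Y w"
    and int: "\<And>k. integrable M (\<lambda>w. (Z k w)\<^sup>2)"
    and le: "\<And>k. (\<integral>w. (Z k w)\<^sup>2 \<partial>M) \<le> K"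
  shows "integrable M Y" "(\<lambda>k. \<integral>w. Z k w \<partial>M) \<longlonglongrightarrow> (\<integral>w. Y w \<partial>M)"
proof -
  have Y2: "integrable M (\<lambda>w. (Y w)\<^sup>2)" "(\<integral>w. (Y w)\<^sup>2 \<partial>M) \<le> K"
    using Fatou_second_moment[of Z Y K] assms by auto
  have Zi: "integrable M (Z k)" for k using int by (rule square_integrable_imp_integrable[rotated]) measurable
  show Yi: "integrable M Y" using Y2(1) by (rule square_integrable_imp_integrable[rotated]) measurable
  define c where "c L x = max (-L) (min L x)" for L x :: real
  have [measurable]: "c L \<in> borel_measurable borel" for L unfolding c_def by measurable
  have trunc: "\<bar>(\<integral>w. X w \<partial>M) - (\<integral>w. c L (X w) \<partial>M)\<bar> \<le> K / L"
    if "0 < L" and [measurable]: "X \<in> borel_measurable M" and X: "integrable M X"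
      "integrable M (\<lambda>w. (X w)\<^sup>2)" "(\<integral>w. (X w)\<^sup>2 \<partial>M) \<le> K" for L X
  proof -
    have pt: "\<bar>x - c L x\<bar> \<le> x\<^sup>2 / L" for x
    proof (cases "\<bar>x\<bar> \<le> L")
      case True then show ?thesis using \<open>0 < L\<close> by (auto simp: c_def)
    next
      case False
      then have "\<bar>x - c L x\<bar> \<le> \<bar>x\<bar>" using \<open>0 < L\<close> by (auto simp: c_def)
      moreover have "\<bar>x\<bar> \<le> x\<^sup>2 / L"
      proof -
      have "\<bar>x\<bar> * L \<le> \<bar>x\<bar> * \<bar>x\<bar>" using False by (intro mult_left_mono) auto
      then show ?thesis using \<open>0 < L\<close> by (simp add: pos_le_divide_eq power2_eq_square)
      qed
      ultimately show ?thesis by linarith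
    qed
    have ci: "integrable M (\<lambda>w. c L (X w))"
      using \<open>0 < L\<close> by (intro integrable_const_bound[where B=L]) (auto simp: c_def)
    have "\<bar>(\<integral>w. X w \<partial>M) - (\<integral>w. c L (X w) \<partial>M)\<bar> = \<bar>\<integral>w. X w - c L (X w) \<partial>M\<bar>"
      using X ci by simp
    also have "\<dots> \<le> (\<integral>w. \<bar>X w - c L (X w)\<bar> \<partial>M)" by (rule integral_abs_bound)
    also have "\<dots> \<le> (\<integral>w. (X w)\<^sup>2 / L \<partial>M)"
      using X ci pt by (intro integral_mono) auto
    also have "\<dots> \<le> K / L" using X \<open>0 < L\<close> by (simp add: divide_right_mono)
    finally show ?thesis .
  qed
  show "(\<lambda>k. \<integral>w. Z k w \<partial>M) \<longlonglongrightarrow> (\<integral>w. Y w \<partial>M)"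
  proof (rule LIMSEQ_I)
    fix e :: real assume "0 < e"
    have "0 \<le> K" using Y2(2) by (meson Bochner_Integration.integral_nonneg order_trans zero_le_power2)
    \<comment> \<open>Two truncations, of \<open>Z k\<close> and of \<open>Y\<close>, cost at most
      e/4 each and leave e/2 for the truncated integrals. The summand 1 keeps L positive when K =
      0.\<close>
    define L where "L = 4 * (K + 1) / e"
    have "0 < L" using \<open>0 < e\<close> \<open>0 \<le> K\<close> by (simp add: L_def)
    have KL: "K / L \<le> e / 4" using \<open>0 < e\<close> \<open>0 \<le> K\<close> by (simp add: L_def field_simps)
    have "(\<lambda>k. \<integral>w. c L (Z k w) \<partial>M) \<longlonglongrightarrow> (\<integral>w. c L (Y w) \<partial>M)"
    proof (rule integral_dominated_convergence[where w="\<lambda>_. L"])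
      show "AE w in M. (\<lambda>k. c L (Z k w)) \<longlonglongrightarrow> c L (Y w)"
        using lim by eventually_elim (auto simp: c_def intro!: tendsto_intros)
      show "AE w in M. norm (c L (Z k w)) \<le> L" for k using \<open>0 < L\<close> by (auto simp: c_def)
    qed auto
    from LIMSEQ_D[OF this half_gt_zero[OF \<open>0 < e\<close>]] obtain n where n: "\<And>k. k \<ge> n \<Longrightarrow> \<bar>(\<integral>w. c L (Z k w) \<partial>M) - (\<integral>w. c L (Y w) \<partial>M)\<bar> < e / 2"
      unfolding real_norm_def by blast
    have "norm ((\<integral>w. Z k w \<partial>M) - (\<integral>w. Y w \<partial>M)) < e" if "k \<ge> n" for k
      using n[OF that] trunc[OF \<open>0 < L\<close> assms(1) Zi[of k] int le] trunc[OF \<open>0 < L\<close> assms(2) Yi Y2] KL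
      unfolding real_norm_def by linarith
    then show "\<exists>n. \<forall>k\<ge>n. norm ((\<integral>w. Z k w \<partial>M) - (\<integral>w. Y w \<partial>M)) < e" by blast
  qed
qed

end

text \<open>Tonelli for the joint law takes the place of conditioning on \<open>X\<close>. The
  nonnegative integral is used because in the moment recursion of the Euler scheme the integrability
  of the left side is a conclusion.\<close>

lemma (in prob_space) nn_integral_indep_var:
  assumes ind: "indep_var S X T Z" and [measurable]: "f \<in> borel_measurable (S \<Otimes>\<^sub>M T)"
  shows "(\<integral>\<^sup>+w. f (X w, Z w) \<partial>M) = (\<integral>\<^sup>+w. (\<integral>\<^sup>+w'. f (X w, Z w') \<partial>M) \<partial>M)"
proof -
  have [measurable]: "X \<in> measurable M S" "Z \<in> measurable M T"
    and eq: "distr M S X \<Otimes>\<^sub>M distr M T Z = distr M (S \<Otimes>\<^sub>M T) (\<lambda>w. (X w, Z w))"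
    using ind by (auto simp: indep_var_distribution_eq)
  interpret X: prob_space "distr M S X" by (rule prob_space_distr) measurable
  interpret Z: prob_space "distr M T Z" by (rule prob_space_distr) measurable
  have m: "(\<lambda>x. \<integral>\<^sup>+z. f (x, z) \<partial>distr M T Z) \<in> borel_measurable S"
    by (rule Z.borel_measurable_nn_integral) (simp add: case_prod_beta')
  have "(\<integral>\<^sup>+w. f (X w, Z w) \<partial>M) = (\<integral>\<^sup>+q. f q \<partial>(distr M S X \<Otimes>\<^sub>M distr M T Z))"
    unfolding eq by (rule nn_integral_distr[symmetric]) measurable
  also have "\<dots> = (\<integral>\<^sup>+x. \<integral>\<^sup>+z. f (x, z) \<partial>distr M T Z \<partial>distr M S X)"
    by (rule Z.nn_integral_fst[symmetric]) simp
  also have "\<dots> = (\<integral>\<^sup>+w. (\<integral>\<^sup>+z. f (X w, z) \<partial>distr M T Z) \<partial>M)"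
    by (rule nn_integral_distr) (use m in simp_all)
  also have "\<dots> = (\<integral>\<^sup>+w. (\<integral>\<^sup>+w'. f (X w, Z w') \<partial>M) \<partial>M)"
  proof (rule nn_integral_cong)
    fix w assume "w \<in> space M"
    then have "X w \<in> space S" by (rule measurable_space[rotated]) measurable
    then show "(\<integral>\<^sup>+z. f (X w, z) \<partial>distr M T Z) = (\<integral>\<^sup>+w'. f (X w, Z w') \<partial>M)"
      by (intro nn_integral_distr) measurable
  qed
  finally show ?thesis .
qed

lemma (in prob_space) integrable_power2_norm_add:
  fixes X Y :: "'a \<Rightarrow> 'b::euclidean_space"
  assumes [measurable]: "X \<in> borel_measurable M" "Y \<in> borel_measurable M"
    and "integrable M (\<lambda>w. (norm (X w))\<^sup>2)" "integrable M (\<lambda>w. (norm (Y w))\<^sup>2)"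
  shows "integrable M (\<lambda>w. (norm (X w + Y w))\<^sup>2)"
proof (rule Bochner_Integration.integrable_bound)
  show "integrable M (\<lambda>w. 2 * (norm (X w))\<^sup>2 + 2 * (norm (Y w))\<^sup>2)" using assms by auto
  show "AE w in M. norm ((norm (X w + Y w))\<^sup>2) \<le> norm (2 * (norm (X w))\<^sup>2 + 2 * (norm (Y w))\<^sup>2)"
    using power2_norm_add_le by (auto intro!: AE_I2)
qed measurable

section \<open>Normal laws\<close>

text \<open>Every centred normal law is a scaled standard one, including the point mass at scale 0,
  so degenerate directions of \<open>B\<close> need no separate treatment later.\<close>

lemma normal_law_eq_distr:
  assumes "0 \<le> v"
  shows "normal_law v = distr std_normal_distribution borel (\<lambda>x. sqrt v * x)"
proof -
  interpret N: prob_space std_normal_distribution by (rule prob_space_normal_density) simp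
  show ?thesis
  proof (cases "v = 0")
    case True
    then show ?thesis by (simp add: normal_law_def N.distr_const)
  next
    case False
    then have v: "0 < v" using assms by simp
    have "distributed std_normal_distribution lborel (\<lambda>x. x) (normal_density 0 1)"
      by (auto simp: distributed_def distr_id2)
    from N.normal_density_affine[OF this, of "sqrt v" 0] v
    have "distr std_normal_distribution lborel (\<lambda>x. sqrt v * x) = density lborel (normal_density 0 (sqrt v))"
      by (simp add: distributed_def)
    moreover have "distr std_normal_distribution lborel (\<lambda>x. sqrt v * x) =
        distr std_normal_distribution borel (\<lambda>x. sqrt v * x)"
      by (rule distr_cong) auto
    ultimately show ?thesis using v by (simp add: normal_law_def)
  qed
qed

lemma (in prob_space) normal_law_integral:
  fixes f :: "real \<Rightarrow> real"
  assumes [measurable]: "X \<in> borel_measurable M" "f \<in> borel_measurable borel"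
    and law: "distr M borel X = normal_law v" and "0 \<le> v"
  shows "integrable M (\<lambda>w. f (X w)) \<longleftrightarrow> integrable std_normal_distribution (\<lambda>x. f (sqrt v * x))"
    and "(\<integral>w. f (X w) \<partial>M) = (\<integral>x. f (sqrt v * x) \<partial>std_normal_distribution)"
proof -
  have eq: "distr M borel X = distr std_normal_distribution borel (\<lambda>x. sqrt v * x)"
    using law normal_law_eq_distr[OF \<open>0 \<le> v\<close>] by simp
  have m: "(\<lambda>x. sqrt v * x) \<in> measurable std_normal_distribution borel" by simp
  show "integrable M (\<lambda>w. f (X w)) \<longleftrightarrow> integrable std_normal_distribution (\<lambda>x. f (sqrt v * x))"
    using integrable_distr_eq[OF assms(1,2)] integrable_distr_eq[OF m assms(2)] eq by simp
  show "(\<integral>w. f (X w) \<partial>M) = (\<integral>x. f (sqrt v * x) \<partial>std_normal_distribution)"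
    using integral_distr[OF assms(1,2)] integral_distr[OF m assms(2)] eq by simp
qed

section \<open>Second-order expansion of p-th powers under Gaussian perturbations\<close>

lemma integrable_std_normal_one_plus_abs_power:
  "integrable std_normal_distribution (\<lambda>x. (1 + \<bar>x\<bar>) ^ k)"
proof -
  have "integrable std_normal_distribution (\<lambda>x. \<bar>x\<bar> ^ j)" for j
    using integrable_abs[OF integrable_std_normal_distribution_moment[of j]] by (simp add: power_abs)
  then have "integrable std_normal_distribution
      (\<lambda>x. \<Sum>j\<le>k. of_nat (k choose j) * \<bar>x\<bar> ^ j * 1 ^ (k - j))"
    by (intro Bochner_Integration.integrable_sum) simp
  then show ?thesis by (simp only: binomial_ring[symmetric] add.commute[of 1])
qed

text \<open>The remainder has to be cubic at 0 and of polynomial growth, so that Gaussian moments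
  control it. For p < 3 the third derivative of (1 + z)^p can blow up at z = -1, so Taylor's formula
  is applied only for |z| \<le> 1/2; beyond that, |z|^3 is bounded below and absorbs each term
  separately.\<close>

lemma powr_taylor_bound:
  fixes p :: real
  assumes "1 \<le> p"
  shows "\<exists>K\<ge>0. \<exists>m. \<forall>z\<ge>-1. \<bar>(1 + z) powr p - (1 + p * z + p * (p - 1) / 2 * z\<^sup>2)\<bar> \<le> K * (\<bar>z\<bar> ^ 3 * (1 + \<bar>z\<bar>) ^ m)"
proof -
  define m where "m = nat \<lceil>p\<rceil>"
  have pm: "p \<le> real m" using assms by (simp add: m_def)
  \<comment> \<open>\<open>K1\<close> bounds the third derivative where 1 + t lies between 1/2 and
    2. In \<open>K2\<close> one 8 comes from (1 + z)^p and 8 + 4p + p(p-1) from the quadratic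
    polynomial, by 1 \<le> 8y^3, y \<le> 4y^3 and y^2 \<le> 2y^3 for y > 1/2.\<close>
  define K1 where "K1 = \<bar>p * (p - 1) * (p - 2)\<bar> * 2 powr \<bar>p - 3\<bar>"
  define K2 where "K2 = 16 + 4 * p + p * (p - 1)"
  have K: "0 \<le> K1" "0 \<le> K2" using assms by (simp_all add: K1_def K2_def)
  have "\<bar>(1 + z) powr p - (1 + p * z + p * (p - 1) / 2 * z\<^sup>2)\<bar> \<le> (K1 + K2) * (\<bar>z\<bar> ^ 3 * (1 + \<bar>z\<bar>) ^ m)"
    if z: "-1 \<le> z" for z
  proof (cases "\<bar>z\<bar> \<le> 1/2")
    case True
    define d where "d n x = (\<Prod>i<n. p - real i) * (1 + x) powr (p - real n)" for n :: nat and x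
    have "\<exists>t. \<bar>t\<bar> \<le> \<bar>z\<bar> \<and> d 0 z = (\<Sum>n<3. d n 0 / fact n * z ^ n) + d 3 t / fact 3 * z ^ 3"
    proof (rule Maclaurin_bi_le)
      show "\<forall>n t. n < 3 \<and> \<bar>t\<bar> \<le> \<bar>z\<bar> \<longrightarrow> DERIV (d n) t :> d (Suc n) t"
      proof (intro allI impI)
        fix n :: nat and t assume "n < 3 \<and> \<bar>t\<bar> \<le> \<bar>z\<bar>"
        then have "0 < 1 + t" using True by auto
        then show "DERIV (d n) t :> d (Suc n) t"
          unfolding d_def by (auto intro!: derivative_eq_intros simp: algebra_simps)
      qed
    qed simp
    then obtain t where t: "\<bar>t\<bar> \<le> \<bar>z\<bar>"
      and eq: "d 0 z = (\<Sum>n<3. d n 0 / fact n * z ^ n) + d 3 t / fact 3 * z ^ 3" by blast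
    have t2: "1/2 \<le> 1 + t" "1 + t \<le> 2" using t True by auto
    have pw: "(1 + t) powr (p - 3) \<le> 2 powr \<bar>p - 3\<bar>"
    proof (cases "0 \<le> p - 3")
      case True then show ?thesis using t2 by (auto intro: powr_mono2)
    next
      case False
      then have "(1 + t) powr (p - 3) \<le> (1/2) powr (p - 3)" using t2 by (intro powr_mono2') auto
      also have "\<dots> = 2 powr \<bar>p - 3\<bar>" using False powr_minus_divide[of 2 "p - 3"] by (simp add: powr_divide)
      finally show ?thesis .
    qed
    have "(1 + z) powr p - (1 + p * z + p * (p - 1) / 2 * z\<^sup>2) = d 3 t / 6 * z ^ 3"
      using eq by (simp add: d_def eval_nat_numeral lessThan_Suc algebra_simps)
    also have "\<bar>\<dots>\<bar> = \<bar>d 3 t\<bar> / 6 * \<bar>z\<bar> ^ 3" by (simp add: abs_mult power_abs)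
    also have "\<bar>d 3 t\<bar> \<le> K1"
      using pw by (simp add: d_def K1_def eval_nat_numeral lessThan_Suc abs_mult mult_left_mono mult.commute mult.left_commute)
    finally have "\<bar>(1 + z) powr p - (1 + p * z + p * (p - 1) / 2 * z\<^sup>2)\<bar> \<le> K1 / 6 * \<bar>z\<bar> ^ 3"
      by (simp add: mult_right_mono divide_right_mono)
    also have "\<dots> \<le> (K1 + K2) * \<bar>z\<bar> ^ 3" using K by (intro mult_right_mono) auto
    also have "\<dots> \<le> (K1 + K2) * (\<bar>z\<bar> ^ 3 * (1 + \<bar>z\<bar>) ^ m)"
    proof (rule mult_left_mono)
      have "1 \<le> (1 + \<bar>z\<bar>) ^ m" by (rule one_le_power) simp
      then show "\<bar>z\<bar> ^ 3 \<le> \<bar>z\<bar> ^ 3 * (1 + \<bar>z\<bar>) ^ m" by (simp add: mult_le_cancel_left1)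
    qed (use K in simp)
    finally show ?thesis .
  next
    case False
    define y where "y = \<bar>z\<bar>"
    have y: "1/2 < y" using False by (simp add: y_def)
    have y1: "1 \<le> 8 * y ^ 3" using power_mono[of "1/2" y 3] y by (simp add: power_divide)
    have y2: "y \<le> 4 * y ^ 3"
    proof -
      have "1 \<le> 4 * y\<^sup>2" using power_mono[of "1/2" y 2] y by (simp add: power_divide)
      then have "y * 1 \<le> y * (4 * y\<^sup>2)" using y by (intro mult_left_mono) auto
      then show ?thesis by (simp add: eval_nat_numeral)
    qed
    have y3: "y\<^sup>2 \<le> 2 * y ^ 3"
    proof -
      have "y\<^sup>2 * 1 \<le> y\<^sup>2 * (2 * y)" using y by (intro mult_left_mono) auto
      then show ?thesis by (simp add: eval_nat_numeral)
    qed
    have one: "1 \<le> (1 + y) ^ m" using y by (intro one_le_power) auto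
    have "(1 + z) powr p \<le> (1 + y) powr p"
      using z assms by (intro powr_mono2) (auto simp: y_def)
    also have "\<dots> \<le> (1 + y) powr real m" using y pm by (intro powr_mono) auto
    also have "\<dots> = (1 + y) ^ m" using y by (simp add: powr_realpow)
    also have "\<dots> \<le> (8 * y ^ 3) * (1 + y) ^ m" using mult_right_mono[OF y1, of "(1 + y) ^ m"] y by simp
    finally have b1: "(1 + z) powr p \<le> 8 * (y ^ 3 * (1 + y) ^ m)" by simp
    have c: "y ^ 3 \<le> y ^ 3 * (1 + y) ^ m" using mult_left_mono[OF one, of "y ^ 3"] y by simp
    have "\<bar>1 + p * z + p * (p - 1) / 2 * z\<^sup>2\<bar> \<le> 1 + p * y + p * (p - 1) / 2 * y\<^sup>2"
      using assms by (intro order_trans[OF abs_triangle_ineq] add_mono) (auto simp: y_def abs_mult intro!: order_trans[OF abs_triangle_ineq])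
    also have "\<dots> \<le> 8 * y ^ 3 + p * (4 * y ^ 3) + p * (p - 1) / 2 * (2 * y ^ 3)"
      using assms y1 y2 y3 by (intro add_mono mult_left_mono) auto
    also have "\<dots> = (8 + 4 * p + p * (p - 1)) * y ^ 3" by (simp add: field_simps)
    also have "\<dots> \<le> (8 + 4 * p + p * (p - 1)) * (y ^ 3 * (1 + y) ^ m)"
      using assms c by (intro mult_left_mono) auto
    finally have b2: "\<bar>1 + p * z + p * (p - 1) / 2 * z\<^sup>2\<bar> \<le> (8 + 4 * p + p * (p - 1)) * (y ^ 3 * (1 + y) ^ m)" .
    have "\<bar>(1 + z) powr p - (1 + p * z + p * (p - 1) / 2 * z\<^sup>2)\<bar>
        \<le> K2 * (y ^ 3 * (1 + y) ^ m)"
    proof (rule order_trans[OF abs_triangle_ineq4])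
      have "K2 * (y ^ 3 * (1 + y) ^ m) = 8 * (y ^ 3 * (1 + y) ^ m) + (8 + 4 * p + p * (p - 1)) * (y ^ 3 * (1 + y) ^ m)"
        by (simp add: K2_def algebra_simps)
      then show "\<bar>(1 + z) powr p\<bar> + \<bar>1 + p * z + p * (p - 1) / 2 * z\<^sup>2\<bar> \<le> K2 * (y ^ 3 * (1 + y) ^ m)"
        using b1 b2 by simp
    qed
    also have "\<dots> \<le> (K1 + K2) * (y ^ 3 * (1 + y) ^ m)" using K y by (intro mult_right_mono) auto
    finally show ?thesis by (simp add: y_def)
  qed
  then show ?thesis using K by (intro exI[of _ "K1 + K2"] conjI exI[of _ m]) auto
qed

text \<open>The base is 1 + z with z = 2ha + h^2(a^2 + b^2), and z^2 = 4h^2a^2 + O(h^3). No mixed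
  term in a and b survives to second order, and the remainder is split into a function of a plus a
  function of b. Hence, after a and b are replaced by random variables, only their marginal laws
  matter.\<close>

lemma powr_square_sum_taylor_bound:
  fixes p :: real
  assumes "1 \<le> p"
  shows "\<exists>K\<ge>0. \<exists>k. \<forall>h a b. 0 < h \<longrightarrow> h \<le> 1 \<longrightarrow>
    \<bar>((1 + h * a)\<^sup>2 + (h * b)\<^sup>2) powr p - (1 + p * (2 * (h * a) + (h * a)\<^sup>2 + (h * b)\<^sup>2) + 2 * p * (p - 1) * (h * a)\<^sup>2)\<bar>
      \<le> K * h ^ 3 * ((1 + \<bar>a\<bar>) ^ k + (1 + \<bar>b\<bar>) ^ k)"
proof -
  obtain K m where K: "0 \<le> K" and taylor: "\<And>z. -1 \<le> z \<Longrightarrow>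
      \<bar>(1 + z) powr p - (1 + p * z + p * (p - 1) / 2 * z\<^sup>2)\<bar> \<le> K * (\<bar>z\<bar> ^ 3 * (1 + \<bar>z\<bar>) ^ m)"
    using powr_taylor_bound[OF assms] by blast
  define L where "L = K + p * (p - 1) / 2 * 5"
  have L: "0 \<le> L" using K assms by (simp add: L_def)
  have "\<bar>((1 + h * a)\<^sup>2 + (h * b)\<^sup>2) powr p - (1 + p * (2 * (h * a) + (h * a)\<^sup>2 + (h * b)\<^sup>2) + 2 * p * (p - 1) * (h * a)\<^sup>2)\<bar>
      \<le> L * h ^ 3 * ((1 + \<bar>a\<bar>) ^ (4 * (m + 3)) + (1 + \<bar>b\<bar>) ^ (4 * (m + 3)))"
    if h: "0 < h" "h \<le> 1" for h a b
  proof -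
    define z where "z = 2 * (h * a) + (h * a)\<^sup>2 + (h * b)\<^sup>2"
    define s where "s = a\<^sup>2 + b\<^sup>2"
    define U V where "U = 1 + \<bar>a\<bar>" and "V = 1 + \<bar>b\<bar>"
    \<comment> \<open>One quantity that is at least 1 + 2|a| + a^2 + b^2, hence at least 1 + |z|
      when h \<le> 1; all remainders are then measured in powers of it.\<close>
    define P where "P = U\<^sup>2 * V\<^sup>2"
    have UV: "1 \<le> U" "1 \<le> V" by (simp_all add: U_def V_def)
    have base: "1 + z = (1 + h * a)\<^sup>2 + (h * b)\<^sup>2"
      by (simp add: z_def power2_eq_square algebra_simps)
    then have z1: "-1 \<le> z" by (smt (verit) zero_le_power2)
    have P1: "1 + 2 * \<bar>a\<bar> + s \<le> P"
    proof -
      have "1 + 2 * \<bar>a\<bar> + s \<le> U\<^sup>2 + 1 * (V\<^sup>2 - 1)"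
        by (simp add: s_def U_def V_def power2_eq_square algebra_simps)
      also have "\<dots> \<le> U\<^sup>2 + U\<^sup>2 * (V\<^sup>2 - 1)"
        using UV by (intro add_left_mono mult_right_mono) (auto intro: one_le_power)
      finally show ?thesis by (simp add: P_def algebra_simps)
    qed
    have s0: "0 \<le> s" by (simp add: s_def)
    have hp: "h\<^sup>2 \<le> h" using h by (simp add: power2_eq_square mult_left_le)
    have "\<bar>z\<bar> \<le> 2 * (h * \<bar>a\<bar>) + h\<^sup>2 * s"
    proof -
      have "z = 2 * (h * a) + h\<^sup>2 * s" by (simp add: z_def s_def power_mult_distrib algebra_simps)
      also have "\<bar>\<dots>\<bar> \<le> \<bar>2 * (h * a)\<bar> + \<bar>h\<^sup>2 * s\<bar>" by (rule abs_triangle_ineq)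
      finally show ?thesis using h s0 by (simp add: abs_mult)
    qed
    also have "\<dots> \<le> 2 * (h * \<bar>a\<bar>) + h * s" using hp s0 by (simp add: mult_right_mono)
    finally have z2: "\<bar>z\<bar> \<le> h * (2 * \<bar>a\<bar> + s)" by (simp add: algebra_simps)
    also have "\<dots> \<le> h * P" using P1 h by (intro mult_left_mono) auto
    finally have z3: "\<bar>z\<bar> \<le> h * P" .
    have "h * (2 * \<bar>a\<bar> + s) \<le> 1 * (2 * \<bar>a\<bar> + s)" using h s0 by (intro mult_right_mono) auto
    then have z4: "1 + \<bar>z\<bar> \<le> P" using order_trans[OF z2] P1 by fastforce
    have PP: "1 \<le> P" "s \<le> P" "2 * \<bar>a\<bar> \<le> P" using P1 s0 by auto
    have "\<bar>z\<bar> ^ 3 * (1 + \<bar>z\<bar>) ^ m \<le> (h * P) ^ 3 * P ^ m"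
      using z3 z4 h PP by (intro mult_mono power_mono) auto
    also have "\<dots> = h ^ 3 * P ^ (m + 3)" by (simp add: power_mult_distrib power_add)
    finally have r1: "\<bar>(1 + z) powr p - (1 + p * z + p * (p - 1) / 2 * z\<^sup>2)\<bar> \<le> K * (h ^ 3 * P ^ (m + 3))"
      using taylor[OF z1] K by (meson mult_left_mono order_trans)
    have zs: "z\<^sup>2 - 4 * (h * a)\<^sup>2 = h ^ 3 * (4 * a * s) + h ^ 4 * s\<^sup>2"
      by (simp add: z_def s_def eval_nat_numeral algebra_simps)
    have "\<bar>z\<^sup>2 - 4 * (h * a)\<^sup>2\<bar> \<le> h ^ 3 * (4 * \<bar>a\<bar> * s) + h ^ 4 * s\<^sup>2"
      unfolding zs using h s0 by (intro order_trans[OF abs_triangle_ineq] add_mono) (auto simp: abs_mult)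
    also have "\<dots> \<le> h ^ 3 * (4 * \<bar>a\<bar> * s) + h ^ 3 * s\<^sup>2"
      using h by (intro add_left_mono mult_right_mono power_decreasing) auto
    also have "\<dots> = h ^ 3 * (2 * (2 * \<bar>a\<bar>) * s + s * s)"
      by (simp add: power2_eq_square algebra_simps)
    also have "\<dots> \<le> h ^ 3 * (2 * P * P + P * P)"
      using h s0 PP by (intro mult_left_mono add_mono mult_mono) auto
    also have "\<dots> \<le> h ^ 3 * (5 * P ^ (m + 3))"
    proof -
      have "P\<^sup>2 \<le> P ^ (m + 3)" using PP by (intro power_increasing) auto
      then have "2 * P * P + P * P \<le> 5 * P ^ (m + 3)"
        using zero_le_power2[of P] unfolding power2_eq_square by linarith
      then show ?thesis using h by (intro mult_left_mono) auto
    qed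
    finally have r2: "\<bar>z\<^sup>2 - 4 * (h * a)\<^sup>2\<bar> \<le> h ^ 3 * (5 * P ^ (m + 3))" .
    have r3: "\<bar>p * (p - 1) / 2 * (z\<^sup>2 - 4 * (h * a)\<^sup>2)\<bar> \<le> p * (p - 1) / 2 * (h ^ 3 * (5 * P ^ (m + 3)))"
      using assms r2 by (simp add: abs_mult mult_left_mono)
    have "(1 + z) powr p - (1 + p * z + 2 * p * (p - 1) * (h * a)\<^sup>2) =
        ((1 + z) powr p - (1 + p * z + p * (p - 1) / 2 * z\<^sup>2)) + p * (p - 1) / 2 * (z\<^sup>2 - 4 * (h * a)\<^sup>2)"
      by (simp add: field_simps)
    then have "\<bar>(1 + z) powr p - (1 + p * z + 2 * p * (p - 1) * (h * a)\<^sup>2)\<bar> \<le>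
        K * (h ^ 3 * P ^ (m + 3)) + p * (p - 1) / 2 * (h ^ 3 * (5 * P ^ (m + 3)))"
      using order_trans[OF abs_triangle_ineq add_mono[OF r1 r3]] by (simp only:)
    also have "\<dots> = L * h ^ 3 * P ^ (m + 3)" by (simp add: L_def algebra_simps)
    also have "\<dots> \<le> L * h ^ 3 * (U ^ (4 * (m + 3)) + V ^ (4 * (m + 3)))"
    proof (rule mult_left_mono)
      have *: "u\<^sup>2 * v\<^sup>2 \<le> u ^ 4 + v ^ 4" for u v :: real
      proof -
        have "2 * (u\<^sup>2 * v\<^sup>2) \<le> u ^ 4 + v ^ 4"
          using sum_squares_bound[of "u\<^sup>2" "v\<^sup>2"] by (simp add: power_mult[symmetric] mult.assoc)
        moreover have "0 \<le> u\<^sup>2 * v\<^sup>2" by simp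
        ultimately show ?thesis by linarith
      qed
      have "P ^ (m + 3) = (U ^ (m + 3))\<^sup>2 * (V ^ (m + 3))\<^sup>2"
        by (simp add: P_def power_mult_distrib power_mult[symmetric] mult.commute)
      also have "\<dots> \<le> (U ^ (m + 3)) ^ 4 + (V ^ (m + 3)) ^ 4" by (rule *)
      finally show "P ^ (m + 3) \<le> U ^ (4 * (m + 3)) + V ^ (4 * (m + 3))"
        by (simp add: power_mult[symmetric] mult.commute)
    qed (use L h in auto)
    finally show ?thesis unfolding base unfolding z_def U_def V_def .
  qed
  then show ?thesis using L by blast
qed

text \<open>The second-order coefficient is p(1/4 + 3/4) + 2p(p-1)/4 = p(p+1)/2. Neither
  independence nor joint normality of \<open>X\<close> and \<open>Y\<close> is assumed. The constant
  \<open>K\<close> serves all h, \<open>X\<close> and \<open>Y\<close>, and with h^2 as time step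
  the error h^3 is negligible when 1/h^2 such steps are compounded.\<close>

lemma (in prob_space) normal_square_sum_moment:
  fixes p :: real
  assumes p: "1 \<le> p"
  obtains K where "0 \<le> K" and
    "\<And>h X Y. 0 < h \<Longrightarrow> h \<le> 1 \<Longrightarrow> X \<in> borel_measurable M \<Longrightarrow> Y \<in> borel_measurable M \<Longrightarrow>
      distr M borel X = normal_law (1 / 4 * h\<^sup>2) \<Longrightarrow> distr M borel Y = normal_law (3 / 4 * h\<^sup>2) \<Longrightarrow>
      integrable M (\<lambda>w. ((1 + X w)\<^sup>2 + (Y w)\<^sup>2) powr p) \<and>
      \<bar>(\<integral>w. ((1 + X w)\<^sup>2 + (Y w)\<^sup>2) powr p \<partial>M) - (1 + p * (p + 1) / 2 * h\<^sup>2)\<bar> \<le> K * h ^ 3"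
proof -
  obtain L k where L: "0 \<le> L" and taylor: "\<And>h a b. 0 < h \<Longrightarrow> h \<le> 1 \<Longrightarrow>
    \<bar>((1 + h * a)\<^sup>2 + (h * b)\<^sup>2) powr p - (1 + p * (2 * (h * a) + (h * a)\<^sup>2 + (h * b)\<^sup>2) + 2 * p * (p - 1) * (h * a)\<^sup>2)\<bar>
      \<le> L * h ^ 3 * ((1 + \<bar>a\<bar>) ^ k + (1 + \<bar>b\<bar>) ^ k)"
    using powr_square_sum_taylor_bound[OF p] by blast
  define m where "m = (\<integral>x. (1 + \<bar>x\<bar>) ^ k \<partial>std_normal_distribution)"
  have m0: "0 \<le> m" unfolding m_def by (rule Bochner_Integration.integral_nonneg) simp
  have scaled: "integrable M (\<lambda>w. (1 + \<bar>X w / h\<bar>) ^ k) \<and> (\<integral>w. (1 + \<bar>X w / h\<bar>) ^ k \<partial>M) \<le> m"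
    \<comment> \<open>\<open>X / h\<close> has variance c \<le> 1, so its moments are dominated by
      the standard normal ones uniformly in h. The two uses have c = 1/4 and c = 3/4.\<close>
    if h: "0 < h" and X: "X \<in> borel_measurable M" "distr M borel X = normal_law (c * h\<^sup>2)" and c: "0 \<le> c" "c \<le> 1" for h X c
  proof -
    have f: "(\<lambda>x. (1 + \<bar>x / h\<bar>) ^ k) \<in> borel_measurable borel" by measurable
    have v: "0 \<le> c * h\<^sup>2" using c by simp
    have s: "sqrt (c * h\<^sup>2) * x / h = sqrt c * x" for x using h by (simp add: real_sqrt_mult)
    note I = normal_law_integral[OF X(1) f X(2) v, unfolded s]
    have le: "(1 + \<bar>sqrt c * x\<bar>) ^ k \<le> (1 + \<bar>x\<bar>) ^ k" for x
    proof -
      have "\<bar>sqrt c * x\<bar> \<le> 1 * \<bar>x\<bar>" unfolding abs_mult using c by (intro mult_right_mono) auto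
      then show ?thesis by (intro power_mono) auto
    qed
    note i = integrable_std_normal_one_plus_abs_power[of k]
    have i': "integrable std_normal_distribution (\<lambda>x. (1 + \<bar>sqrt c * x\<bar>) ^ k)"
      by (rule Bochner_Integration.integrable_bound[OF i]) (auto intro!: AE_I2 le)
    show ?thesis using I i' integral_mono[OF i' i le] by (simp add: m_def)
  qed
  have moments: "integrable M X \<and> integrable M (\<lambda>w. (X w)\<^sup>2) \<and> expectation X = 0 \<and> (\<integral>w. (X w)\<^sup>2 \<partial>M) = v"
    if X: "X \<in> borel_measurable M" "distr M borel X = normal_law v" and v: "0 \<le> v" for X v
  proof -
    note I = normal_law_integral[OF X(1) _ X(2) v]
    have "integrable M X" "expectation X = 0"
      using I[of "\<lambda>x. x"] integrable_std_normal_distribution_moment[of 1] integral_std_normal_distribution_moment_odd[of 1]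
      by simp_all
    moreover have "integrable M (\<lambda>w. (X w)\<^sup>2)" "(\<integral>w. (X w)\<^sup>2 \<partial>M) = v"
      using I[of "\<lambda>x. x\<^sup>2"] integrable_std_normal_distribution_moment[of 2] std_normal_distribution_even_moments(1)[of 1] v
      by (simp_all add: power_mult_distrib)
    ultimately show ?thesis by simp
  qed
  show thesis
  proof (rule that)
    show "0 \<le> 2 * L * m" using L m0 by simp
    fix h :: real and X Y
    assume h: "0 < h" "h \<le> 1" and [measurable]: "X \<in> borel_measurable M" "Y \<in> borel_measurable M"
      and law: "distr M borel X = normal_law (1 / 4 * h\<^sup>2)" "distr M borel Y = normal_law (3 / 4 * h\<^sup>2)"
    note sX = scaled[OF h(1) _ law(1)] and sY = scaled[OF h(1) _ law(2)]
    note mX = moments[OF _ law(1)] and mY = moments[OF _ law(2)]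
    let ?f = "\<lambda>w. ((1 + X w)\<^sup>2 + (Y w)\<^sup>2) powr p"
    define g where "g w = 1 + p * (2 * X w + (X w)\<^sup>2 + (Y w)\<^sup>2) + 2 * p * (p - 1) * (X w)\<^sup>2" for w
    define b where "b w = L * h ^ 3 * ((1 + \<bar>X w / h\<bar>) ^ k + (1 + \<bar>Y w / h\<bar>) ^ k)" for w
    have bound: "\<bar>?f w - g w\<bar> \<le> b w" for w
      using taylor[OF h, of "X w / h" "Y w / h"] h by (simp add: g_def b_def)
    have bi: "integrable M b" "integral\<^sup>L M b \<le> 2 * L * m * h ^ 3"
    proof -
      show "integrable M b" unfolding b_def using sX sY by simp
      have "integral\<^sup>L M b = L * h ^ 3 * ((\<integral>w. (1 + \<bar>X w / h\<bar>) ^ k \<partial>M) + (\<integral>w. (1 + \<bar>Y w / h\<bar>) ^ k \<partial>M))"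
        unfolding b_def using sX sY by simp
      also have "\<dots> \<le> L * h ^ 3 * (m + m)" using sX sY L h by (intro mult_left_mono add_mono) auto
      finally show "integral\<^sup>L M b \<le> 2 * L * m * h ^ 3" by (simp add: algebra_simps)
    qed
    have gi: "integrable M g" unfolding g_def using mX mY by simp
    have v: "(\<integral>w. (X w)\<^sup>2 \<partial>M) = 1 / 4 * h\<^sup>2" "(\<integral>w. (Y w)\<^sup>2 \<partial>M) = 3 / 4 * h\<^sup>2" using mX mY by simp_all
    have "integral\<^sup>L M g = 1 + p * ((\<integral>w. (X w)\<^sup>2 \<partial>M) + (\<integral>w. (Y w)\<^sup>2 \<partial>M)) + 2 * p * (p - 1) * (\<integral>w. (X w)\<^sup>2 \<partial>M)"
      unfolding g_def using mX mY by (simp add: prob_space)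
    also have "\<dots> = 1 + p * (1 / 4 * h\<^sup>2 + 3 / 4 * h\<^sup>2) + 2 * p * (p - 1) * (1 / 4 * h\<^sup>2)"
      unfolding v ..
    also have "\<dots> = 1 + p * (p + 1) / 2 * h\<^sup>2" by (simp add: field_simps)
    finally have gE: "integral\<^sup>L M g = 1 + p * (p + 1) / 2 * h\<^sup>2" .
    have gm: "g \<in> borel_measurable M" unfolding g_def by measurable
    have di: "integrable M (\<lambda>w. ?f w - g w)"
      by (rule Bochner_Integration.integrable_bound[OF bi(1)])
        (use gm bound in \<open>auto intro!: AE_I2 order_trans[OF bound abs_ge_self]\<close>)
    have fi: "integrable M ?f" using Bochner_Integration.integrable_add[OF di gi] by simp
    have "\<bar>integral\<^sup>L M ?f - integral\<^sup>L M g\<bar> = \<bar>\<integral>w. ?f w - g w \<partial>M\<bar>" using fi gi by simp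
    also have "\<dots> \<le> (\<integral>w. \<bar>?f w - g w\<bar> \<partial>M)" by (rule integral_abs_bound)
    also have "\<dots> \<le> integral\<^sup>L M b" by (rule integral_mono[OF _ bi(1) bound]) (use di in auto)
    finally show "integrable M ?f \<and> \<bar>integral\<^sup>L M ?f - (1 + p * (p + 1) / 2 * h\<^sup>2)\<bar> \<le> 2 * L * m * h ^ 3"
      using fi bi(2) unfolding gE by simp
  qed
qed

section \<open>Increments of the Brownian motion\<close>

context sl2_brownian_motion
begin

abbreviation increment :: "real \<Rightarrow> real \<Rightarrow> 'w \<Rightarrow> mat2" where
  "increment s t w \<equiv> B t w - B s w"

text \<open>The quadratic form of the covariance of \<open>B\<close>, evaluated at \<open>A\<close>.
  \<open>B_normal\<close> only asserts that a rate exists for each \<open>A\<close>; the choice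
  makes it a function of \<open>A\<close>, and the second moment of the increments identifies its
  value.\<close>

definition variance_rate :: "mat2 \<Rightarrow> real" where
  "variance_rate A = (SOME v. 0 \<le> v \<and> (\<forall>s t. 0 \<le> s \<longrightarrow> s \<le> t \<longrightarrow>
     distr M borel (\<lambda>w. A \<bullet> (B t w - B s w)) = normal_law (v * (t - s))))"

lemma variance_rate_nonneg: "0 \<le> variance_rate A"
  and increment_law: "0 \<le> s \<Longrightarrow> s \<le> t \<Longrightarrow>
    distr M borel (\<lambda>w. A \<bullet> increment s t w) = normal_law (variance_rate A * (t - s))"
proof -
  have "0 \<le> variance_rate A \<and> (\<forall>s t. 0 \<le> s \<longrightarrow> s \<le> t \<longrightarrow>
     distr M borel (\<lambda>w. A \<bullet> (B t w - B s w)) = normal_law (variance_rate A * (t - s)))"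
    unfolding variance_rate_def by (rule someI_ex) (use B_normal[of A] in blast)
  then show "0 \<le> variance_rate A" and "0 \<le> s \<Longrightarrow> s \<le> t \<Longrightarrow>
    distr M borel (\<lambda>w. A \<bullet> increment s t w) = normal_law (variance_rate A * (t - s))"
    by auto
qed

lemma measurable_G_M: "0 \<le> t \<Longrightarrow> X \<in> borel_measurable (G t) \<Longrightarrow> X \<in> borel_measurable M"
  by (rule measurable_from_subalg[OF subalg])

lemma measurable_G_mono:
  assumes "0 \<le> s" "s \<le> t" "X \<in> borel_measurable (G s)"
  shows "X \<in> borel_measurable (G t)"
proof (rule measurable_from_subalg)
  have "space (G s) = space M" "space (G t) = space M"
    using subalg[of s] subalg[of t] assms by (auto simp: subalgebra_def)
  then show "subalgebra (G t) (G s)" using G_mono[of s t] assms by (auto simp: subalgebra_def)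
qed fact

lemma B_adapted: "0 \<le> t \<Longrightarrow> B t \<in> borel_measurable (G t)"
  using B_cont_adapted by (simp add: continuous_adapted_def)

lemma B_measurable [measurable]: "0 \<le> t \<Longrightarrow> B t \<in> borel_measurable M"
  using B_adapted measurable_G_M by blast

lemma increment_measurable_M: "0 \<le> s \<Longrightarrow> s \<le> t \<Longrightarrow> increment s t \<in> borel_measurable M"
  by measurable

lemma increment_measurable:
  assumes "0 \<le> s" "s \<le> t" shows "increment s t \<in> borel_measurable (G t)"
  using B_adapted[of t] measurable_G_mono[OF assms B_adapted[OF assms(1)]] assms
  by (intro borel_measurable_diff) auto

text \<open>\<open>B_indep\<close> speaks of sigma-algebras; this is its form for random variables,
  with any state space for the past, so that a whole matrix known at time s may be paired with the
  increment.\<close>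

lemma indep_var_increment:
  assumes st: "0 \<le> s" "s \<le> t" and X: "X \<in> measurable (G s) N" and g: "g \<in> measurable borel T"
  shows "indep_var N X T (\<lambda>w. g (increment s t w))"
  unfolding indep_var_eq
proof (intro conjI)
  have sp: "space (G s) = space M" using subalg[of s] st by (auto simp: subalgebra_def)
  show "X \<in> measurable M N" using measurable_from_subalg[OF subalg X] st by simp
  show "(\<lambda>w. g (increment s t w)) \<in> measurable M T"
    by (rule measurable_compose[OF increment_measurable_M[OF st] g])
  let ?V = "vimage_algebra (space M) (increment s t) borel"
  have gV: "(\<lambda>w. g (increment s t w)) \<in> measurable ?V T"
    by (rule measurable_compose[OF measurable_vimage_algebra1 g]) simp
  have a: "sigma_sets (space M) {X -` A \<inter> space M |A. A \<in> sets N} \<subseteq> sets (G s)"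
    using X sp by (intro sets.sigma_sets_subset[of _ "G s", unfolded sp]) (auto intro: measurable_sets[of X "G s", unfolded sp])
  have b: "sigma_sets (space M) {(\<lambda>w. g (increment s t w)) -` A \<inter> space M |A. A \<in> sets T} \<subseteq> sets ?V"
    using gV by (intro sets.sigma_sets_subset[of _ ?V, unfolded space_vimage_algebra])
      (auto intro: measurable_sets[of _ ?V, unfolded space_vimage_algebra])
  show "indep_set (sigma_sets (space M) {X -` A \<inter> space M |A. A \<in> sets N})
     (sigma_sets (space M) {(\<lambda>w. g (increment s t w)) -` A \<inter> space M |A. A \<in> sets T})"
    using B_indep[OF st] a b unfolding indep_sets2_eq by blast
qed

lemma indep_increment_mult:
  fixes X :: "'w \<Rightarrow> real" and g :: "mat2 \<Rightarrow> real"
  assumes st: "0 \<le> s" "s \<le> t" and X: "X \<in> borel_measurable (G s)" "integrable M X"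
    and g: "g \<in> borel_measurable borel" "integrable M (\<lambda>w. g (increment s t w))"
  shows "integrable M (\<lambda>w. X w * g (increment s t w))"
    and "(\<integral>w. X w * g (increment s t w) \<partial>M) = (\<integral>w. X w \<partial>M) * (\<integral>w. g (increment s t w) \<partial>M)"
proof -
  note i = indep_var_increment[OF st X(1) g(1)]
  show "integrable M (\<lambda>w. X w * g (increment s t w))"
    by (rule indep_var_integrable[OF i X(2) g(2)])
  show "(\<integral>w. X w * g (increment s t w) \<partial>M) = (\<integral>w. X w \<partial>M) * (\<integral>w. g (increment s t w) \<partial>M)"
    by (rule indep_var_lebesgue_integral[OF i X(2) g(2)])
qed

lemma increment_moments:
  assumes st: "0 \<le> s" "s \<le> t"
  shows "integrable M (\<lambda>w. (A \<bullet> increment s t w) ^ k)"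
    and "(\<integral>w. A \<bullet> increment s t w \<partial>M) = 0"
    and "(\<integral>w. (A \<bullet> increment s t w)\<^sup>2 \<partial>M) = variance_rate A * (t - s)"
    and "(\<integral>w. (A \<bullet> increment s t w) ^ 4 \<partial>M) = 3 * (variance_rate A * (t - s))\<^sup>2"
proof -
  define v where "v = variance_rate A * (t - s)"
  have v: "0 \<le> v" using st variance_rate_nonneg[of A] by (simp add: v_def)
  have m: "(\<lambda>w. A \<bullet> increment s t w) \<in> borel_measurable M"
    using increment_measurable_M[OF st] by measurable
  note law = increment_law[OF st, of A, folded v_def]
  note I = normal_law_integral[OF m _ law v]
  show "integrable M (\<lambda>w. (A \<bullet> increment s t w) ^ k)"
    using I(1)[of "\<lambda>x. x ^ k"] integrable_std_normal_distribution_moment[of k]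
    by (simp add: power_mult_distrib)
  have "(\<integral>w. A \<bullet> increment s t w \<partial>M) = sqrt v * (\<integral>x. x \<partial>std_normal_distribution)"
    using I(2)[of "\<lambda>x. x"] by simp
  then show "(\<integral>w. A \<bullet> increment s t w \<partial>M) = 0"
    using integral_std_normal_distribution_moment_odd[of 1] by simp
  show "(\<integral>w. (A \<bullet> increment s t w)\<^sup>2 \<partial>M) = variance_rate A * (t - s)"
    using I(2)[of "\<lambda>x. x\<^sup>2"] std_normal_distribution_even_moments(1)[of 1] v
    by (simp add: power_mult_distrib v_def)
  have "(\<integral>x. x ^ 4 \<partial>std_normal_distribution) = 3"
    using std_normal_distribution_even_moments(1)[of 2] by (simp add: fact_numeral)
  moreover have "sqrt v ^ 4 = v\<^sup>2" using v real_sqrt_pow2[OF v]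
    by (metis numeral_Bit0 power_even_eq mult_2)
  ultimately show "(\<integral>w. (A \<bullet> increment s t w) ^ 4 \<partial>M) = 3 * (variance_rate A * (t - s))\<^sup>2"
    using I(2)[of "\<lambda>x. x ^ 4"] by (simp add: power_mult_distrib v_def)
qed

text \<open>The trace of the covariance. The L^2 estimates need only that it is a finite constant,
  so they are available before the covariance has been determined.\<close>

definition total_rate :: real where
  "total_rate = variance_rate (unit_mat 1 1) + variance_rate (unit_mat 1 2)
     + variance_rate (unit_mat 2 1) + variance_rate (unit_mat 2 2)"

lemma total_rate_nonneg: "0 \<le> total_rate"
  unfolding total_rate_def by (intro add_nonneg_nonneg variance_rate_nonneg)

lemma increment_entry_integrable:
  "0 \<le> s \<Longrightarrow> s \<le> t \<Longrightarrow> integrable M (\<lambda>w. (increment s t w $ i $ j) ^ k)"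
  "0 \<le> s \<Longrightarrow> s \<le> t \<Longrightarrow> integrable M (\<lambda>w. increment s t w $ i $ j)"
  using increment_moments(1)[of s t "unit_mat i j"] increment_moments(1)[of s t "unit_mat i j" 1] by simp_all

text \<open>The entries are dependent in an unknown way, so the fourth moment is only bounded: 12 is
  4, from Cauchy-Schwarz over the four entries, times 3, the fourth moment of a standard normal
  variable.\<close>

lemma increment_norm_moments:
  assumes st: "0 \<le> s" "s \<le> t"
  shows "integrable M (\<lambda>w. (norm (increment s t w))\<^sup>2)"
    and "(\<integral>w. (norm (increment s t w))\<^sup>2 \<partial>M) = total_rate * (t - s)"
    and "integrable M (\<lambda>w. (norm (increment s t w)) ^ 4)"
    and "(\<integral>w. (norm (increment s t w)) ^ 4 \<partial>M) \<le> 12 * (total_rate * (t - s))\<^sup>2"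
proof -
  note i2 = increment_entry_integrable(1)[OF st, of _ _ 2]
  note i4 = increment_entry_integrable(1)[OF st, of _ _ 4]
  note [measurable] = increment_measurable_M[OF st]
  have e2: "(\<integral>w. (increment s t w $ i $ j)\<^sup>2 \<partial>M) = variance_rate (unit_mat i j) * (t - s)" for i j
    using increment_moments(3)[OF st, of "unit_mat i j"] by simp
  have e4: "(\<integral>w. (increment s t w $ i $ j) ^ 4 \<partial>M) = 3 * (variance_rate (unit_mat i j) * (t - s))\<^sup>2" for i j
    using increment_moments(4)[OF st, of "unit_mat i j"] by simp
  show "integrable M (\<lambda>w. (norm (increment s t w))\<^sup>2)"
    unfolding norm_mat2_squared by (intro Bochner_Integration.integrable_add i2)
  show "(\<integral>w. (norm (increment s t w))\<^sup>2 \<partial>M) = total_rate * (t - s)"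
  proof -
    have "(\<integral>w. (norm (increment s t w))\<^sup>2 \<partial>M) = (\<integral>w. (increment s t w $ 1 $ 1)\<^sup>2 \<partial>M)
        + (\<integral>w. (increment s t w $ 1 $ 2)\<^sup>2 \<partial>M) + (\<integral>w. (increment s t w $ 2 $ 1)\<^sup>2 \<partial>M)
        + (\<integral>w. (increment s t w $ 2 $ 2)\<^sup>2 \<partial>M)"
      unfolding norm_mat2_squared using i2 by simp
    also have "\<dots> = total_rate * (t - s)"
      unfolding e2 total_rate_def by (simp add: algebra_simps)
    finally show ?thesis .
  qed
  define q where "q w = 4 * ((increment s t w $ 1 $ 1) ^ 4 + (increment s t w $ 1 $ 2) ^ 4
     + (increment s t w $ 2 $ 1) ^ 4 + (increment s t w $ 2 $ 2) ^ 4)" for w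
  have four: "(a\<^sup>2 + b\<^sup>2 + c\<^sup>2 + d\<^sup>2)\<^sup>2 \<le> 4 * (a ^ 4 + b ^ 4 + c ^ 4 + d ^ 4)" for a b c d :: real
  proof -
    have *: "(x + y + z + u)\<^sup>2 \<le> 4 * (x\<^sup>2 + y\<^sup>2 + z\<^sup>2 + u\<^sup>2)" for x y z u :: real
      using sum_squares_bound[of x y] sum_squares_bound[of x z] sum_squares_bound[of x u]
        sum_squares_bound[of y z] sum_squares_bound[of y u] sum_squares_bound[of z u]
      by (simp add: power2_eq_square algebra_simps)
    show ?thesis using *[of "a\<^sup>2" "b\<^sup>2" "c\<^sup>2" "d\<^sup>2"] by (simp add: power_mult[symmetric])
  qed
  have pt: "(norm (increment s t w)) ^ 4 \<le> q w" for w
  proof -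
    have "(norm (increment s t w)) ^ 4 = ((norm (increment s t w))\<^sup>2)\<^sup>2" by (simp add: power_mult[symmetric])
    also have "\<dots> \<le> q w" unfolding q_def norm_mat2_squared by (rule four)
    finally show ?thesis .
  qed
  have qi: "integrable M q" unfolding q_def using i4 by auto
  show n4: "integrable M (\<lambda>w. (norm (increment s t w)) ^ 4)"
    by (rule Bochner_Integration.integrable_bound[OF qi]) (auto intro!: AE_I2 order_trans[OF pt])
  have "(\<integral>w. (norm (increment s t w)) ^ 4 \<partial>M) \<le> integral\<^sup>L M q"
    by (rule integral_mono[OF n4 qi pt])
  also have "\<dots> = 12 * ((variance_rate (unit_mat 1 1))\<^sup>2 + (variance_rate (unit_mat 1 2))\<^sup>2
     + (variance_rate (unit_mat 2 1))\<^sup>2 + (variance_rate (unit_mat 2 2))\<^sup>2) * (t - s)\<^sup>2"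
  proof -
    have "integral\<^sup>L M q = 4 * ((\<integral>w. (increment s t w $ 1 $ 1) ^ 4 \<partial>M)
        + (\<integral>w. (increment s t w $ 1 $ 2) ^ 4 \<partial>M) + (\<integral>w. (increment s t w $ 2 $ 1) ^ 4 \<partial>M)
        + (\<integral>w. (increment s t w $ 2 $ 2) ^ 4 \<partial>M))"
      unfolding q_def using i4 by simp
    then show ?thesis unfolding e4 power_mult_distrib by (simp add: algebra_simps)
  qed
  also have "\<dots> \<le> 12 * total_rate\<^sup>2 * (t - s)\<^sup>2"
  proof (intro mult_right_mono mult_left_mono)
    have *: "x\<^sup>2 + y\<^sup>2 + z\<^sup>2 + u\<^sup>2 \<le> (x + y + z + u)\<^sup>2" if "0 \<le> x" "0 \<le> y" "0 \<le> z" "0 \<le> u" for x y z u :: real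
      using that by (simp add: power2_eq_square algebra_simps)
    show "(variance_rate (unit_mat 1 1))\<^sup>2 + (variance_rate (unit_mat 1 2))\<^sup>2
     + (variance_rate (unit_mat 2 1))\<^sup>2 + (variance_rate (unit_mat 2 2))\<^sup>2 \<le> total_rate\<^sup>2"
      unfolding total_rate_def by (intro * variance_rate_nonneg)
  qed auto
  finally show "(\<integral>w. (norm (increment s t w)) ^ 4 \<partial>M) \<le> 12 * (total_rate * (t - s))\<^sup>2"
    by (simp add: power_mult_distrib mult.assoc)
qed

text \<open>The martingale property in the form that removes the cross terms between successive
  summands of a discrete integral.\<close>

lemma indep_increment_inner:
  assumes st: "0 \<le> s" "s \<le> t" and W: "W \<in> borel_measurable (G s)" "integrable M (\<lambda>w. norm (W w))"
  shows "integrable M (\<lambda>w. W w \<bullet> increment s t w)" "(\<integral>w. W w \<bullet> increment s t w \<partial>M) = 0"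
proof -
  have Wij: "(\<lambda>w. W w $ i $ j) \<in> borel_measurable (G s)" for i j using W(1) by measurable
  have [measurable]: "W \<in> borel_measurable M" using measurable_G_M[OF st(1) W(1)] .
  have Wi: "integrable M (\<lambda>w. W w $ i $ j)" for i j
    by (rule Bochner_Integration.integrable_bound[OF W(2)])
      (auto intro!: AE_I2 order_trans[OF component_le_norm_cart] simp: order_trans[OF norm_nth_le norm_nth_le] Finite_Cartesian_Product.norm_nth_le)
  have g: "(\<lambda>A::mat2. A $ i $ j) \<in> borel_measurable borel" for i j by measurable
  note p = indep_increment_mult[OF st Wij Wi g increment_entry_integrable(2)[OF st]]
  have z: "(\<integral>w. increment s t w $ i $ j \<partial>M) = 0" for i j
    using increment_moments(2)[OF st, of "unit_mat i j"] by simp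
  show "integrable M (\<lambda>w. W w \<bullet> increment s t w)" unfolding inner_mat2 using p(1) by auto
  show "(\<integral>w. W w \<bullet> increment s t w \<partial>M) = 0" unfolding inner_mat2 using p z by simp
qed

lemma indep_increment_matrix_mult:
  assumes st: "0 \<le> s" "s \<le> t" and X: "X \<in> borel_measurable (G s)" "integrable M (\<lambda>w. (norm (X w))\<^sup>2)"
  shows "integrable M (\<lambda>w. (norm (X w ** increment s t w))\<^sup>2)"
    and "(\<integral>w. (norm (X w ** increment s t w))\<^sup>2 \<partial>M) \<le> total_rate * ((\<integral>w. (norm (X w))\<^sup>2 \<partial>M) * (t - s))"
proof -
  note [measurable] = increment_measurable_M[OF st] measurable_G_M[OF st(1) X(1)]
  have X2: "(\<lambda>w. (norm (X w))\<^sup>2) \<in> borel_measurable (G s)" using X(1) by measurable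
  have g: "(\<lambda>A::mat2. (norm A)\<^sup>2) \<in> borel_measurable borel" by measurable
  note p = indep_increment_mult[OF st X2 X(2) g increment_norm_moments(1)[OF st]]
  have pt: "(norm (X w ** increment s t w))\<^sup>2 \<le> (norm (X w))\<^sup>2 * (norm (increment s t w))\<^sup>2" for w
    unfolding power_mult_distrib[symmetric] by (intro power_mono norm_matrix_mult_le) simp
  show i: "integrable M (\<lambda>w. (norm (X w ** increment s t w))\<^sup>2)"
    by (rule Bochner_Integration.integrable_bound[OF p(1)]) (auto intro!: AE_I2 pt)
  show "(\<integral>w. (norm (X w ** increment s t w))\<^sup>2 \<partial>M) \<le> total_rate * ((\<integral>w. (norm (X w))\<^sup>2 \<partial>M) * (t - s))"
    using integral_mono[OF i p(1) pt] p(2) increment_norm_moments(2)[OF st] by (simp add: ac_simps)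
qed

text \<open>The Ito isometry for sums, weakened to an inequality: the last summand is orthogonal to
  the sum of the earlier ones, and submultiplicativity of the norm accounts for the factor
  \<open>total_rate\<close>.\<close>

lemma discrete_integral_second_moment:
  fixes X :: "nat \<Rightarrow> 'w \<Rightarrow> mat2"
  assumes r: "0 \<le> r 0" "mono r"
    and X: "\<And>j. j < n \<Longrightarrow> X j \<in> borel_measurable (G (r j))"
      "\<And>j. j < n \<Longrightarrow> integrable M (\<lambda>w. (norm (X j w))\<^sup>2)"
  defines "S \<equiv> \<lambda>n w. \<Sum>j<n. X j w ** increment (r j) (r (Suc j)) w"
  shows "S n \<in> borel_measurable (G (r n)) \<and> integrable M (\<lambda>w. (norm (S n w))\<^sup>2) \<and>
    (\<integral>w. (norm (S n w))\<^sup>2 \<partial>M) \<le> total_rate * (\<Sum>j<n. (\<integral>w. (norm (X j w))\<^sup>2 \<partial>M) * (r (Suc j) - r j))"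
  using X
proof (induction n)
  case 0
  show ?case by (simp add: S_def)
next
  case (Suc n)
  have rn: "0 \<le> r n" for n using r monoD[OF r(2), of 0 n] by simp
  have st: "0 \<le> r n" "r n \<le> r (Suc n)" using rn monoD[OF r(2), of n "Suc n"] by auto
  note Xn = Suc.prems(1)[OF lessI] Suc.prems(2)[OF lessI]
  define Z where "Z w = X n w ** increment (r n) (r (Suc n)) w" for w
  have IH: "S n \<in> borel_measurable (G (r n))" "integrable M (\<lambda>w. (norm (S n w))\<^sup>2)"
    "(\<integral>w. (norm (S n w))\<^sup>2 \<partial>M) \<le> total_rate * (\<Sum>j<n. (\<integral>w. (norm (X j w))\<^sup>2 \<partial>M) * (r (Suc j) - r j))"
    using Suc.IH[OF Suc.prems] by auto
  have SZ: "S (Suc n) = (\<lambda>w. S n w + Z w)" by (simp add: S_def Z_def)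
  note [measurable] = measurable_G_M[OF st(1) IH(1)] measurable_G_M[OF st(1) Xn(1)] increment_measurable_M[OF st]
  have [measurable]: "Z \<in> borel_measurable M" unfolding Z_def by measurable
  note Z2 = indep_increment_matrix_mult[OF st Xn, folded Z_def]
  have cross: "integrable M (\<lambda>w. S n w \<bullet> Z w)" "(\<integral>w. S n w \<bullet> Z w \<partial>M) = 0"
  proof -
    \<comment> \<open>Moving \<open>X n\<close> across the inner product leaves the bare increment
      on one side. \<open>W\<close> is known at time \<open>r n\<close>, and it is integrable as a
      product of two square integrable factors.\<close>
    define W where "W w = transpose (X n w) ** S n w" for w
    have Wm: "W \<in> borel_measurable (G (r n))" unfolding W_def using Xn(1) IH(1) by measurable
    have pt: "norm (W w) \<le> (norm (X n w))\<^sup>2 + (norm (S n w))\<^sup>2" for w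
    proof -
      have "norm (W w) \<le> norm (X n w) * norm (S n w)"
        unfolding W_def by (rule order_trans[OF norm_matrix_mult_le]) (simp add: norm_transpose_mat2)
      also have "\<dots> \<le> (norm (X n w))\<^sup>2 + (norm (S n w))\<^sup>2"
        using sum_squares_bound[of "norm (X n w)" "norm (S n w)"] mult_nonneg_nonneg[OF norm_ge_zero[of "X n w"] norm_ge_zero[of "S n w"]]
        by linarith
      finally show ?thesis .
    qed
    have "integrable M (\<lambda>w. norm (W w))"
      by (rule Bochner_Integration.integrable_bound[OF Bochner_Integration.integrable_add[OF Xn(2) IH(2)]])
        (use pt measurable_G_M[OF st(1) Wm] in \<open>auto intro!: AE_I2\<close>)
    from indep_increment_inner[OF st Wm this]
    show "integrable M (\<lambda>w. S n w \<bullet> Z w)" "(\<integral>w. S n w \<bullet> Z w \<partial>M) = 0"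
      unfolding Z_def W_def inner_matrix_mult .
  qed
  have eq: "(norm (S n w + Z w))\<^sup>2 = (norm (S n w))\<^sup>2 + 2 * (S n w \<bullet> Z w) + (norm (Z w))\<^sup>2" for w
    unfolding power2_norm_eq_inner by (simp add: algebra_simps inner_commute)
  have "S (Suc n) \<in> borel_measurable (G (r (Suc n)))"
    unfolding SZ Z_def using measurable_G_mono[OF st IH(1)] measurable_G_mono[OF st Xn(1)] increment_measurable[OF st]
    by measurable
  moreover have "integrable M (\<lambda>w. (norm (S (Suc n) w))\<^sup>2)"
    unfolding SZ eq using IH(2) cross(1) Z2(1) by auto
  moreover have "(\<integral>w. (norm (S (Suc n) w))\<^sup>2 \<partial>M) = (\<integral>w. (norm (S n w))\<^sup>2 \<partial>M) + (\<integral>w. (norm (Z w))\<^sup>2 \<partial>M)"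
    unfolding SZ eq using IH(2) cross Z2(1) by simp
  ultimately show ?case using IH(3) Z2(2) by (simp add: algebra_simps)
qed

end

section \<open>Comparison of the solution with discrete integrals\<close>

text \<open>The grid u with each interval cut into m equal pieces, enumerated so that
  \<open>j div m\<close> is the coarse interval containing the j-th piece and every m-th point is a
  coarse one.\<close>

definition refined :: "(nat \<Rightarrow> real) \<Rightarrow> nat \<Rightarrow> nat \<Rightarrow> real" where
  "refined u m j = u (j div m) + real (j mod m) / real m * (u (Suc (j div m)) - u (j div m))"

lemma refined_mult: "0 < m \<Longrightarrow> refined u m (i * m) = u i"
  by (simp add: refined_def)

lemma refined_Suc_diff:
  assumes "0 < m"
  shows "refined u m (Suc j) - refined u m j = (u (Suc (j div m)) - u (j div m)) / real m"
proof (cases "Suc (j mod m) = m")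
  case True
  then have q: "Suc j mod m = 0" "Suc j div m = Suc (j div m)" by (simp_all add: mod_Suc div_Suc)
  have "real (j mod m) = real m - 1" using arg_cong[OF True, of real] by simp
  then have f: "real (j mod m) / real m = 1 - 1 / real m" using assms by (simp add: diff_divide_distrib)
  show ?thesis unfolding refined_def q f by (simp add: algebra_simps diff_divide_distrib)
next
  case False
  then have "Suc j mod m = Suc (j mod m)" by (simp add: mod_Suc)
  moreover from this have "Suc j div m = j div m" by (simp add: div_Suc)
  ultimately show ?thesis using assms by (simp add: refined_def field_simps)
qed

lemma mono_refined:
  assumes "mono u" "0 < m"
  shows "mono (refined u m)"
  unfolding mono_iff_le_Suc
proof
  fix j
  have "0 \<le> (u (Suc (j div m)) - u (j div m)) / real m"
    using assms(1) by (simp add: monoD)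
  then show "refined u m j \<le> refined u m (Suc j)"
    using refined_Suc_diff[OF assms(2), of u j] by linarith
qed

lemma refined_bounds:
  assumes "mono u" "0 < m"
  shows "u (j div m) \<le> refined u m j" "refined u m j \<le> u (Suc (j div m))"
proof -
  have d: "0 \<le> u (Suc (j div m)) - u (j div m)" using assms(1) by (simp add: monoD)
  have "real (j mod m) / real m \<le> 1" using assms(2) by (simp add: less_imp_le)
  from mult_right_mono[OF this d] show "refined u m j \<le> u (Suc (j div m))" by (simp add: refined_def)
  show "u (j div m) \<le> refined u m j" using d by (simp add: refined_def)
qed

text \<open>A fine sum whose coefficients are constant on coarse intervals is a coarse sum. The
  linear maps \<open>h i\<close> cover both uses, left multiplication by a matrix and multiplication
  of interval lengths by a number.\<close>

lemma sum_refined_telescope: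
  fixes f :: "nat \<Rightarrow> 'b::real_vector" and h :: "nat \<Rightarrow> 'b \<Rightarrow> 'c::real_vector"
  assumes lin: "\<And>i. linear (h i)" and m: "0 < m"
  shows "(\<Sum>j<n * m. h (j div m) (f (Suc j) - f j)) = (\<Sum>i<n. h i (f (Suc i * m) - f (i * m)))"
proof -
  have "(\<Sum>j<n * m. h (j div m) (f (Suc j) - f j)) =
      (\<Sum>i<n. \<Sum>j = i * m..<i * m + m. h (j div m) (f (Suc j) - f j))"
    by (rule sum.nat_group[symmetric])
  also have "\<dots> = (\<Sum>i<n. h i (\<Sum>j = i * m..<i * m + m. f (Suc j) - f j))"
  proof (rule sum.cong[OF refl])
    fix i
    have "j div m = i" if "j \<in> {i * m..<i * m + m}" for j
      using that m by (intro div_nat_eqI) (auto simp: algebra_simps)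
    then show "(\<Sum>j = i * m..<i * m + m. h (j div m) (f (Suc j) - f j)) = h i (\<Sum>j = i * m..<i * m + m. f (Suc j) - f j)"
      by (simp add: linear_sum[OF lin])
  qed
  also have "\<dots> = (\<Sum>i<n. h i (f (Suc i * m) - f (i * m)))"
    by (simp add: sum_Suc_diff' add.commute)
  finally show ?thesis .
qed

lemma partition_pts_refined:
  assumes "u 0 = 0" "mono u" "0 < m"
  shows "partition_pts (u n) (n * m) (refined u m)"
  using assms monoD[OF mono_refined[OF assms(2,3)]] refined_mult[OF assms(3), of u 0]
  by (auto simp: partition_pts_def refined_mult)

lemma refined_mesh:
  assumes "mono u" "0 < \<delta>"
  shows "\<forall>\<^sub>F m in sequentially. \<forall>j<n * Suc m. refined u (Suc m) (Suc j) - refined u (Suc m) j < \<delta>"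
proof -
  have "(\<lambda>m. (u n - u 0) / real (Suc m)) \<longlonglongrightarrow> 0"
    by (rule LIMSEQ_Suc) (rule lim_const_over_n)
  then have "\<forall>\<^sub>F m in sequentially. (u n - u 0) / real (Suc m) < \<delta>"
    using assms(2) by (rule order_tendstoD)
  then show ?thesis
  proof (rule eventually_mono, intro allI impI)
    fix m j assume *: "(u n - u 0) / real (Suc m) < \<delta>" and j: "j < n * Suc m"
    have "j div Suc m < n" using j by (simp add: less_mult_imp_div_less)
    then have "u (Suc (j div Suc m)) - u (j div Suc m) \<le> u n - u 0"
      using assms(1) by (intro diff_mono) (auto intro: monoD)
    then have "(u (Suc (j div Suc m)) - u (j div Suc m)) / real (Suc m) \<le> (u n - u 0) / real (Suc m)"
      by (rule divide_right_mono) simp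
    with * show "refined u (Suc m) (Suc j) - refined u (Suc m) j < \<delta>"
      by (subst refined_Suc_diff) simp_all
  qed
qed

lemma discrete_Gronwall:
  fixes e :: "nat \<Rightarrow> real"
  assumes "0 \<le> a" "0 \<le> b" and e: "\<And>k. k \<le> n \<Longrightarrow> e k \<le> a + b * (\<Sum>i<k. e i)" and "k \<le> n"
  shows "e k \<le> a * (1 + b) ^ k"
  using \<open>k \<le> n\<close>
proof (induction k rule: less_induct)
  case (less k)
  have "e k \<le> a + b * (\<Sum>i<k. e i)" using e less.prems by simp
  also have "\<dots> \<le> a + b * (\<Sum>i<k. a * (1 + b) ^ i)"
    using less assms by (intro add_left_mono mult_left_mono sum_mono) auto
  also have "\<dots> = a * (1 + b) ^ k"
  proof -
    have "1 + b * (\<Sum>i<k. (1 + b) ^ i) = (1 + b) ^ k" using one_diff_power_eq[of "1 + b" k] by simp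
    from arg_cong[OF this, of "\<lambda>x. a * x"] show ?thesis
      by (simp add: sum_distrib_left[symmetric] algebra_simps)
  qed
  finally show ?case .
qed

context geometric_brownian_motion_SL2
begin

lemma ito_integral: "0 \<le> t \<Longrightarrow> has_ito_integral M F B t (\<lambda>w. F t w - mat 1)"
  using ito_eq_stratonovich F_sde by blast

lemma F_adapted: "0 \<le> t \<Longrightarrow> F t \<in> borel_measurable (G t)"
  using F_cont_adapted by (simp add: continuous_adapted_def)

lemma F_measurable [measurable]: "0 \<le> t \<Longrightarrow> F t \<in> borel_measurable M"
  using F_adapted measurable_G_M by blast

lemma F_row_second_moment:
  assumes "0 \<le> t"
  shows "integrable M (\<lambda>w. (norm (F t w $ i))\<^sup>2)" "(\<integral>w. (norm (F t w $ i))\<^sup>2 \<partial>M) = exp t"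
proof -
  have "has_bochner_integral M (\<lambda>w. (F t w ** transpose (F t w)) $ i $ i) ((exp t *\<^sub>R (mat 1 :: mat2)) $ i $ i)"
    by (rule has_bochner_integral_bounded_linear[OF bounded_linear_matrix_entry F_second_moment[OF assms]])
  moreover have "(F t w ** transpose (F t w)) $ i $ i = (norm (F t w $ i))\<^sup>2" for w
    by (simp add: matrix_matrix_mult_def transpose_def power2_norm_eq_inner inner_vec_def)
  ultimately have "has_bochner_integral M (\<lambda>w. (norm (F t w $ i))\<^sup>2) (exp t)" by (simp add: mat_def)
  then show "integrable M (\<lambda>w. (norm (F t w $ i))\<^sup>2)" "(\<integral>w. (norm (F t w $ i))\<^sup>2 \<partial>M) = exp t"
    by (auto simp: has_bochner_integral_iff)
qed

lemma F_second_moment_norm: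
  assumes "0 \<le> t"
  shows "integrable M (\<lambda>w. (norm (F t w))\<^sup>2)" "(\<integral>w. (norm (F t w))\<^sup>2 \<partial>M) = 2 * exp t"
  using F_row_second_moment[OF assms] by (simp_all add: power2_norm_rows)

text \<open>This stands in for the Ito isometry of the integral defining \<open>F\<close>. On a
  refinement of the grid, the left-point sum for \<open>F\<close> minus the coarse sum for
  \<open>X\<close> is a discrete integral with integrand \<open>F (r j) - X i\<close>, whose second
  moment is bounded by the right-hand side whatever the mesh; Fatou's lemma transfers the bound to
  the limit \<open>D\<close>.\<close>

lemma F_compare_discrete_integral:
  fixes u :: "nat \<Rightarrow> real" and X :: "nat \<Rightarrow> 'w \<Rightarrow> mat2" and \<phi> :: "nat \<Rightarrow> real"
  assumes u: "0 \<le> u 0" "mono u"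
    and X: "\<And>i. i < k \<Longrightarrow> X i \<in> borel_measurable (G (u i))"
    and int: "\<And>i r. i < k \<Longrightarrow> u i \<le> r \<Longrightarrow> r \<le> u (Suc i) \<Longrightarrow> integrable M (\<lambda>w. (norm (F r w - X i w))\<^sup>2)"
    and le: "\<And>i r. i < k \<Longrightarrow> u i \<le> r \<Longrightarrow> r \<le> u (Suc i) \<Longrightarrow> (\<integral>w. (norm (F r w - X i w))\<^sup>2 \<partial>M) \<le> \<phi> i"
  defines "D \<equiv> \<lambda>w. F (u k) w - F (u 0) w - (\<Sum>i<k. X i w ** increment (u i) (u (Suc i)) w)"
  shows "integrable M (\<lambda>w. (norm (D w))\<^sup>2)"
    and "(\<integral>w. (norm (D w))\<^sup>2 \<partial>M) \<le> total_rate * (\<Sum>i<k. \<phi> i * (u (Suc i) - u i))"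
proof -
  have u0: "0 \<le> u i" for i using u monoD[OF u(2), of 0 i] by simp
  \<comment> \<open>Partitions have to start at time 0, whereas the grid starts at
    \<open>u 0\<close>; an interval from 0 to \<open>u 0\<close> is put in front, which shifts all
    coarse indices by one.\<close>
  define v where "v = case_nat 0 u"
  have v: "v 0 = 0" "v (Suc i) = u i" for i by (simp_all add: v_def)
  have mv: "mono v"
    using u0 monoD[OF u(2)] by (auto simp: mono_iff_le_Suc v_def split: nat.split)
  define r where "r m = refined v (Suc m)" for m
  have mr: "mono (r m)" for m unfolding r_def by (rule mono_refined[OF mv]) simp
  have r0: "r m 0 = 0" for m using refined_mult[of "Suc m" v 0] by (simp add: r_def v)
  have rpos: "0 \<le> r m j" for m j using monoD[OF mr, of 0 j m] r0 by simp
  have rle: "r m j \<le> r m (Suc j)" for m j using monoD[OF mr, of j "Suc j" m] by simp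
  define A where "A n m w = (\<Sum>j<n * Suc m. F (r m j) w ** increment (r m j) (r m (Suc j)) w)" for n m w
  have [measurable]: "A n m \<in> borel_measurable M" for n m
    unfolding A_def using rpos by measurable
  have conv: "tends_prob_0 M (\<lambda>m w. A (Suc n) m w - (F (u n) w - mat 1))" for n
    unfolding A_def
  proof (rule partition_limitD)
    show "partition_limit M (u n) (\<lambda>N s w. \<Sum>i<N. F (s i) w ** (B (s (Suc i)) w - B (s i) w)) (\<lambda>w. F (u n) w - mat 1)"
      using ito_integral[OF u0] by (simp add: has_ito_integral_def)
    show "\<forall>\<^sub>F m in sequentially. partition_pts (u n) (Suc n * Suc m) (r m)"
      unfolding r_def using partition_pts_refined[of v _ "Suc n"] v mv
      by (intro always_eventually allI) (metis zero_less_Suc)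
    show "\<forall>\<^sub>F m in sequentially. \<forall>i<Suc n * Suc m. r m (Suc i) - r m i < \<delta>" if "0 < \<delta>" for \<delta>
      unfolding r_def by (rule refined_mesh[OF mv that])
  qed
  \<comment> \<open>Subtracting \<open>A (Suc 0)\<close>, the part of the sum over the extra
    interval, leaves an approximation of \<open>F (u k) - F (u 0)\<close>.\<close>
  have "tends_prob_0 M (\<lambda>m w. (A (Suc k) m w - (F (u k) w - mat 1)) - (A (Suc 0) m w - (F (u 0) w - mat 1)))"
    by (rule tends_prob_0_diff[OF conv conv]) (use u0 in measurable)
  from tends_prob_0_AE_subseq[OF this] u0 obtain \<rho> where
    \<rho>: "AE w in M. (\<lambda>l. (A (Suc k) (\<rho> l) w - (F (u k) w - mat 1)) - (A (Suc 0) (\<rho> l) w - (F (u 0) w - mat 1))) \<longlonglongrightarrow> 0"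
    by (auto simp: measurable_If) measurable
  define S where "S w = (\<Sum>i<k. X i w ** increment (u i) (u (Suc i)) w)" for w
  define Z where "Z m w = A (Suc k) m w - A (Suc 0) m w - S w" for m w
  have Xm: "X i \<in> borel_measurable M" if "i < k" for i using X[OF that] measurable_G_M u0 by blast
  have [measurable]: "S \<in> borel_measurable M"
    unfolding S_def
    by (intro borel_measurable_sum borel_measurable_matrix_mult borel_measurable_diff B_measurable u0 Xm) simp
  have [measurable]: "Z m \<in> borel_measurable M" for m unfolding Z_def by measurable
  have Zlim: "AE w in M. (\<lambda>l. Z (\<rho> l) w) \<longlonglongrightarrow> D w"
    using \<rho>
  proof eventually_elim
    case (elim w)
    from tendsto_add[OF elim tendsto_const[of "D w"]]
    show ?case by (simp add: Z_def D_def S_def algebra_simps)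
  qed
  \<comment> \<open>The integrand of \<open>Z\<close>: zero on the extra interval, and the
    difference between \<open>F\<close> and the coarse integrand afterwards. The map
    \<open>h\<close> below rewrites the coarse sum over the same fine grid.\<close>
  define Y where "Y m j w = (if j < Suc m then 0 else F (r m j) w) - (case j div Suc m of 0 \<Rightarrow> 0 | Suc i \<Rightarrow> X i w)" for m j w
  define h :: "'w \<Rightarrow> nat \<Rightarrow> mat2 \<Rightarrow> mat2" where "h w i = (case i of 0 \<Rightarrow> (\<lambda>_. 0) | Suc i \<Rightarrow> (**) (X i w))" for w i
  have lin: "linear (h w i)" for w i
    unfolding h_def using bounded_bilinear.bounded_linear_right[OF bounded_bilinear_matrix_mult]
    by (auto split: nat.split intro: bounded_linear.linear linearI)
  have ZY: "Z m w = (\<Sum>j<Suc k * Suc m. Y m j w ** increment (r m j) (r m (Suc j)) w)" for m w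
  proof -
    have "S w = (\<Sum>i<Suc k. h w i (B (r m (Suc i * Suc m)) w - B (r m (i * Suc m)) w))"
      unfolding r_def refined_mult[OF zero_less_Suc] S_def
      by (simp add: sum.lessThan_Suc_shift h_def v del: sum.lessThan_Suc)
    also have "\<dots> = (\<Sum>j<Suc k * Suc m. h w (j div Suc m) (B (r m (Suc j)) w - B (r m j) w))"
      by (rule sum_refined_telescope[OF lin zero_less_Suc, symmetric])
    finally have S: "S w = \<dots>" .
    have A0: "A (Suc 0) m w = (\<Sum>j<Suc k * Suc m. (if j < Suc m then F (r m j) w ** increment (r m j) (r m (Suc j)) w else 0))"
      unfolding A_def by (rule sum.mono_neutral_cong_left) auto
    have "Y m j w ** increment (r m j) (r m (Suc j)) w = F (r m j) w ** increment (r m j) (r m (Suc j)) w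
        - (if j < Suc m then F (r m j) w ** increment (r m j) (r m (Suc j)) w else 0)
        - h w (j div Suc m) (increment (r m j) (r m (Suc j)) w)" for j
      by (cases "j div Suc m") (simp_all add: Y_def h_def bounded_bilinear.diff_left[OF bounded_bilinear_matrix_mult]
          bounded_bilinear.zero_left[OF bounded_bilinear_matrix_mult])
    then show ?thesis
      unfolding Z_def S A0 A_def[of "Suc k"] by (simp only: sum_subtractf)
  qed
  define \<psi> where "\<psi> = case_nat 0 \<phi>"
  have Yprop: "Y m j \<in> borel_measurable (G (r m j)) \<and> integrable M (\<lambda>w. (norm (Y m j w))\<^sup>2) \<and>
      (\<integral>w. (norm (Y m j w))\<^sup>2 \<partial>M) \<le> \<psi> (j div Suc m)" if j: "j < Suc k * Suc m" for m j
  proof (cases "j div Suc m")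
    case 0
    then have "j < Suc m" by (simp add: div_eq_0_iff)
    then have "Y m j = (\<lambda>_. 0)" using 0 by (simp add: Y_def fun_eq_iff)
    then show ?thesis using 0 by (simp add: \<psi>_def)
  next
    case (Suc i)
    have "i < k" using less_mult_imp_div_less[OF j] Suc by simp
    have "\<not> j < Suc m" using Suc by (auto simp: div_eq_0_iff)
    then have Y: "Y m j = (\<lambda>w. F (r m j) w - X i w)" using Suc by (simp add: Y_def fun_eq_iff)
    have b: "u i \<le> r m j" "r m j \<le> u (Suc i)"
      using refined_bounds[OF mv, of "Suc m" j] Suc by (simp_all add: r_def v)
    have "X i \<in> borel_measurable (G (r m j))"
      by (rule measurable_G_mono[OF u0 b(1) X[OF \<open>i < k\<close>]])
    then have "Y m j \<in> borel_measurable (G (r m j))"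
      unfolding Y using F_adapted[OF rpos] by measurable
    then show ?thesis using int[OF \<open>i < k\<close> b] le[OF \<open>i < k\<close> b] Suc unfolding Y by (simp add: \<psi>_def)
  qed
  have Zprop: "integrable M (\<lambda>w. (norm (Z m w))\<^sup>2)"
    "(\<integral>w. (norm (Z m w))\<^sup>2 \<partial>M) \<le> total_rate * (\<Sum>i<k. \<phi> i * (u (Suc i) - u i))" for m
  proof -
    have d: "integrable M (\<lambda>w. (norm (Z m w))\<^sup>2) \<and> (\<integral>w. (norm (Z m w))\<^sup>2 \<partial>M) \<le>
        total_rate * (\<Sum>j<Suc k * Suc m. (\<integral>w. (norm (Y m j w))\<^sup>2 \<partial>M) * (r m (Suc j) - r m j))"
      unfolding ZY using discrete_integral_second_moment[of "r m" "Suc k * Suc m" "Y m"] Yprop mr r0 by simp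
    then show "integrable M (\<lambda>w. (norm (Z m w))\<^sup>2)" by blast
    have "(\<Sum>j<Suc k * Suc m. (\<integral>w. (norm (Y m j w))\<^sup>2 \<partial>M) * (r m (Suc j) - r m j))
        \<le> (\<Sum>j<Suc k * Suc m. \<psi> (j div Suc m) * (r m (Suc j) - r m j))"
      using Yprop rle by (intro sum_mono mult_right_mono) auto
    also have "\<dots> = (\<Sum>i<Suc k. \<psi> i * (r m (Suc i * Suc m) - r m (i * Suc m)))"
      by (rule sum_refined_telescope[where h="\<lambda>i x. \<psi> i * x"]) (auto intro!: linearI simp: algebra_simps)
    also have "\<dots> = (\<Sum>i<k. \<phi> i * (u (Suc i) - u i))"
      unfolding r_def refined_mult[OF zero_less_Suc] by (simp add: sum.lessThan_Suc_shift \<psi>_def v del: sum.lessThan_Suc)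
    finally show "(\<integral>w. (norm (Z m w))\<^sup>2 \<partial>M) \<le> total_rate * (\<Sum>i<k. \<phi> i * (u (Suc i) - u i))"
      using d mult_left_mono[OF _ total_rate_nonneg] by (meson order_trans)
  qed
  have [measurable]: "D \<in> borel_measurable M" unfolding D_def S_def[symmetric] using u0 by measurable
  show "integrable M (\<lambda>w. (norm (D w))\<^sup>2)"
    "(\<integral>w. (norm (D w))\<^sup>2 \<partial>M) \<le> total_rate * (\<Sum>i<k. \<phi> i * (u (Suc i) - u i))"
    using Fatou_second_moment[of "\<lambda>l. Z (\<rho> l)" D, OF _ _ Zlim Zprop] by auto
qed

text \<open>Comparison with the integrand 0 on a single interval; the constant is the bound 2 exp T
  for the second moment of \<open>F\<close> up to time T.\<close>

lemma F_increment_second_moment: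
  assumes "0 \<le> s" "s \<le> t" "t \<le> T"
  shows "integrable M (\<lambda>w. (norm (F t w - F s w))\<^sup>2)"
    and "(\<integral>w. (norm (F t w - F s w))\<^sup>2 \<partial>M) \<le> 2 * exp T * total_rate * (t - s)"
proof -
  define u where "u i = (if i = 0 then s else t)" for i :: nat
  have "mono u" using assms by (auto simp: mono_iff_le_Suc u_def)
  note c = F_compare_discrete_integral[of u 1 "\<lambda>_ _. 0" "\<lambda>_. 2 * exp T", OF _ this]
  have z: "(0::mat2) ** A = 0" for A :: mat2 by (simp add: bounded_bilinear.zero_left[OF bounded_bilinear_matrix_mult])
  show "integrable M (\<lambda>w. (norm (F t w - F s w))\<^sup>2)"
    "(\<integral>w. (norm (F t w - F s w))\<^sup>2 \<partial>M) \<le> 2 * exp T * total_rate * (t - s)"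
    using c assms F_second_moment_norm by (auto simp: u_def z algebra_simps)
qed

text \<open>Comparison with the integrand frozen at \<open>F s\<close>. The preceding bound makes
  the deviation of the integrand O(t - s), and integrating it over the interval yields the second
  power.\<close>

lemma F_increment_linearization:
  assumes "0 \<le> s" "s \<le> t" "t \<le> T"
  shows "integrable M (\<lambda>w. (norm (F t w - F s w - F s w ** increment s t w))\<^sup>2)"
    and "(\<integral>w. (norm (F t w - F s w - F s w ** increment s t w))\<^sup>2 \<partial>M) \<le> 2 * exp T * total_rate\<^sup>2 * (t - s)\<^sup>2"
proof -
  define u where "u i = (if i = 0 then s else t)" for i :: nat
  have "mono u" using assms by (auto simp: mono_iff_le_Suc u_def)
  note c = F_compare_discrete_integral[of u 1 "\<lambda>_. F s" "\<lambda>_. 2 * exp T * total_rate * (t - s)", OF _ this]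
  have le: "(\<integral>w. (norm (F r w - F s w))\<^sup>2 \<partial>M) \<le> 2 * exp T * total_rate * (t - s)" if "s \<le> r" "r \<le> t" for r
  proof -
    have "(\<integral>w. (norm (F r w - F s w))\<^sup>2 \<partial>M) \<le> 2 * exp T * total_rate * (r - s)"
      using that assms by (intro F_increment_second_moment(2)) auto
    also have "\<dots> \<le> 2 * exp T * total_rate * (t - s)"
      using that total_rate_nonneg by (intro mult_left_mono) auto
    finally show ?thesis .
  qed
  show "integrable M (\<lambda>w. (norm (F t w - F s w - F s w ** increment s t w))\<^sup>2)"
    "(\<integral>w. (norm (F t w - F s w - F s w ** increment s t w))\<^sup>2 \<partial>M) \<le> 2 * exp T * total_rate\<^sup>2 * (t - s)\<^sup>2"
    using c assms F_increment_second_moment(1)[of s _ T] le F_adapted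
    by (auto simp: u_def power2_eq_square algebra_simps)
qed

section \<open>The Euler scheme and its convergence in mean square\<close>

primrec euler :: "(nat \<Rightarrow> real) \<Rightarrow> nat \<Rightarrow> 'w \<Rightarrow> mat2" where
  "euler u 0 w = mat 1"
| "euler u (Suc i) w = euler u i w + euler u i w ** increment (u i) (u (Suc i)) w"

lemma euler_eq_sum: "euler u k w = mat 1 + (\<Sum>i<k. euler u i w ** increment (u i) (u (Suc i)) w)"
  by (induction k) (simp_all add: add.assoc)

lemma euler_adapted_square_integrable:
  assumes u: "0 \<le> u 0" "mono u"
  shows "euler u i \<in> borel_measurable (G (u i)) \<and> integrable M (\<lambda>w. (norm (euler u i w))\<^sup>2)"
proof (induction i)
  case 0
  show ?case by simp
next
  case (Suc i)
  have st: "0 \<le> u i" "u i \<le> u (Suc i)" using u monoD[OF u(2), of 0 i] monoD[OF u(2), of i "Suc i"] by auto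
  from Suc have m: "euler u i \<in> borel_measurable (G (u i))" and i: "integrable M (\<lambda>w. (norm (euler u i w))\<^sup>2)" by auto
  have "euler u (Suc i) \<in> borel_measurable (G (u (Suc i)))"
    unfolding euler.simps using measurable_G_mono[OF st m] increment_measurable[OF st] by measurable
  moreover have "integrable M (\<lambda>w. (norm (euler u (Suc i) w))\<^sup>2)"
    unfolding euler.simps using measurable_G_M[OF st(1) m] increment_measurable_M[OF st]
    by (intro integrable_power2_norm_add i indep_increment_matrix_mult(1)[OF st m i]; measurable)
  ultimately show ?case by blast
qed

text \<open>The Euler sum is a coarse sum with integrand \<open>euler u i\<close>. On a step the
  distance of \<open>F r\<close> from it splits into the oscillation of \<open>F\<close>, of order h
  in mean square, and the error at the left grid point, so the error satisfies a discrete Gronwall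
  inequality.\<close>

lemma euler_convergence:
  assumes "0 \<le> T"
  shows "\<exists>K\<ge>0. \<forall>N>0. integrable M (\<lambda>w. (norm (F T w - euler (\<lambda>i. real i * (T / real N)) N w))\<^sup>2) \<and>
    (\<integral>w. (norm (F T w - euler (\<lambda>i. real i * (T / real N)) N w))\<^sup>2 \<partial>M) \<le> K / real N"
proof -
  define c where "c = total_rate"
  define L where "L = 2 * exp T * c"
  \<comment> \<open>\<open>K / real N\<close> is the Gronwall bound c(2Lh)T exp(2cT) at h = T/N; L h
    bounds the mean square oscillation of \<open>F\<close> on one step, and each factor 2 comes from
    \<open>power2_norm_add_le\<close>.\<close>
  define K where "K = c * (2 * L * T) * T * exp (2 * c * T)"
  have c0: "0 \<le> c" "0 \<le> L" using total_rate_nonneg by (simp_all add: c_def L_def)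
  have "integrable M (\<lambda>w. (norm (F T w - euler (\<lambda>i. real i * (T / real N)) N w))\<^sup>2) \<and>
    (\<integral>w. (norm (F T w - euler (\<lambda>i. real i * (T / real N)) N w))\<^sup>2 \<partial>M) \<le> K / real N" if N: "0 < N" for N
  proof -
    define h where "h = T / real N"
    define u where "u i = real i * h" for i
    have h0: "0 \<le> h" "real N * h = T" using assms N by (simp_all add: h_def)
    have u: "0 \<le> u 0" "mono u" "u (Suc i) - u i = h" for i
      using h0 by (auto simp: u_def mono_def distrib_right intro!: mult_right_mono)
    have upos: "0 \<le> u i" for i using h0 by (simp add: u_def)
    have uT: "u i \<le> T" if "i \<le> N" for i
      using that h0 mult_right_mono[of "real i" "real N" h] by (simp add: u_def)
    note eu = euler_adapted_square_integrable[OF u(1,2)]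
    have [measurable]: "euler u i \<in> borel_measurable M" for i using eu measurable_G_M upos by blast
    define e where "e i = (\<integral>w. (norm (F (u i) w - euler u i w))\<^sup>2 \<partial>M)" for i
    have ei: "integrable M (\<lambda>w. (norm (F (u i) w - euler u i w))\<^sup>2)" for i
      using integrable_power2_norm_add[of "F (u i)" "\<lambda>w. - euler u i w"] eu F_second_moment_norm(1) upos by simp
    have pt: "(norm (F r w - euler u i w))\<^sup>2 \<le> 2 * (norm (F r w - F (u i) w))\<^sup>2 + 2 * (norm (F (u i) w - euler u i w))\<^sup>2" for r i w
      using power2_norm_add_le[of "F r w - F (u i) w" "F (u i) w - euler u i w"] by simp
    have step: "integrable M (\<lambda>w. (norm (F r w - euler u i w))\<^sup>2)"
      "(\<integral>w. (norm (F r w - euler u i w))\<^sup>2 \<partial>M) \<le> 2 * (L * h) + 2 * e i"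
      if i: "i < N" and r: "u i \<le> r" "r \<le> u (Suc i)" for i r
    proof -
      have rr: "0 \<le> r" "r \<le> T" using r upos[of i] uT[of "Suc i"] i by auto
      show 1: "integrable M (\<lambda>w. (norm (F r w - euler u i w))\<^sup>2)"
        using integrable_power2_norm_add[of "F r" "\<lambda>w. - euler u i w"] eu F_second_moment_norm(1) rr(1) by simp
      note 2 = F_increment_second_moment[OF upos r(1) rr(2)]
      have "(\<integral>w. (norm (F r w - euler u i w))\<^sup>2 \<partial>M) \<le>
         (\<integral>w. 2 * (norm (F r w - F (u i) w))\<^sup>2 + 2 * (norm (F (u i) w - euler u i w))\<^sup>2 \<partial>M)"
        by (rule integral_mono[OF 1 _ pt]) (use 2(1) ei in auto)
      also have "\<dots> = 2 * (\<integral>w. (norm (F r w - F (u i) w))\<^sup>2 \<partial>M) + 2 * e i"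
        using 2(1) ei by (simp add: e_def)
      also have "(\<integral>w. (norm (F r w - F (u i) w))\<^sup>2 \<partial>M) \<le> L * (r - u i)" using 2(2) by (simp add: L_def c_def)
      also have "L * (r - u i) \<le> L * h" using r(2) u(3)[of i] c0 by (intro mult_left_mono) auto
      finally show "(\<integral>w. (norm (F r w - euler u i w))\<^sup>2 \<partial>M) \<le> 2 * (L * h) + 2 * e i" by simp
    qed
    have rec: "e k \<le> c * (2 * L * h) * T + 2 * c * h * (\<Sum>i<k. e i)" if k: "k \<le> N" for k
    proof -
      have "(\<integral>w. (norm (F (u k) w - F (u 0) w - (\<Sum>i<k. euler u i w ** increment (u i) (u (Suc i)) w)))\<^sup>2 \<partial>M)
         \<le> total_rate * (\<Sum>i<k. (2 * (L * h) + 2 * e i) * (u (Suc i) - u i))"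
        by (rule F_compare_discrete_integral(2)[OF u(1,2)]) (use eu step k in auto)
      also have "(\<integral>w. (norm (F (u k) w - F (u 0) w - (\<Sum>i<k. euler u i w ** increment (u i) (u (Suc i)) w)))\<^sup>2 \<partial>M) = e k"
        unfolding e_def
      proof (rule integral_cong_AE)
        show "AE w in M. (norm (F (u k) w - F (u 0) w - (\<Sum>i<k. euler u i w ** increment (u i) (u (Suc i)) w)))\<^sup>2
            = (norm (F (u k) w - euler u k w))\<^sup>2"
          using F_0 by eventually_elim (simp add: u_def euler_eq_sum[of _ k] diff_diff_eq)
      qed (use upos in measurable)
      also have "total_rate * (\<Sum>i<k. (2 * (L * h) + 2 * e i) * (u (Suc i) - u i)) =
          c * (2 * L * h) * (real k * h) + 2 * c * h * (\<Sum>i<k. e i)"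
        unfolding u(3) c_def[symmetric] by (simp add: sum.distrib sum_distrib_left sum_distrib_right algebra_simps)
      also have "c * (2 * L * h) * (real k * h) \<le> c * (2 * L * h) * T"
        using uT[OF k] c0 h0 by (intro mult_left_mono) (auto simp: u_def)
      finally show ?thesis by simp
    qed
    have "e N \<le> c * (2 * L * h) * T * (1 + 2 * c * h) ^ N"
      by (rule discrete_Gronwall[OF _ _ rec order_refl]) (use c0 h0 assms in auto)
    also have "\<dots> \<le> c * (2 * L * h) * T * exp (2 * c * T)"
    proof (rule mult_left_mono)
      have "(1 + 2 * c * h) ^ N \<le> exp (2 * c * h) ^ N"
        using c0 h0 by (intro power_mono exp_ge_add_one_self) auto
      also have "\<dots> = exp (2 * c * T)"
        using h0 by (simp add: exp_of_nat_mult[symmetric] mult.left_commute)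
      finally show "(1 + 2 * c * h) ^ N \<le> exp (2 * c * T)" .
    qed (use c0 h0 assms in auto)
    also have "\<dots> = K / real N" by (simp add: K_def h_def)
    finally have "e N \<le> K / real N" .
    moreover have ueq: "u = (\<lambda>i. real i * (T / real N))" by (simp add: u_def h_def fun_eq_iff)
    moreover have "u N = T" using h0 by (simp add: u_def)
    ultimately show ?thesis using ei[of N] unfolding e_def ueq[symmetric] by simp
  qed
  moreover have "0 \<le> K" using c0 assms by (simp add: K_def)
  ultimately show ?thesis by blast
qed

end

section \<open>The covariance of the Brownian motion\<close>

text \<open>Two first-order expansions at 0 of the same function have the same coefficient. The
  error t^(3/2) is the one produced by \<open>variance_rate_limit\<close>.\<close>

lemma rate_unique:
  fixes a b :: real
  assumes f: "\<And>t. 0 < t \<Longrightarrow> t \<le> 1 \<Longrightarrow> \<bar>f t - a * t\<bar> \<le> K * (t * sqrt t)"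
    and g: "\<And>t. 0 < t \<Longrightarrow> t \<le> 1 \<Longrightarrow> \<bar>f t - b * t\<bar> \<le> L * (t * sqrt t)"
  shows "a = b"
proof -
  have bound: "\<bar>a - b\<bar> \<le> (K + L) * sqrt t" if t: "0 < t" "t \<le> 1" for t
  proof -
    have "t * \<bar>a - b\<bar> = \<bar>t * (a - b)\<bar>" using t by (simp add: abs_mult)
    also have "\<dots> = \<bar>(f t - b * t) - (f t - a * t)\<bar>" by (simp add: algebra_simps)
    also have "\<dots> \<le> t * ((K + L) * sqrt t)"
      using abs_triangle_ineq4[of "f t - b * t" "f t - a * t"] f[OF t] g[OF t] by (simp add: algebra_simps)
    finally show ?thesis using t by simp
  qed
  have "(\<lambda>n. (K + L) * sqrt (1 / real (Suc n))) \<longlonglongrightarrow> (K + L) * sqrt 0"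
    by (intro tendsto_intros LIMSEQ_Suc lim_const_over_n)
  then have "\<bar>a - b\<bar> \<le> (K + L) * sqrt 0"
    by (rule LIMSEQ_le_const) (auto intro!: bound)
  then show ?thesis by simp
qed

context geometric_brownian_motion_SL2
begin

text \<open>Each Euler step adds a term of mean zero, so the diagonal entries of the scheme have
  mean exactly 1, and L^2 convergence passes this to \<open>F\<close>.\<close>

lemma expectation_F_diagonal:
  assumes "0 \<le> T"
  shows "integrable M (\<lambda>w. F T w $ i $ j)" "(\<integral>w. F T w $ i $ i \<partial>M) = 1"
proof -
  have Fi: "integrable M (\<lambda>w. (F T w $ i $ j)\<^sup>2)" for i j
  proof (rule Bochner_Integration.integrable_bound[OF F_second_moment_norm(1)[OF assms]])
    show "AE w in M. norm ((F T w $ i $ j)\<^sup>2) \<le> norm ((norm (F T w))\<^sup>2)"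
      by (auto intro!: AE_I2 abs_le_square_iff[THEN iffD1] order_trans[OF component_le_norm_cart Finite_Cartesian_Product.norm_nth_le])
  qed (use assms in measurable)
  show Fint: "integrable M (\<lambda>w. F T w $ i $ j)" for i j
    using Fi by (rule square_integrable_imp_integrable[rotated]) (use assms in measurable)
  obtain K where "0 \<le> K" and K: "\<And>N. 0 < N \<Longrightarrow> integrable M (\<lambda>w. (norm (F T w - euler (\<lambda>i. real i * (T / real N)) N w))\<^sup>2) \<and>
    (\<integral>w. (norm (F T w - euler (\<lambda>i. real i * (T / real N)) N w))\<^sup>2 \<partial>M) \<le> K / real N"
    using euler_convergence[OF assms] by blast
  define e where "e = (\<integral>w. F T w $ i $ i \<partial>M) - 1"
  have "e\<^sup>2 \<le> K / real (Suc n)" for n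
  proof -
    define u where "u i = real i * (T / real (Suc n))" for i
    have u: "0 \<le> u 0" "mono u"
      using assms by (auto simp: u_def mono_def intro!: divide_right_mono mult_right_mono)
    have upos: "0 \<le> u i" for i using assms by (simp add: u_def)
    have ule: "u i \<le> u (Suc i)" for i using u(2) by (simp add: monoD)
    note eu = euler_adapted_square_integrable[OF u]
    have [measurable]: "euler u k \<in> borel_measurable M" for k using eu measurable_G_M upos by blast
    have eI: "integrable M (\<lambda>w. euler u k w $ i $ i) \<and> (\<integral>w. euler u k w $ i $ i \<partial>M) = 1" for k
    proof (induction k)
      case 0
      show ?case by (simp add: mat_def prob_space)
    next
      case (Suc k)
      \<comment> \<open>The diagonal entry of the Euler step, written as an inner product of a
        matrix known at time \<open>u k\<close> with the increment.\<close>
      define W where "W w = transpose (euler u k w) ** unit_mat i i" for w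
      have Wm: "W \<in> borel_measurable (G (u k))" unfolding W_def using eu[of k, THEN conjunct1] by measurable
      have "integrable M (\<lambda>w. norm (W w))"
      proof (rule Bochner_Integration.integrable_bound)
        show "integrable M (\<lambda>w. norm (unit_mat i i) * (1 + (norm (euler u k w))\<^sup>2))" using eu[of k] by simp
        have "norm (W w) \<le> norm (unit_mat i i) * (1 + (norm (euler u k w))\<^sup>2)" for w
        proof -
          have "norm (W w) \<le> norm (euler u k w) * norm (unit_mat i i)"
            unfolding W_def by (rule order_trans[OF norm_matrix_mult_le]) (simp add: norm_transpose_mat2)
          also have "norm (euler u k w) \<le> 1 + (norm (euler u k w))\<^sup>2"
            using sum_squares_bound[of 1 "norm (euler u k w)"] by (simp add: power2_eq_square) (smt (verit) norm_ge_zero)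
          finally show ?thesis by (simp add: mult_right_mono mult.commute)
        qed
        then show "AE w in M. norm (norm (W w)) \<le> norm (norm (unit_mat i i) * (1 + (norm (euler u k w))\<^sup>2))"
          by (auto intro!: AE_I2 order_trans[OF _ abs_ge_self])
      qed (use measurable_G_M[OF upos Wm] in measurable)
      note W = indep_increment_inner[OF upos ule Wm this]
      have eq: "euler u (Suc k) w $ i $ i = euler u k w $ i $ i + W w \<bullet> increment (u k) (u (Suc k)) w" for w
        unfolding W_def inner_matrix_mult[symmetric] unit_mat_inner by simp
      show ?case unfolding eq using Suc W by simp
    qed
    have "u = (\<lambda>i. real i * (T / real (Suc n)))" by (simp add: u_def fun_eq_iff)
    then have KK: "integrable M (\<lambda>w. (norm (F T w - euler u (Suc n) w))\<^sup>2)"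
      "(\<integral>w. (norm (F T w - euler u (Suc n) w))\<^sup>2 \<partial>M) \<le> K / real (Suc n)"
      using K[of "Suc n"] by auto
    define X where "X w = F T w $ i $ i - euler u (Suc n) w $ i $ i" for w
    have Xm [measurable]: "X \<in> borel_measurable M" unfolding X_def using assms by measurable
    have pt: "(X w)\<^sup>2 \<le> (norm (F T w - euler u (Suc n) w))\<^sup>2" for w
    proof -
      have "\<bar>(F T w - euler u (Suc n) w) $ i $ i\<bar> \<le> norm (F T w - euler u (Suc n) w)"
        by (rule order_trans[OF component_le_norm_cart Finite_Cartesian_Product.norm_nth_le])
      then have "\<bar>X w\<bar>\<^sup>2 \<le> (norm (F T w - euler u (Suc n) w))\<^sup>2"
        unfolding X_def vector_minus_component by (intro power_mono) auto
      then show ?thesis by simp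
    qed
    have X1: "integrable M X" unfolding X_def using Fint eI by (simp del: euler.simps)
    have X2: "integrable M (\<lambda>w. (X w)\<^sup>2)"
      by (rule Bochner_Integration.integrable_bound[OF KK(1)]) (auto intro!: AE_I2 pt simp del: euler.simps)
    have "e = expectation X" unfolding X_def e_def using Fint eI by (simp del: euler.simps)
    \<comment> \<open>Jensen's inequality, from the nonnegativity of the variance.\<close>
    then have "e\<^sup>2 \<le> expectation (\<lambda>w. (X w)\<^sup>2)"
      using variance_eq[OF X1 X2] variance_positive[of X] by simp
    also have "\<dots> \<le> (\<integral>w. (norm (F T w - euler u (Suc n) w))\<^sup>2 \<partial>M)"
      by (rule integral_mono[OF X2 KK(1) pt])
    finally show ?thesis using KK(2) by simp
  qed
  moreover have "(\<lambda>n. K / real (Suc n)) \<longlonglongrightarrow> 0" by (rule LIMSEQ_Suc) (rule lim_const_over_n)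
  ultimately have "e\<^sup>2 \<le> 0" by (intro LIMSEQ_le_const[of _ 0 "e\<^sup>2"]) auto
  then show "(\<integral>w. F T w $ i $ i \<partial>M) = 1" by (simp add: e_def)
qed

text \<open>Almost surely \<open>F t - mat 1\<close> is the increment of \<open>B\<close> plus a
  remainder with second moment O(t^2). So the covariance of \<open>B\<close> is visible in second
  moments of \<open>F\<close>, which is where the hypotheses live.\<close>

lemma variance_rate_limit:
  "\<exists>K. \<forall>t. 0 < t \<longrightarrow> t \<le> 1 \<longrightarrow> integrable M (\<lambda>w. (A \<bullet> (F t w - mat 1))\<^sup>2) \<and>
    \<bar>(\<integral>w. (A \<bullet> (F t w - mat 1))\<^sup>2 \<partial>M) - variance_rate A * t\<bar> \<le> K * (t * sqrt t)"
proof -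
  define v where "v = variance_rate A"
  define L where "L = (norm A)\<^sup>2 * (2 * exp 1 * total_rate\<^sup>2)"
  have pos: "0 \<le> v" "0 \<le> L" using variance_rate_nonneg by (simp_all add: v_def L_def)
  have "integrable M (\<lambda>w. (A \<bullet> (F t w - mat 1))\<^sup>2) \<and>
    \<bar>(\<integral>w. (A \<bullet> (F t w - mat 1))\<^sup>2 \<partial>M) - variance_rate A * t\<bar> \<le> (v + 2 * L) * (t * sqrt t)"
    if t: "0 < t" "t \<le> 1" for t
  proof -
    define R where "R w = F t w - F 0 w - F 0 w ** increment 0 t w" for w
    define x where "x w = A \<bullet> increment 0 t w" for w
    define d where "d w = A \<bullet> R w" for w
    have st: "0 \<le> (0::real)" "0 \<le> t" using t by auto
    note [measurable] = increment_measurable_M[OF st]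
    have [measurable]: "R \<in> borel_measurable M" unfolding R_def using st by measurable
    have [measurable]: "x \<in> borel_measurable M" "d \<in> borel_measurable M" unfolding x_def d_def by measurable
    have R: "integrable M (\<lambda>w. (norm (R w))\<^sup>2)" "(\<integral>w. (norm (R w))\<^sup>2 \<partial>M) \<le> 2 * exp 1 * total_rate\<^sup>2 * t\<^sup>2"
      using F_increment_linearization[OF st t(2)] by (simp_all add: R_def)
    have x2: "integrable M (\<lambda>w. (x w)\<^sup>2)" "(\<integral>w. (x w)\<^sup>2 \<partial>M) = v * t"
      using increment_moments(1)[OF st, of A 2] increment_moments(3)[OF st, of A] by (simp_all add: x_def v_def)
    have dpt: "(d w)\<^sup>2 \<le> (norm A)\<^sup>2 * (norm (R w))\<^sup>2" for w
      using Cauchy_Schwarz_ineq[of A "R w"] by (simp add: d_def power2_norm_eq_inner)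
    have d2: "integrable M (\<lambda>w. (d w)\<^sup>2)"
      by (rule Bochner_Integration.integrable_bound[of _ "\<lambda>w. (norm A)\<^sup>2 * (norm (R w))\<^sup>2"])
        (use R(1) dpt in \<open>auto intro!: AE_I2\<close>)
    have "(\<integral>w. (d w)\<^sup>2 \<partial>M) \<le> (\<integral>w. (norm A)\<^sup>2 * (norm (R w))\<^sup>2 \<partial>M)"
      by (rule integral_mono[OF d2 _ dpt]) (use R(1) in auto)
    also have "\<dots> \<le> L * t\<^sup>2"
      using mult_left_mono[OF R(2), of "(norm A)\<^sup>2"] R(1) by (simp add: L_def mult_ac)
    finally have d2': "(\<integral>w. (d w)\<^sup>2 \<partial>M) \<le> L * t\<^sup>2" .
    have xd2: "integrable M (\<lambda>w. (x w + d w)\<^sup>2)"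
      using integrable_power2_norm_add[of x d] x2 d2 by simp
    have AEeq: "AE w in M. (A \<bullet> (F t w - mat 1))\<^sup>2 = (x w + d w)\<^sup>2"
      using F_0
    proof eventually_elim
      case (elim w)
      then show ?case by (simp add: x_def d_def R_def inner_add_right[symmetric])
    qed
    have m: "(\<lambda>w. (A \<bullet> (F t w - mat 1))\<^sup>2) \<in> borel_measurable M" using st by measurable
    have 1: "integrable M (\<lambda>w. (A \<bullet> (F t w - mat 1))\<^sup>2)"
      using integrable_cong_AE[OF m _ AEeq] xd2 by auto
    have 2: "(\<integral>w. (A \<bullet> (F t w - mat 1))\<^sup>2 \<partial>M) = (\<integral>w. (x w + d w)\<^sup>2 \<partial>M)"
      by (rule integral_cong_AE[OF m _ AEeq]) measurable
    \<comment> \<open>The weight in the inequality 2|xd| \<le> q x^2 + d^2/q. With E x^2 of order t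
      and E d^2 of order t^2, the choice q = sqrt t makes both terms of order t^(3/2).\<close>
    define q where "q = sqrt t"
    have q: "0 < q" "q\<^sup>2 = t" "q \<le> 1" using t by (simp_all add: q_def)
    have pt: "\<bar>(x w + d w)\<^sup>2 - (x w)\<^sup>2\<bar> \<le> q * (x w)\<^sup>2 + (1 / q + 1) * (d w)\<^sup>2" for w
    proof -
      have "2 * (q * \<bar>x w\<bar>) * \<bar>d w\<bar> \<le> (q * \<bar>x w\<bar>)\<^sup>2 + \<bar>d w\<bar>\<^sup>2" by (rule sum_squares_bound)
      then have "q * (2 * \<bar>x w * d w\<bar>) \<le> q * (q * (x w)\<^sup>2 + (1 / q) * (d w)\<^sup>2)"
        using q(1) by (simp add: power_mult_distrib abs_mult power2_eq_square algebra_simps)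
      then have "2 * \<bar>x w * d w\<bar> \<le> q * (x w)\<^sup>2 + (1 / q) * (d w)\<^sup>2" using q(1) by (simp only: mult_le_cancel_left_pos)
      moreover have "(x w + d w)\<^sup>2 - (x w)\<^sup>2 = 2 * (x w * d w) + (d w)\<^sup>2" by (simp add: power2_eq_square algebra_simps)
      ultimately show ?thesis by (simp add: distrib_right) (smt (verit) zero_le_power2)
    qed
    have "\<bar>(\<integral>w. (x w + d w)\<^sup>2 \<partial>M) - v * t\<bar> = \<bar>\<integral>w. (x w + d w)\<^sup>2 - (x w)\<^sup>2 \<partial>M\<bar>"
      using xd2 x2 by simp
    also have "\<dots> \<le> (\<integral>w. \<bar>(x w + d w)\<^sup>2 - (x w)\<^sup>2\<bar> \<partial>M)" by (rule integral_abs_bound)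
    also have "\<dots> \<le> (\<integral>w. q * (x w)\<^sup>2 + (1 / q + 1) * (d w)\<^sup>2 \<partial>M)"
      by (rule integral_mono[OF _ _ pt]) (use xd2 x2 d2 in auto)
    also have "\<dots> = q * (v * t) + (1 / q + 1) * (\<integral>w. (d w)\<^sup>2 \<partial>M)" using x2 d2 by simp
    also have "\<dots> \<le> q * (v * t) + (1 / q + 1) * (L * t\<^sup>2)"
      using d2' q by (intro add_left_mono mult_left_mono) auto
    also have "\<dots> = v * (t * q) + L * (t * q) + L * (t * q) * q"
      using q(1) unfolding q(2)[symmetric] by (simp add: field_simps power2_eq_square)
    also have "\<dots> \<le> v * (t * q) + L * (t * q) + L * (t * q)"
      using pos t q by (intro add_left_mono mult_left_le) auto
    finally show ?thesis using 1 2 by (simp add: v_def q_def algebra_simps)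
  qed
  then show ?thesis by blast
qed

section \<open>Relations between the rates of the entries\<close>

lemma F_law_conj:
  assumes Q: "orthogonal_matrix Q" and t: "0 \<le> t"
  shows "distr M borel (\<lambda>w. Q ** F t w ** transpose Q) = distr M borel (F t)"
proof -
  let ?P = "\<lambda>X. distr M (Pi\<^sub>M {0..} (\<lambda>_. borel)) (\<lambda>w. \<lambda>t\<in>{0..}. X t w) :: (real \<Rightarrow> mat2) measure"
  have marginal: "distr (?P X) borel (\<lambda>f. f t) = distr M borel (X t)"
    if X: "\<And>s. 0 \<le> s \<Longrightarrow> X s \<in> borel_measurable M" for X :: "real \<Rightarrow> 'w \<Rightarrow> mat2"
  proof (subst distr_distr)
    show "(\<lambda>f. f t) \<in> borel_measurable (Pi\<^sub>M {0..} (\<lambda>_. borel))"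
      by (rule measurable_component_singleton) (use t in simp)
    show "(\<lambda>w. \<lambda>t\<in>{0..}. X t w) \<in> M \<rightarrow>\<^sub>M Pi\<^sub>M {0..} (\<lambda>_. borel)"
      by (rule measurable_restrict) (use X in simp)
    show "distr M borel ((\<lambda>f. f t) \<circ> (\<lambda>w. \<lambda>t\<in>{0..}. X t w)) = distr M borel (X t)"
      by (rule distr_cong) (use t in auto)
  qed
  have "?P (\<lambda>t w. Q ** F t w ** matrix_inv Q) = ?P F"
    using F_isotropic[OF Q] by (simp add: same_law_def)
  then show ?thesis
    using marginal[of "\<lambda>t w. Q ** F t w ** matrix_inv Q"] marginal[of F]
    by (simp add: matrix_inv_orthogonal[OF Q] borel_measurable_matrix_mult)
qed

text \<open>Isotropy is assumed for the law of \<open>F\<close>. It makes the second moments of both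
  projections of \<open>F t - mat 1\<close> equal for every t > 0, and their expansions at 0 then
  have equal coefficients.\<close>

lemma variance_rate_conj:
  assumes Q: "orthogonal_matrix Q"
  shows "variance_rate (transpose Q ** A ** Q) = variance_rate A"
proof -
  have eq: "(\<integral>w. ((transpose Q ** A ** Q) \<bullet> (F t w - mat 1))\<^sup>2 \<partial>M) = (\<integral>w. (A \<bullet> (F t w - mat 1))\<^sup>2 \<partial>M)"
    if t: "0 < t" for t
  proof -
    have t0: "0 \<le> t" using t by simp
    have QF: "(\<lambda>w. Q ** F t w ** transpose Q) \<in> borel_measurable M" using t0 by measurable
    have g: "(\<lambda>X. (A \<bullet> (X - mat 1))\<^sup>2) \<in> borel_measurable borel" by measurable
    have "(transpose Q ** A ** Q) \<bullet> (F t w - mat 1) = A \<bullet> (Q ** F t w ** transpose Q - mat 1)" for w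
    proof -
      have "A \<bullet> (Q ** (F t w - mat 1) ** transpose Q) = (transpose Q ** A ** Q) \<bullet> (F t w - mat 1)"
        by (subst inner_matrix_mult_right, subst inner_matrix_mult) (simp add: matrix_mul_assoc)
      moreover have "Q ** (F t w - mat 1) ** transpose Q = Q ** F t w ** transpose Q - mat 1"
        using Q by (simp add: bounded_bilinear.diff_left[OF bounded_bilinear_matrix_mult]
            bounded_bilinear.diff_right[OF bounded_bilinear_matrix_mult] orthogonal_matrix_def)
      ultimately show ?thesis by simp
    qed
    then have "(\<integral>w. ((transpose Q ** A ** Q) \<bullet> (F t w - mat 1))\<^sup>2 \<partial>M)
        = (\<integral>X. (A \<bullet> (X - mat 1))\<^sup>2 \<partial>distr M borel (\<lambda>w. Q ** F t w ** transpose Q))"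
      using integral_distr[OF QF g] by simp
    also have "\<dots> = (\<integral>w. (A \<bullet> (F t w - mat 1))\<^sup>2 \<partial>M)"
      unfolding F_law_conj[OF Q t0] by (rule integral_distr[OF F_measurable[OF t0] g])
    finally show ?thesis .
  qed
  obtain K where K: "\<And>t. 0 < t \<Longrightarrow> t \<le> 1 \<Longrightarrow>
      \<bar>(\<integral>w. (A \<bullet> (F t w - mat 1))\<^sup>2 \<partial>M) - variance_rate A * t\<bar> \<le> K * (t * sqrt t)"
    using variance_rate_limit[of A] by blast
  obtain L where L: "\<And>t. 0 < t \<Longrightarrow> t \<le> 1 \<Longrightarrow>
      \<bar>(\<integral>w. ((transpose Q ** A ** Q) \<bullet> (F t w - mat 1))\<^sup>2 \<partial>M) - variance_rate (transpose Q ** A ** Q) * t\<bar> \<le> L * (t * sqrt t)"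
    using variance_rate_limit[of "transpose Q ** A ** Q"] by blast
  show ?thesis
    by (rule rate_unique[of "\<lambda>t. \<integral>w. (A \<bullet> (F t w - mat 1))\<^sup>2 \<partial>M"]) (use K L eq in auto)
qed

text \<open>The squared distance of the first row of \<open>F t\<close> from the first unit vector
  has mean exp t - 2 + 1, because the first row has second moment exp t and its diagonal entry has
  mean 1. Its derivative at 0 is 1.\<close>

lemma variance_rate_row_sum: "variance_rate (unit_mat 1 1) + variance_rate (unit_mat 1 2) = 1"
proof -
  obtain K1 where K1: "\<And>t. 0 < t \<Longrightarrow> t \<le> 1 \<Longrightarrow> integrable M (\<lambda>w. (unit_mat 1 1 \<bullet> (F t w - mat 1))\<^sup>2) \<and>
      \<bar>(\<integral>w. (unit_mat 1 1 \<bullet> (F t w - mat 1))\<^sup>2 \<partial>M) - variance_rate (unit_mat 1 1) * t\<bar> \<le> K1 * (t * sqrt t)"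
    using variance_rate_limit[of "unit_mat 1 1"] by blast
  obtain K2 where K2: "\<And>t. 0 < t \<Longrightarrow> t \<le> 1 \<Longrightarrow> integrable M (\<lambda>w. (unit_mat 1 2 \<bullet> (F t w - mat 1))\<^sup>2) \<and>
      \<bar>(\<integral>w. (unit_mat 1 2 \<bullet> (F t w - mat 1))\<^sup>2 \<partial>M) - variance_rate (unit_mat 1 2) * t\<bar> \<le> K2 * (t * sqrt t)"
    using variance_rate_limit[of "unit_mat 1 2"] by blast
  have sum: "(\<integral>w. (unit_mat 1 1 \<bullet> (F t w - mat 1))\<^sup>2 \<partial>M) + (\<integral>w. (unit_mat 1 2 \<bullet> (F t w - mat 1))\<^sup>2 \<partial>M) = exp t - 1"
    if t: "0 < t" "t \<le> 1" for t
  proof -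
    have eq: "(unit_mat 1 1 \<bullet> (F t w - mat 1))\<^sup>2 + (unit_mat 1 2 \<bullet> (F t w - mat 1))\<^sup>2
       = (norm (F t w $ 1))\<^sup>2 - 2 * F t w $ 1 $ 1 + 1" for w
      unfolding unit_mat_inner unfolding power2_norm_eq_inner inner_vec_def
      by (simp add: sum_2 mat_def power2_eq_square algebra_simps)
    have "(\<integral>w. (unit_mat 1 1 \<bullet> (F t w - mat 1))\<^sup>2 \<partial>M) + (\<integral>w. (unit_mat 1 2 \<bullet> (F t w - mat 1))\<^sup>2 \<partial>M)
       = (\<integral>w. (norm (F t w $ 1))\<^sup>2 - 2 * F t w $ 1 $ 1 + 1 \<partial>M)"
      unfolding eq[symmetric] using K1[OF t] K2[OF t] by (intro Bochner_Integration.integral_add[symmetric]) auto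
    also have "\<dots> = exp t - 2 * 1 + 1"
      using F_row_second_moment[of t 1] expectation_F_diagonal[of t 1] t by (simp add: prob_space)
    finally show ?thesis by simp
  qed
  show ?thesis
  proof (rule rate_unique[of "\<lambda>t. exp t - 1"])
    fix t :: real assume t: "0 < t" "t \<le> 1"
    show "\<bar>exp t - 1 - (variance_rate (unit_mat 1 1) + variance_rate (unit_mat 1 2)) * t\<bar> \<le> (K1 + K2) * (t * sqrt t)"
      using K1[OF t] K2[OF t] unfolding sum[OF t, symmetric] distrib_right by linarith
    have "t * t \<le> t * sqrt t"
      using t by (intro mult_left_mono real_le_rsqrt) (auto simp: power2_eq_square mult_left_le)
    then show "\<bar>exp t - 1 - 1 * t\<bar> \<le> 1 * (t * sqrt t)"
      using exp_bound[of t] exp_ge_add_one_self[of t] t unfolding power2_eq_square by linarith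
  qed
qed


text \<open>\<open>B\<close> lives in \<open>sl2\<close>, so a rate depends only on the restriction
  of the functional to \<open>sl2\<close>: multiples of the identity may be added to
  \<open>A\<close> freely.\<close>

lemma variance_rate_scale_on_sl2:
  assumes "\<And>X. X \<in> sl2 \<Longrightarrow> A \<bullet> X = c * (A' \<bullet> X)"
  shows "variance_rate A = c\<^sup>2 * variance_rate A'"
proof -
  have "variance_rate A = (\<integral>w. (A \<bullet> increment 0 1 w)\<^sup>2 \<partial>M)"
    using increment_moments(3)[of 0 1 A] by simp
  also have "\<dots> = (\<integral>w. c\<^sup>2 * (A' \<bullet> increment 0 1 w)\<^sup>2 \<partial>M)"
  proof (rule Bochner_Integration.integral_cong[OF refl])
    fix w assume "w \<in> space M"
    then have "increment 0 1 w \<in> sl2"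
      using B_sl2[of 0 w] B_sl2[of 1 w] by (simp add: sl2_def trace_def sum_subtractf)
    then show "(A \<bullet> increment 0 1 w)\<^sup>2 = c\<^sup>2 * (A' \<bullet> increment 0 1 w)\<^sup>2"
      using assms by (simp add: power_mult_distrib)
  qed
  also have "\<dots> = c\<^sup>2 * variance_rate A'"
    using increment_moments(3)[of 0 1 A'] by simp
  finally show ?thesis .
qed

text \<open>Conjugating with a rotation by \<open>\<pi>/4\<close> turns the diagonal entry of \<open>B\<close> into half the sum of
  the two off-diagonal entries.\<close>

lemma variance_rate_relations:
  "variance_rate (unit_mat 2 1) = variance_rate (unit_mat 1 2)"
  "variance_rate (unit_mat 1 2 + unit_mat 2 1) = 4 * variance_rate (unit_mat 1 1)"
proof -
  define S :: mat2 where "S = vector [vector [0, 1], vector [1, 0]]"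
  have "orthogonal_matrix S"
    by (simp add: S_def orthogonal_matrix_def vec_eq_iff forall_2 matrix_matrix_mult_def transpose_def mat_def sum_2)
  moreover have "transpose S ** unit_mat 1 2 ** S = unit_mat 2 1"
    by (simp add: S_def vec_eq_iff forall_2 matrix_matrix_mult_def transpose_def unit_mat_def axis_def sum_2)
  ultimately show "variance_rate (unit_mat 2 1) = variance_rate (unit_mat 1 2)"
    using variance_rate_conj[of S "unit_mat 1 2"] by simp
  define a where "a = 1 / sqrt (2::real)"
  have a: "a * a = 1 / 2" by (simp add: a_def)
  define R :: mat2 where "R = vector [vector [a, a], vector [- a, a]]"
  have "orthogonal_matrix R"
    by (simp add: R_def orthogonal_matrix_def vec_eq_iff forall_2 matrix_matrix_mult_def transpose_def mat_def sum_2 a)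
  then have "variance_rate (transpose R ** unit_mat 1 1 ** R) = variance_rate (unit_mat 1 1)"
    by (rule variance_rate_conj)
  \<comment> \<open>The conjugated matrix has all entries equal to 1/2, hence is half the sum of the
    two off-diagonal units plus half the identity, and the latter vanishes on
    \<open>sl2\<close>.\<close>
  moreover have "variance_rate (transpose R ** unit_mat 1 1 ** R) = (1/2)\<^sup>2 * variance_rate (unit_mat 1 2 + unit_mat 2 1)"
  proof (rule variance_rate_scale_on_sl2)
    fix X assume "X \<in> sl2"
    then have X: "X $ 2 $ 2 = - X $ 1 $ 1" by (simp add: sl2_def trace_def sum_2)
    show "(transpose R ** unit_mat 1 1 ** R) \<bullet> X = 1 / 2 * ((unit_mat 1 2 + unit_mat 2 1) \<bullet> X)"
      by (simp add: R_def inner_mat2 matrix_matrix_mult_def transpose_def unit_mat_def axis_def sum_2 a X algebra_simps)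
  qed
  ultimately show "variance_rate (unit_mat 1 2 + unit_mat 2 1) = 4 * variance_rate (unit_mat 1 1)"
    by (simp add: power2_eq_square)
qed

text \<open>By Cayley-Hamilton the square of a trace-free 2x2 matrix is a multiple of the identity,
  which gives the zero. The entry 11 of the square is x^2 + yz with x the diagonal and y, z the
  off-diagonal entries; polarisation of yz and \<open>variance_rate_relations\<close> give the rate
  a + (4a - 2b)/2 = 3a - b.\<close>

lemma square_increment_expectation:
  assumes st: "0 \<le> s" "s \<le> t"
  defines "Z \<equiv> \<lambda>w. increment s t w ** increment s t w"
  shows "integrable M (\<lambda>w. Z w $ i $ j)"
    and "(\<integral>w. Z w $ 1 $ 1 \<partial>M) = (3 * variance_rate (unit_mat 1 1) - variance_rate (unit_mat 1 2)) * (t - s)"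
    and "(\<integral>w. Z w $ 2 $ 1 \<partial>M) = 0"
proof -
  note [measurable] = increment_measurable_M[OF st]
  have Zpt: "\<bar>Z w $ i $ j\<bar> \<le> (norm (increment s t w))\<^sup>2" for w i j
    by (rule order_trans[OF component_le_norm_cart order_trans[OF Finite_Cartesian_Product.norm_nth_le]])
      (simp add: Z_def power2_eq_square norm_matrix_mult_le)
  show Zi: "integrable M (\<lambda>w. Z w $ i $ j)" for i j
    by (rule Bochner_Integration.integrable_bound[OF increment_norm_moments(1)[OF st]])
      (use Zpt in \<open>auto intro!: AE_I2 simp: Z_def\<close>)
  have tr: "B r w $ 2 $ 2 = - B r w $ 1 $ 1" if "0 \<le> r" "w \<in> space M" for r w
    using B_sl2[OF that] by (simp add: sl2_def trace_def sum_2 add_eq_0_iff)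
  have "(\<integral>w. Z w $ 2 $ 1 \<partial>M) = (\<integral>w. 0 \<partial>M)"
  proof (rule Bochner_Integration.integral_cong[OF refl])
    fix w assume "w \<in> space M"
    then show "Z w $ 2 $ 1 = 0"
      unfolding Z_def matrix_matrix_mult_def using st by (simp add: sum_2 tr algebra_simps)
  qed
  then show "(\<integral>w. Z w $ 2 $ 1 \<partial>M) = 0" by simp
  let ?I = "\<lambda>A w. (A \<bullet> increment s t w)\<^sup>2"
  have eq: "Z w $ 1 $ 1 = ?I (unit_mat 1 1) w + (?I (unit_mat 1 2 + unit_mat 2 1) w - ?I (unit_mat 1 2) w - ?I (unit_mat 2 1) w) / 2" for w
    unfolding Z_def matrix_matrix_mult_def inner_add_left unit_mat_inner
    by (simp add: sum_2 power2_eq_square field_simps)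
  note m = increment_moments(1)[OF st, of _ 2] increment_moments(3)[OF st]
  have "(\<integral>w. Z w $ 1 $ 1 \<partial>M) = (\<integral>w. ?I (unit_mat 1 1) w \<partial>M) + ((\<integral>w. ?I (unit_mat 1 2 + unit_mat 2 1) w \<partial>M)
      - (\<integral>w. ?I (unit_mat 1 2) w \<partial>M) - (\<integral>w. ?I (unit_mat 2 1) w \<partial>M)) / 2"
    unfolding eq using m(1) by (simp del: unit_mat_inner)
  also have "\<dots> = (3 * variance_rate (unit_mat 1 1) - variance_rate (unit_mat 1 2)) * (t - s)"
    unfolding m(2) variance_rate_relations by (simp add: field_simps)
  finally show "(\<integral>w. Z w $ 1 $ 1 \<partial>M) = (3 * variance_rate (unit_mat 1 1) - variance_rate (unit_mat 1 2)) * (t - s)" .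
qed

text \<open>Independence factors the mean; the entry 12 of \<open>F s\<close> is multiplied by an
  entry of mean zero, so its own mean is never computed. The 24 is 2, from the second moment 2 exp s
  of \<open>F s\<close>, times the 12 of the fourth moment of the increment.\<close>

lemma F_mult_square_increment:
  assumes st: "0 \<le> s" "s \<le> t"
  defines "p \<equiv> \<lambda>w. (F s w ** (increment s t w ** increment s t w)) $ 1 $ 1"
  shows "integrable M p"
    and "(\<integral>w. p w \<partial>M) = (3 * variance_rate (unit_mat 1 1) - variance_rate (unit_mat 1 2)) * (t - s)"
    and "integrable M (\<lambda>w. (p w)\<^sup>2)"
    and "(\<integral>w. (p w)\<^sup>2 \<partial>M) \<le> 24 * exp s * (total_rate * (t - s))\<^sup>2"
proof -
  note [measurable] = increment_measurable_M[OF st] F_measurable[OF st(1)]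
  have Fm: "(\<lambda>w. F s w $ i $ j) \<in> borel_measurable (G s)" for i j using F_adapted[OF st(1)] by measurable
  have gm: "(\<lambda>A::mat2. (A ** A) $ i $ j) \<in> borel_measurable borel" for i j by measurable
  note ind = indep_increment_mult[OF st Fm expectation_F_diagonal(1)[OF st(1)] gm square_increment_expectation(1)[OF st]]
  note sq = square_increment_expectation[OF st]
  have p: "p = (\<lambda>w. F s w $ 1 $ 1 * (increment s t w ** increment s t w) $ 1 $ 1
      + F s w $ 1 $ 2 * (increment s t w ** increment s t w) $ 2 $ 1)"
    unfolding p_def matrix_matrix_mult_def[of "F s _"] by (simp add: sum_2)
  show "integrable M p" unfolding p by (intro Bochner_Integration.integrable_add ind(1))
  show "(\<integral>w. p w \<partial>M) = (3 * variance_rate (unit_mat 1 1) - variance_rate (unit_mat 1 2)) * (t - s)"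
    unfolding p using Bochner_Integration.integral_add[OF ind(1) ind(1), of 1 1 1 1 1 2 2 1]
    by (simp only: ind(2) sq expectation_F_diagonal(2)[OF st(1)] mult_1 mult_zero_right add_0_right)
  have F2: "(\<lambda>w. (norm (F s w))\<^sup>2) \<in> borel_measurable (G s)" using F_adapted[OF st(1)] by measurable
  have g2: "(\<lambda>A::mat2. (norm A) ^ 4) \<in> borel_measurable borel" by measurable
  note b = indep_increment_mult[OF st F2 F_second_moment_norm(1)[OF st(1)] g2 increment_norm_moments(3)[OF st]]
  have pt: "(p w)\<^sup>2 \<le> (norm (F s w))\<^sup>2 * (norm (increment s t w)) ^ 4" for w
  proof -
    have "\<bar>p w\<bar> \<le> norm (F s w ** (increment s t w ** increment s t w))"
      unfolding p_def by (rule order_trans[OF component_le_norm_cart Finite_Cartesian_Product.norm_nth_le])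
    also have "\<dots> \<le> norm (F s w) * (norm (increment s t w) * norm (increment s t w))"
      by (rule order_trans[OF norm_matrix_mult_le]) (simp add: mult_left_mono norm_matrix_mult_le)
    finally have "\<bar>p w\<bar>\<^sup>2 \<le> (norm (F s w) * (norm (increment s t w) * norm (increment s t w)))\<^sup>2"
      by (intro power_mono) auto
    then show ?thesis by (simp add: power_mult_distrib power_mult[symmetric] eval_nat_numeral mult_ac)
  qed
  have [measurable]: "p \<in> borel_measurable M" unfolding p_def by measurable
  show i: "integrable M (\<lambda>w. (p w)\<^sup>2)"
    by (rule Bochner_Integration.integrable_bound[OF b(1)]) (use pt in \<open>auto intro!: AE_I2\<close>)
  have "(\<integral>w. (p w)\<^sup>2 \<partial>M) \<le> 2 * exp s * (\<integral>w. (norm (increment s t w)) ^ 4 \<partial>M)"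
    using integral_mono[OF i b(1) pt] b(2) F_second_moment_norm(2)[OF st(1)] by simp
  also have "\<dots> \<le> 2 * exp s * (12 * (total_rate * (t - s))\<^sup>2)"
    by (intro mult_left_mono increment_norm_moments(4)[OF st]) simp
  finally show "(\<integral>w. (p w)\<^sup>2 \<partial>M) \<le> 24 * exp s * (total_rate * (t - s))\<^sup>2" by simp
qed

text \<open>Half the sum of \<open>(F (s (i+1)) - F (s i)) ** \<Delta>B\<close> is the difference of the trapezoidal and the
  left-point sums, hence tends to 0; to leading order it is half the sum of \<open>F (s i) ** \<Delta>B ** \<Delta>B\<close>,
  whose expectation is known.\<close>

lemma variance_rate_12: "variance_rate (unit_mat 1 2) = 3 * variance_rate (unit_mat 1 1)"
proof -
  \<comment> \<open>The rate of the entry 11 of the expectation of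
    \<open>increment s t w ** increment s t w\<close>; the claim is that it vanishes.\<close>
  define \<kappa> where "\<kappa> = 3 * variance_rate (unit_mat 1 1) - variance_rate (unit_mat 1 2)"
  define h where "h m = 1 / real (Suc m)" for m
  define u where "u m i = real i * h m" for m i
  have h: "0 < h m" "h m \<le> 1" "real (Suc m) * h m = 1" for m by (simp_all add: h_def)
  have ust: "0 \<le> u m i" "u m i \<le> u m (Suc i)" "u m (Suc i) - u m i = h m" for m i
    using h[of m] by (simp_all add: u_def distrib_right)
  have ule: "u m (Suc i) \<le> 1" if "i < Suc m" for m i
    using mult_right_mono[of "real (Suc i)" "real (Suc m)" "h m"] that h[of m] by (simp add: u_def del: of_nat_Suc)
  have pts: "partition_pts 1 (Suc m) (u m)" for m
    using ust[of m] h(3)[of m] by (simp add: partition_pts_def u_def)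
  have hlim: "h \<longlonglongrightarrow> 0" unfolding h_def by (rule LIMSEQ_Suc) (rule lim_const_over_n)
  have mesh: "\<forall>\<^sub>F m in sequentially. \<forall>i<Suc m. u m (Suc i) - u m i < \<delta>" if "0 < \<delta>" for \<delta>
    using order_tendstoD(2)[OF hlim that] unfolding ust(3) by (auto elim: eventually_mono)
  let ?d = "\<lambda>m i w. increment (u m i) (u m (Suc i)) w"
  \<comment> \<open>\<open>I\<close> and \<open>J\<close> are the errors of the left-point and the
    trapezoidal sums. Both tend to 0 in probability because the Stratonovich integral of
    \<open>F\<close>, given by the equation, is also its Ito integral.\<close>
  define I where "I m w = (\<Sum>i<Suc m. F (u m i) w ** ?d m i w) - (F 1 w - mat 1)" for m w
  define J where "J m w = (\<Sum>i<Suc m. ((1/2) *\<^sub>R (F (u m i) w + F (u m (Suc i)) w)) ** ?d m i w) - (F 1 w - mat 1)" for m w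
  have [measurable]: "F 1 \<in> borel_measurable M" by (rule F_measurable) simp
  have [measurable]: "F (u m i) \<in> borel_measurable M" "B (u m i) \<in> borel_measurable M" for m i using ust by simp_all
  have [measurable]: "I m \<in> borel_measurable M" "J m \<in> borel_measurable M" for m
    unfolding I_def J_def by measurable
  have I0: "tends_prob_0 M I" unfolding I_def
    by (rule partition_limitD[where N=Suc and s=u, OF ito_integral[of 1, unfolded has_ito_integral_def]])
      (use pts mesh in auto)
  have J0: "tends_prob_0 M J" unfolding J_def
    by (rule partition_limitD[where N=Suc and s=u, OF F_sde[of 1, unfolded has_stratonovich_integral_def]])
      (use pts mesh in auto)
  have "tends_prob_0 M (\<lambda>m w. J m w - I m w)" by (rule tends_prob_0_diff[OF J0 I0]) measurable
  from tends_prob_0_AE_subseq[OF this] obtain \<rho> :: "nat \<Rightarrow> nat" where \<rho>: "strict_mono \<rho>"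
    "AE w in M. (\<lambda>l. J (\<rho> l) w - I (\<rho> l) w) \<longlonglongrightarrow> 0" by auto
  \<comment> \<open>The increment of \<open>F\<close> over a step is \<open>F (u m i)\<close> times
    the increment of \<open>B\<close> plus \<open>R\<close>. Accordingly \<open>P\<close> is the
    leading part of twice the entry 11 of \<open>J m - I m\<close>, and \<open>Q\<close> the
    remainder.\<close>
  define R where "R m i w = F (u m (Suc i)) w - F (u m i) w - F (u m i) w ** ?d m i w" for m i w
  define P where "P m w = (\<Sum>i<Suc m. (F (u m i) w ** (?d m i w ** ?d m i w)) $ 1 $ 1)" for m w
  define Q where "Q m w = (\<Sum>i<Suc m. (R m i w ** ?d m i w) $ 1 $ 1)" for m w
  have [measurable]: "R m i \<in> borel_measurable M" for m i unfolding R_def by measurable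
  have [measurable]: "P m \<in> borel_measurable M" "Q m \<in> borel_measurable M" for m
    unfolding P_def Q_def by measurable
  have PQ: "P m w + Q m w = 2 * (J m w - I m w) $ 1 $ 1" for m w
  proof -
    have t: "(X ** (D ** D)) $ 1 $ 1 + ((Y - X - X ** D) ** D) $ 1 $ 1
       = 2 * (((1/2) *\<^sub>R (X + Y)) ** D - X ** D) $ 1 $ 1" for X Y D :: mat2
      by (simp add: matrix_matrix_mult_def sum_2 algebra_simps)
    show ?thesis
      unfolding P_def Q_def I_def J_def R_def
      by (simp add: sum.distrib[symmetric] t sum_subtractf[symmetric] sum_component sum_distrib_left del: sum.lessThan_Suc)
  qed
  define K where "K = 2 * exp 1 * total_rate\<^sup>2"
  have Qi: "integrable M (Q m)" and Qb: "(\<integral>w. norm (Q m w) \<partial>M) \<le> (K + total_rate) * sqrt (h m)" for m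
  proof -
    \<comment> \<open>Balances the second moment of \<open>R\<close>, of order h^2, against that of
      the increment, of order h. Each summand is then of order h^(3/2), and the sum of 1/h of them
      is of order sqrt h.\<close>
    define q where "q = sqrt (h m)"
    have q: "0 < q" "q * q = h m" using h[of m] by (simp_all add: q_def)
    have b: "integrable M (\<lambda>w. (1 / q) * (norm (R m i w))\<^sup>2 + q * (norm (?d m i w))\<^sup>2)"
        "(\<integral>w. (1 / q) * (norm (R m i w))\<^sup>2 + q * (norm (?d m i w))\<^sup>2 \<partial>M) \<le> (K + total_rate) * q * h m"
      if i: "i < Suc m" for i
    proof -
      note Rb = F_increment_linearization[OF ust(1,2) ule[OF i], folded R_def K_def]
      note db = increment_norm_moments(1,2)[OF ust(1,2), of m i]
      show "integrable M (\<lambda>w. (1 / q) * (norm (R m i w))\<^sup>2 + q * (norm (?d m i w))\<^sup>2)" using Rb(1) db(1) by simp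
      have "(\<integral>w. (1 / q) * (norm (R m i w))\<^sup>2 + q * (norm (?d m i w))\<^sup>2 \<partial>M) =
         (1 / q) * (\<integral>w. (norm (R m i w))\<^sup>2 \<partial>M) + q * (total_rate * h m)"
        using Rb(1) db by (simp add: ust(3))
      also have "\<dots> \<le> (1 / q) * (K * (h m)\<^sup>2) + q * (total_rate * h m)"
        using Rb(2) q unfolding ust(3) by (intro add_right_mono mult_left_mono) auto
      also have "\<dots> = (K + total_rate) * q * h m"
        using q(1) unfolding q(2)[symmetric] by (simp add: field_simps power2_eq_square)
      finally show "(\<integral>w. (1 / q) * (norm (R m i w))\<^sup>2 + q * (norm (?d m i w))\<^sup>2 \<partial>M) \<le> (K + total_rate) * q * h m" .
    qed
    define S where "S w = (\<Sum>i<Suc m. (1 / q) * (norm (R m i w))\<^sup>2 + q * (norm (?d m i w))\<^sup>2)" for w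
    have pt: "\<bar>Q m w\<bar> \<le> S w" for w
      unfolding Q_def S_def
    proof (rule order_trans[OF sum_abs sum_mono])
      fix i
      have "\<bar>(R m i w ** ?d m i w) $ 1 $ 1\<bar> \<le> norm (R m i w ** ?d m i w)"
        by (rule order_trans[OF component_le_norm_cart Finite_Cartesian_Product.norm_nth_le])
      also have "\<dots> \<le> norm (R m i w) * norm (?d m i w)" by (rule norm_matrix_mult_le)
      also have "\<dots> \<le> (1 / q) * (norm (R m i w))\<^sup>2 + q * (norm (?d m i w))\<^sup>2"
      proof -
        define x y where "x = norm (R m i w)" and "y = norm (?d m i w)"
        have "0 \<le> x * y" by (simp add: x_def y_def)
        have "2 * x * (q * y) \<le> x\<^sup>2 + (q * y)\<^sup>2" by (rule sum_squares_bound)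
        then have "q * (2 * (x * y)) \<le> q * ((1 / q) * x\<^sup>2 + q * y\<^sup>2)"
          using q(1) by (simp add: power2_eq_square algebra_simps)
        then have "2 * (x * y) \<le> (1 / q) * x\<^sup>2 + q * y\<^sup>2" using q(1) by (simp only: mult_le_cancel_left_pos)
        then show ?thesis using \<open>0 \<le> x * y\<close> unfolding x_def y_def by linarith
      qed
      finally show "\<bar>(R m i w ** ?d m i w) $ 1 $ 1\<bar> \<le> (1 / q) * (norm (R m i w))\<^sup>2 + q * (norm (?d m i w))\<^sup>2" .
    qed
    have Si: "integrable M S" unfolding S_def by (intro Bochner_Integration.integrable_sum b(1)) simp
    show Qi: "integrable M (Q m)"
      by (rule Bochner_Integration.integrable_bound[OF Si]) (auto intro!: AE_I2 order_trans[OF pt abs_ge_self] simp del: sum.lessThan_Suc)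
    have "(\<integral>w. norm (Q m w) \<partial>M) \<le> integral\<^sup>L M S"
      by (rule integral_mono[OF _ Si]) (use Qi pt in \<open>auto simp del: sum.lessThan_Suc\<close>)
    also have "\<dots> = (\<Sum>i<Suc m. \<integral>w. (1 / q) * (norm (R m i w))\<^sup>2 + q * (norm (?d m i w))\<^sup>2 \<partial>M)"
      unfolding S_def by (rule Bochner_Integration.integral_sum) (rule b(1), simp)
    also have "\<dots> \<le> (\<Sum>i<Suc m. (K + total_rate) * q * h m)" by (intro sum_mono b(2)) simp
    also have "\<dots> = (K + total_rate) * q * (real (Suc m) * h m)" by simp
    also have "\<dots> = (K + total_rate) * sqrt (h m)" unfolding h(3) q_def by simp
    finally show "(\<integral>w. norm (Q m w) \<partial>M) \<le> (K + total_rate) * sqrt (h m)" .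
  qed
  have "(\<lambda>m. (K + total_rate) * sqrt (h m)) \<longlonglongrightarrow> (K + total_rate) * sqrt 0"
    by (intro tendsto_intros hlim)
  then have "(\<lambda>m. \<integral>w. norm (Q m w) \<partial>M) \<longlonglongrightarrow> 0"
    by (intro Lim_null_comparison[of "\<lambda>m. \<integral>w. norm (Q m w) \<partial>M"]) (use Qb in \<open>auto intro!: always_eventually\<close>)
  from LIMSEQ_subseq_LIMSEQ[OF this \<rho>(1)] have "(\<lambda>l. \<integral>w. norm (Q (\<rho> l) w) \<partial>M) \<longlonglongrightarrow> 0"
    by (simp add: o_def)
  from tendsto_L1_AE_subseq[OF Qi this] obtain \<sigma> :: "nat \<Rightarrow> nat" where \<sigma>: "strict_mono \<sigma>"
    "AE w in M. (\<lambda>l. Q (\<rho> (\<sigma> l)) w) \<longlonglongrightarrow> 0" by auto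
  have Plim: "AE w in M. (\<lambda>l. P (\<rho> (\<sigma> l)) w) \<longlonglongrightarrow> 0"
    using \<rho>(2) \<sigma>(2)
  proof eventually_elim
    case (elim w)
    have "(\<lambda>l. 2 * (J (\<rho> (\<sigma> l)) w - I (\<rho> (\<sigma> l)) w) $ 1 $ 1 - Q (\<rho> (\<sigma> l)) w) \<longlonglongrightarrow> 2 * (0::mat2) $ 1 $ 1 - 0"
      using LIMSEQ_subseq_LIMSEQ[OF elim(1) \<sigma>(1)] elim(2) unfolding o_def by (intro tendsto_intros)
    then show ?case unfolding PQ[symmetric] by simp
  qed
  note p = F_mult_square_increment[OF ust(1,2), unfolded ust(3)]
  \<comment> \<open>\<open>P\<close> has the same mean \<kappa> for every mesh but tends to 0 almost
    surely along a subsequence. The uniform second moments \<open>P2\<close> let the means converge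
    too, which forces \<kappa> = 0.\<close>
  have PE: "(\<integral>w. P m w \<partial>M) = \<kappa>" for m
  proof -
    have "(\<integral>w. P m w \<partial>M) = (\<Sum>i<Suc m. \<kappa> * h m)"
      unfolding P_def by (subst Bochner_Integration.integral_sum[OF p(1)]) (simp only: p(2) \<kappa>_def)
    also have "\<dots> = \<kappa> * (real (Suc m) * h m)" by simp
    finally show ?thesis unfolding h(3) by simp
  qed
  have P2: "integrable M (\<lambda>w. (P m w)\<^sup>2)" "(\<integral>w. (P m w)\<^sup>2 \<partial>M) \<le> 24 * exp 1 * total_rate\<^sup>2" for m
  proof -
    let ?p = "\<lambda>i w. (F (u m i) w ** (?d m i w ** ?d m i w)) $ 1 $ 1"
    \<comment> \<open>Cauchy-Schwarz without any orthogonality is enough here: each of the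
      \<open>Suc m\<close> summands has second moment of order h^2, and
      \<open>(real (Suc m) * h m)\<^sup>2\<close> is 1.\<close>
    define S where "S w = real (Suc m) * (\<Sum>i<Suc m. (?p i w)\<^sup>2)" for w
    have pt: "(P m w)\<^sup>2 \<le> S w" for w
      unfolding P_def S_def using sum_squared_le_sum_of_squares[of "\<lambda>i. ?p i w" "{..<Suc m}"]
      by (simp add: mult.commute del: sum.lessThan_Suc)
    have Si: "integrable M S"
      unfolding S_def by (intro Bochner_Integration.integrable_mult_right Bochner_Integration.integrable_sum p(3))
    show i: "integrable M (\<lambda>w. (P m w)\<^sup>2)"
      by (rule Bochner_Integration.integrable_bound[OF Si]) (auto intro!: AE_I2 order_trans[OF pt abs_ge_self] simp del: sum.lessThan_Suc)
    have "(\<integral>w. (P m w)\<^sup>2 \<partial>M) \<le> integral\<^sup>L M S"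
      by (rule integral_mono[OF i Si pt])
    also have "\<dots> = real (Suc m) * (\<Sum>i<Suc m. \<integral>w. (?p i w)\<^sup>2 \<partial>M)"
      unfolding S_def using p(3) by (simp add: Bochner_Integration.integral_sum del: sum.lessThan_Suc)
    also have "\<dots> \<le> real (Suc m) * (\<Sum>i<Suc m. 24 * exp 1 * (total_rate * h m)\<^sup>2)"
    proof (intro mult_left_mono sum_mono)
      fix i assume "i \<in> {..<Suc m}"
      then have "u m i \<le> 1" using ule[of i m] ust(2)[of m i] by simp
      then have "24 * exp (u m i) * (total_rate * h m)\<^sup>2 \<le> 24 * exp 1 * (total_rate * h m)\<^sup>2"
        by (intro mult_right_mono) auto
      with p(4) show "(\<integral>w. (?p i w)\<^sup>2 \<partial>M) \<le> 24 * exp 1 * (total_rate * h m)\<^sup>2" by (rule order_trans)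
    qed simp
    also have "\<dots> = 24 * exp 1 * total_rate\<^sup>2 * (real (Suc m) * h m)\<^sup>2"
      by (simp add: power2_eq_square mult_ac del: of_nat_Suc)
    finally show "(\<integral>w. (P m w)\<^sup>2 \<partial>M) \<le> 24 * exp 1 * total_rate\<^sup>2" unfolding h(3) by simp
  qed
  have "(\<lambda>l. \<integral>w. P (\<rho> (\<sigma> l)) w \<partial>M) \<longlonglongrightarrow> (\<integral>w. 0 \<partial>M)"
    by (rule tendsto_integral_bounded_second_moment(2)[OF _ _ Plim P2]) measurable
  then have "\<kappa> = 0" unfolding PE by (simp add: LIMSEQ_const_iff)
  then show ?thesis by (simp add: \<kappa>_def)
qed

lemma variance_rate_values:
  "variance_rate (unit_mat 1 1) = 1 / 4" "variance_rate (unit_mat 1 2) = 3 / 4"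
  using variance_rate_row_sum variance_rate_12 by linarith+

end

section \<open>Moments of the rows\<close>

text \<open>An error of order n^(-3/2) in each of n factors disappears in the limit. The third power
  of the square root is the form in which \<open>vector_increment_moment\<close> delivers that
  error.\<close>

lemma compound_growth_limit:
  fixes a c :: real
  assumes "0 < a"
  shows "(\<lambda>n. (1 + a * (1 / real n) + c * (sqrt (1 / real n)) ^ 3) ^ n) \<longlonglongrightarrow> exp a"
  using assms by real_asymp

context geometric_brownian_motion_SL2
begin

text \<open>With row vectors n = (a, b) and n' = (-b, a), the matrices are n^T n and n^T n'. They
  are conjugates of the matrix units 11 and 12 by the rotation with rows n and n', and pairing them
  with D gives the components of n D along n and n'.\<close>

lemma variance_rate_unit_vector:
  assumes n: "a\<^sup>2 + b\<^sup>2 = 1"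
  shows "variance_rate (vector [vector [a * a, a * b], vector [b * a, b * b]]) = 1 / 4"
    and "variance_rate (vector [vector [a * - b, a * a], vector [b * - b, b * a]]) = 3 / 4"
proof -
  define Q :: mat2 where "Q = vector [vector [a, b], vector [- b, a]]"
  have n': "a * a + b * b = 1" "b * b + a * a = 1" using n by (simp_all add: power2_eq_square)
  have Q: "orthogonal_matrix Q"
    by (simp add: Q_def orthogonal_matrix_def vec_eq_iff forall_2 matrix_matrix_mult_def transpose_def mat_def sum_2 n')
  have "transpose Q ** unit_mat 1 1 ** Q = vector [vector [a * a, a * b], vector [b * a, b * b]]"
    by (simp add: Q_def vec_eq_iff forall_2 matrix_matrix_mult_def transpose_def unit_mat_def axis_def sum_2)
  then show "variance_rate (vector [vector [a * a, a * b], vector [b * a, b * b]]) = 1 / 4"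
    using variance_rate_conj[OF Q, of "unit_mat 1 1"] variance_rate_values by simp
  have "transpose Q ** unit_mat 1 2 ** Q = vector [vector [a * - b, a * a], vector [b * - b, b * a]]"
    by (simp add: Q_def vec_eq_iff forall_2 matrix_matrix_mult_def transpose_def unit_mat_def axis_def sum_2)
  then show "variance_rate (vector [vector [a * - b, a * a], vector [b * - b, b * a]]) = 3 / 4"
    using variance_rate_conj[OF Q, of "unit_mat 1 2"] variance_rate_values by simp
qed

text \<open>In the frame with first vector n = x/|x|, the squared norm of x + x D is |x|^2((1 + X)^2
  + Y^2), where X and Y are the components of n D. Their laws do not depend on the direction of x,
  so one \<open>K\<close> serves all x.\<close>

lemma vector_increment_moment:
  fixes q :: real
  assumes q: "1 \<le> q"
  obtains K where "0 \<le> K" and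
    "\<And>s t x. 0 \<le> s \<Longrightarrow> s < t \<Longrightarrow> t \<le> s + 1 \<Longrightarrow>
      integrable M (\<lambda>w. norm (x + x v* increment s t w) powr (2 * q)) \<and>
      \<bar>(\<integral>w. norm (x + x v* increment s t w) powr (2 * q) \<partial>M) - (1 + q * (q + 1) / 2 * (t - s)) * norm x powr (2 * q)\<bar>
        \<le> K * sqrt (t - s) ^ 3 * norm x powr (2 * q)"
proof -
  obtain K where K: "0 \<le> K" and moment:
    "\<And>h X Y. 0 < h \<Longrightarrow> h \<le> 1 \<Longrightarrow> X \<in> borel_measurable M \<Longrightarrow> Y \<in> borel_measurable M \<Longrightarrow>
      distr M borel X = normal_law (1 / 4 * h\<^sup>2) \<Longrightarrow> distr M borel Y = normal_law (3 / 4 * h\<^sup>2) \<Longrightarrow>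
      integrable M (\<lambda>w. ((1 + X w)\<^sup>2 + (Y w)\<^sup>2) powr q) \<and>
      \<bar>(\<integral>w. ((1 + X w)\<^sup>2 + (Y w)\<^sup>2) powr q \<partial>M) - (1 + q * (q + 1) / 2 * h\<^sup>2)\<bar> \<le> K * h ^ 3"
    using normal_square_sum_moment[OF q] by blast
  show thesis
  proof (rule that[OF K])
    fix s t :: real and x :: "real^2"
    assume s: "0 \<le> s" and t: "s < t" "t \<le> s + 1"
    have st: "0 \<le> s" "s \<le> t" using s t by auto
    note [measurable] = increment_measurable_M[OF st]
    define h where "h = sqrt (t - s)"
    have h: "0 < h" "h \<le> 1" "h\<^sup>2 = t - s" using t by (simp_all add: h_def)
    show "integrable M (\<lambda>w. norm (x + x v* increment s t w) powr (2 * q)) \<and>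
      \<bar>(\<integral>w. norm (x + x v* increment s t w) powr (2 * q) \<partial>M) - (1 + q * (q + 1) / 2 * (t - s)) * norm x powr (2 * q)\<bar>
        \<le> K * sqrt (t - s) ^ 3 * norm x powr (2 * q)"
    proof (cases "x = 0")
      case True
      then show ?thesis by simp
    next
      case False
      define a b where "a = x $ 1 / norm x" and "b = x $ 2 / norm x"
      have "(norm x)\<^sup>2 = (x $ 1)\<^sup>2 + (x $ 2)\<^sup>2"
        unfolding power2_norm_eq_inner inner_vec_def by (simp add: sum_2 power2_eq_square)
      then have "a\<^sup>2 + b\<^sup>2 = (norm x)\<^sup>2 / (norm x)\<^sup>2"
        by (simp only: a_def b_def power_divide add_divide_distrib)
      then have ab: "a\<^sup>2 + b\<^sup>2 = 1" using False by simp
      define A A' :: mat2 where "A = vector [vector [a * a, a * b], vector [b * a, b * b]]"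
        and "A' = vector [vector [a * - b, a * a], vector [b * - b, b * a]]"
      define X Y where "X w = A \<bullet> increment s t w" and "Y w = A' \<bullet> increment s t w" for w
      have [measurable]: "X \<in> borel_measurable M" "Y \<in> borel_measurable M" unfolding X_def Y_def by measurable
      have law: "distr M borel X = normal_law (1 / 4 * h\<^sup>2)" "distr M borel Y = normal_law (3 / 4 * h\<^sup>2)"
        unfolding X_def[abs_def] Y_def[abs_def] A_def A'_def h(3) increment_law[OF st] variance_rate_unit_vector[OF ab]
        by (rule refl)+
      have norm_eq: "norm (x + x v* increment s t w) powr (2 * q) = norm x powr (2 * q) * ((1 + X w)\<^sup>2 + (Y w)\<^sup>2) powr q" for w
      proof -
        define D where "D = increment s t w"
        have x: "x $ 1 = norm x * a" "x $ 2 = norm x * b" using False by (simp_all add: a_def b_def)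
        \<comment> \<open>Coordinates of n + n D in the standard frame; 1 + X and Y are the same
          vector in the rotated frame, so the sums of squares agree.\<close>
        define u v where "u = a + (a * D$1$1 + b * D$2$1)" and "v = b + (a * D$1$2 + b * D$2$2)"
        have X: "1 + X w = a * u + b * v"
        proof -
          have "a * u + b * v = (a\<^sup>2 + b\<^sup>2) + X w"
            by (simp add: X_def D_def[symmetric] A_def inner_mat2 u_def v_def power2_eq_square algebra_simps)
          then show ?thesis using ab by simp
        qed
        have Y: "Y w = - b * u + a * v"
          by (simp add: Y_def D_def[symmetric] A'_def inner_mat2 u_def v_def power2_eq_square algebra_simps)
        have "(1 + X w)\<^sup>2 + (Y w)\<^sup>2 = (a\<^sup>2 + b\<^sup>2) * (u\<^sup>2 + v\<^sup>2)"
          unfolding X Y by (simp add: power2_eq_square algebra_simps)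
        then have XY: "(1 + X w)\<^sup>2 + (Y w)\<^sup>2 = u\<^sup>2 + v\<^sup>2" using ab by simp
        have "(norm (x + x v* D))\<^sup>2 = (x$1 + (x$1 * D$1$1 + x$2 * D$2$1))\<^sup>2 + (x$2 + (x$1 * D$1$2 + x$2 * D$2$2))\<^sup>2"
          unfolding power2_norm_eq_inner inner_vec_def
          by (simp add: sum_2 vector_matrix_mult_def power2_eq_square mult.commute)
        also have "\<dots> = (norm x)\<^sup>2 * (u\<^sup>2 + v\<^sup>2)"
          unfolding x u_def v_def by (simp add: power2_eq_square algebra_simps)
        finally have eq: "(norm (x + x v* D))\<^sup>2 = (norm x)\<^sup>2 * ((1 + X w)\<^sup>2 + (Y w)\<^sup>2)" unfolding XY .
        have p: "y powr (2 * q) = (y\<^sup>2) powr q" if "0 \<le> y" for y :: real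
          using that by (cases "y = 0") (simp_all add: powr_powr[symmetric] powr_numeral)
        show ?thesis unfolding D_def[symmetric] by (simp add: p eq powr_mult)
      qed
      note m = moment[OF h(1,2) _ _ law]
      define E where "E = (\<integral>w. ((1 + X w)\<^sup>2 + (Y w)\<^sup>2) powr q \<partial>M)"
      have E: "\<bar>E - (1 + q * (q + 1) / 2 * (t - s))\<bar> \<le> K * h ^ 3" using m by (simp add: E_def h(3))
      have "\<bar>norm x powr (2 * q) * E - (1 + q * (q + 1) / 2 * (t - s)) * norm x powr (2 * q)\<bar>
          = \<bar>E - (1 + q * (q + 1) / 2 * (t - s))\<bar> * norm x powr (2 * q)"
        by (subst abs_of_nonneg[of "norm x powr (2 * q)", symmetric], simp, subst abs_mult[symmetric]) (simp add: algebra_simps)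
      also have "\<dots> \<le> K * h ^ 3 * norm x powr (2 * q)" using E by (intro mult_right_mono) auto
      finally show ?thesis unfolding norm_eq h_def[symmetric] using m by (simp add: E_def)
    qed
  qed
qed

text \<open>The bounds \<open>step\<close> hold for every fixed vector x, and the current row is
  independent of the next increment, so they may be integrated over the law of the row. Finiteness
  of the new moment comes out of the upper bound.\<close>

lemma euler_row_moment_step:
  fixes q :: real
  assumes u: "0 \<le> u 0" "mono u" and y: "0 \<le> l" "0 \<le> r"
    and step: "\<And>x. integrable M (\<lambda>w. norm (x + x v* increment (u k) (u (Suc k)) w) powr (2 * q)) \<and>
      l * norm x powr (2 * q) \<le> (\<integral>w. norm (x + x v* increment (u k) (u (Suc k)) w) powr (2 * q) \<partial>M) \<and>
      (\<integral>w. norm (x + x v* increment (u k) (u (Suc k)) w) powr (2 * q) \<partial>M) \<le> r * norm x powr (2 * q)"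
    and int: "integrable M (\<lambda>w. norm (euler u k w $ i) powr (2 * q))"
  shows "integrable M (\<lambda>w. norm (euler u (Suc k) w $ i) powr (2 * q))"
    and "l * (\<integral>w. norm (euler u k w $ i) powr (2 * q) \<partial>M) \<le> (\<integral>w. norm (euler u (Suc k) w $ i) powr (2 * q) \<partial>M)"
    and "(\<integral>w. norm (euler u (Suc k) w $ i) powr (2 * q) \<partial>M) \<le> r * (\<integral>w. norm (euler u k w $ i) powr (2 * q) \<partial>M)"
proof -
  have st: "0 \<le> u k" "u k \<le> u (Suc k)" using u monoD[OF u(2), of 0 k] monoD[OF u(2), of k "Suc k"] by auto
  note [measurable] = increment_measurable_M[OF st]
  have Xm: "euler u k \<in> borel_measurable (G (u k))" using euler_adapted_square_integrable[OF u] by blast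
  note [measurable] = measurable_G_M[OF st(1) Xm]
  let ?f = "\<lambda>w. norm (euler u (Suc k) w $ i) powr (2 * q)" and ?g = "\<lambda>w. norm (euler u k w $ i) powr (2 * q)"
  have fm: "?f \<in> borel_measurable M" unfolding euler.simps by measurable
  have "(\<integral>\<^sup>+w. ennreal (?f w) \<partial>M) = (\<integral>\<^sup>+w. \<integral>\<^sup>+w'. ennreal (norm ((euler u k w + euler u k w ** increment (u k) (u (Suc k)) w') $ i) powr (2 * q)) \<partial>M \<partial>M)"
    using nn_integral_indep_var[OF indep_var_increment[OF st Xm, of "\<lambda>A. A" borel],
      of "\<lambda>(X, D). ennreal (norm ((X + X ** D) $ i) powr (2 * q))"] by simp
  also have "\<dots> = (\<integral>\<^sup>+w. ennreal (\<integral>w'. norm (euler u k w $ i + euler u k w $ i v* increment (u k) (u (Suc k)) w') powr (2 * q) \<partial>M) \<partial>M)"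
    unfolding vector_add_component matrix_mult_nth
    by (intro nn_integral_cong nn_integral_eq_integral) (use step in auto)
  finally have eq: "(\<integral>\<^sup>+w. ennreal (?f w) \<partial>M) = \<dots>" .
  have "(\<integral>\<^sup>+w. ennreal (?f w) \<partial>M) \<le> (\<integral>\<^sup>+w. ennreal (r * ?g w) \<partial>M)"
    unfolding eq by (intro nn_integral_mono ennreal_leI) (use step in auto)
  also have "\<dots> = ennreal (r * integral\<^sup>L M ?g)"
    using nn_integral_eq_integral[of M "\<lambda>w. r * ?g w"] int y by simp
  finally have le: "(\<integral>\<^sup>+w. ennreal (?f w) \<partial>M) \<le> ennreal (r * integral\<^sup>L M ?g)" .
  show fi: "integrable M ?f"
    using le fm by (intro integrableI_bounded) (auto simp: less_top[symmetric] top_unique simp del: euler.simps)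
  have f: "(\<integral>\<^sup>+w. ennreal (?f w) \<partial>M) = ennreal (integral\<^sup>L M ?f)"
    by (rule nn_integral_eq_integral[OF fi]) simp
  have g0: "0 \<le> integral\<^sup>L M ?g" by (rule Bochner_Integration.integral_nonneg) simp
  show "integral\<^sup>L M ?f \<le> r * integral\<^sup>L M ?g"
    using le unfolding f using y g0 by (subst (asm) ennreal_le_iff) auto
  have "ennreal (l * integral\<^sup>L M ?g) = (\<integral>\<^sup>+w. ennreal (l * ?g w) \<partial>M)"
    using nn_integral_eq_integral[of M "\<lambda>w. l * ?g w"] int y by simp
  also have "\<dots> \<le> (\<integral>\<^sup>+w. ennreal (?f w) \<partial>M)"
    unfolding eq by (intro nn_integral_mono ennreal_leI) (use step in auto)
  finally show "l * integral\<^sup>L M ?g \<le> integral\<^sup>L M ?f"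
    unfolding f by (subst (asm) ennreal_le_iff) (auto intro!: Bochner_Integration.integral_nonneg simp del: euler.simps)
qed

text \<open>The moment after N steps lies between N-th powers of a lower and an upper growth factor,
  and both powers have the same limit. This needs N so large that the steps are at most 1 and the
  lower factor is nonnegative, hence integrability is claimed only eventually.\<close>

lemma euler_row_moment_limit:
  fixes q :: real
  assumes q: "1 \<le> q" and T: "0 < T"
  shows "\<forall>\<^sub>F N in sequentially. integrable M (\<lambda>w. norm (euler (\<lambda>i. real i * (T / real N)) N w $ i) powr (2 * q))"
    and "(\<lambda>N. \<integral>w. norm (euler (\<lambda>i. real i * (T / real N)) N w $ i) powr (2 * q) \<partial>M) \<longlonglongrightarrow> exp (q * (q + 1) * T / 2)"
proof -
  obtain K where K: "0 \<le> K" and inc: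
    "\<And>s t x. 0 \<le> s \<Longrightarrow> s < t \<Longrightarrow> t \<le> s + 1 \<Longrightarrow>
      integrable M (\<lambda>w. norm (x + x v* increment s t w) powr (2 * q)) \<and>
      \<bar>(\<integral>w. norm (x + x v* increment s t w) powr (2 * q) \<partial>M) - (1 + q * (q + 1) / 2 * (t - s)) * norm x powr (2 * q)\<bar>
        \<le> K * sqrt (t - s) ^ 3 * norm x powr (2 * q)"
    using vector_increment_moment[OF q] by blast
  define a where "a = q * (q + 1) / 2 * T"
  define c where "c = K * sqrt T ^ 3"
  \<comment> \<open>\<open>1 + e N\<close> and \<open>1 + d N\<close> are the upper and lower growth
    factors of one step of length T/N.\<close>
  define e where "e N = a * (1 / real N) + c * sqrt (1 / real N) ^ 3" for N
  define d where "d N = a * (1 / real N) + (- c) * sqrt (1 / real N) ^ 3" for N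
  have a: "0 < a" using q T by (simp add: a_def)
  let ?E = "\<lambda>N k. \<integral>w. norm (euler (\<lambda>i. real i * (T / real N)) k w $ i) powr (2 * q) \<partial>M"
  have main: "integrable M (\<lambda>w. norm (euler (\<lambda>i. real i * (T / real N)) N w $ i) powr (2 * q)) \<and>
      (1 + d N) ^ N \<le> ?E N N \<and> ?E N N \<le> (1 + e N) ^ N"
    if N: "0 < N" "T / real N \<le> 1" "0 \<le> 1 + d N" for N
  proof -
    define h where "h = T / real N"
    have h: "0 < h" "h \<le> 1" using T N by (simp_all add: h_def)
    define u where "u i = real i * h" for i
    have u: "0 \<le> u 0" "mono u"
      using h by (auto simp: u_def mono_def intro!: mult_right_mono)
    have us: "0 \<le> u k" "u k < u (Suc k)" "u (Suc k) \<le> u k + 1" "u (Suc k) - u k = h" for k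
      using h by (simp_all add: u_def distrib_right)
    have ed: "1 + d N = 1 + q * (q + 1) / 2 * h - K * sqrt h ^ 3" "1 + e N = 1 + q * (q + 1) / 2 * h + K * sqrt h ^ 3"
      by (simp_all add: d_def e_def a_def c_def h_def real_sqrt_divide power_divide)
    have e0: "0 \<le> 1 + e N" using h q K unfolding ed by simp
    have step: "integrable M (\<lambda>w. norm (x + x v* increment (u k) (u (Suc k)) w) powr (2 * q)) \<and>
      (1 + d N) * norm x powr (2 * q) \<le> (\<integral>w. norm (x + x v* increment (u k) (u (Suc k)) w) powr (2 * q) \<partial>M) \<and>
      (\<integral>w. norm (x + x v* increment (u k) (u (Suc k)) w) powr (2 * q) \<partial>M) \<le> (1 + e N) * norm x powr (2 * q)" for x k
      using inc[OF us(1)[of k] us(2)[of k] us(3)[of k], of x] unfolding us(4) ed distrib_right left_diff_distrib by linarith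
    have "integrable M (\<lambda>w. norm (euler u k w $ i) powr (2 * q)) \<and>
      (1 + d N) ^ k \<le> (\<integral>w. norm (euler u k w $ i) powr (2 * q) \<partial>M) \<and>
      (\<integral>w. norm (euler u k w $ i) powr (2 * q) \<partial>M) \<le> (1 + e N) ^ k" for k
    proof (induction k)
      case 0
      have "norm ((mat 1 :: mat2) $ i) = 1"
      proof -
        have "(mat 1 :: mat2) $ i = axis i 1" by (simp add: mat_def axis_def vec_eq_iff)
        then show ?thesis by simp
      qed
      then show ?case by (simp add: prob_space)
    next
      case (Suc k)
      note s = euler_row_moment_step[OF u N(3) e0 step, of k i]
      have "(1 + d N) ^ Suc k \<le> (1 + d N) * (\<integral>w. norm (euler u k w $ i) powr (2 * q) \<partial>M)"
        using Suc N(3) by (simp add: mult_left_mono)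
      moreover have "(1 + e N) * (\<integral>w. norm (euler u k w $ i) powr (2 * q) \<partial>M) \<le> (1 + e N) ^ Suc k"
        using Suc e0 by (simp add: mult_left_mono)
      ultimately show ?case using s Suc by linarith
    qed
    moreover have "u = (\<lambda>i. real i * (T / real N))" by (simp add: u_def h_def fun_eq_iff)
    ultimately show ?thesis by simp
  qed
  have "(\<lambda>N. T / real N) \<longlonglongrightarrow> 0" by (rule lim_const_over_n)
  then have ev1: "\<forall>\<^sub>F N in sequentially. T / real N < 1" by (rule order_tendstoD) simp
  have "(\<lambda>N. 1 + d N) \<longlonglongrightarrow> 1 + (a * 0 + (- c) * sqrt 0 ^ 3)"
    unfolding d_def by (intro tendsto_intros lim_const_over_n)
  then have ev2: "\<forall>\<^sub>F N in sequentially. 0 < 1 + d N" by (rule order_tendstoD) simp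
  have ev: "\<forall>\<^sub>F N in sequentially. integrable M (\<lambda>w. norm (euler (\<lambda>i. real i * (T / real N)) N w $ i) powr (2 * q)) \<and>
      (1 + d N) ^ N \<le> ?E N N \<and> ?E N N \<le> (1 + e N) ^ N"
    using ev1 ev2 eventually_gt_at_top[of 0] by eventually_elim (rule main, auto)
  then show "\<forall>\<^sub>F N in sequentially. integrable M (\<lambda>w. norm (euler (\<lambda>i. real i * (T / real N)) N w $ i) powr (2 * q))"
    by (auto elim: eventually_mono)
  have "(\<lambda>N. (1 + d N) ^ N) \<longlonglongrightarrow> exp a" "(\<lambda>N. (1 + e N) ^ N) \<longlonglongrightarrow> exp a"
    using compound_growth_limit[OF a, of "- c"] compound_growth_limit[OF a, of c] unfolding d_def e_def add.assoc by simp_all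
  then have "(\<lambda>N. ?E N N) \<longlonglongrightarrow> exp a"
    by (rule tendsto_sandwich[rotated 2]) (use ev in \<open>auto elim: eventually_mono\<close>)
  then show "(\<lambda>N. ?E N N) \<longlonglongrightarrow> exp (q * (q + 1) * T / 2)" by (simp add: a_def mult_ac)
qed

text \<open>Mean square convergence of the Euler scheme gives almost sure convergence along a
  subsequence; bounded second moments of the 2p-th powers of the row norms then allow the limit to
  be taken under the expectation.\<close>

lemma F_row_moment:
  fixes p :: real
  assumes p: "1 \<le> p" and T: "0 \<le> T"
  shows "integrable M (\<lambda>w. norm (F T w $ i) powr (2 * p))"
    and "(\<integral>w. norm (F T w $ i) powr (2 * p) \<partial>M) = exp (p * (p + 1) * T / 2)"
proof -
  have "integrable M (\<lambda>w. norm (F T w $ i) powr (2 * p)) \<and>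
    (\<integral>w. norm (F T w $ i) powr (2 * p) \<partial>M) = exp (p * (p + 1) * T / 2)"
  proof (cases "T = 0")
    case True
    have "(mat 1 :: mat2) $ i = axis i 1" by (simp add: mat_def axis_def vec_eq_iff)
    then have "norm ((mat 1 :: mat2) $ i) = 1" by simp
    then have AE: "AE w in M. norm (F T w $ i) powr (2 * p) = 1"
      using F_0 True by (auto elim: AE_mp)
    have m: "(\<lambda>w. norm (F T w $ i) powr (2 * p)) \<in> borel_measurable M" using T by measurable
    have "integrable M (\<lambda>w. norm (F T w $ i) powr (2 * p)) \<longleftrightarrow> integrable M (\<lambda>w. 1 :: real)"
      by (rule integrable_cong_AE[OF m _ AE]) simp
    moreover have "(\<integral>w. norm (F T w $ i) powr (2 * p) \<partial>M) = (\<integral>w. 1 \<partial>M)"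
      by (rule integral_cong_AE[OF m _ AE]) simp
    ultimately show ?thesis using True by (simp add: prob_space)
  next
    case False
    then have T0: "0 < T" using T by simp
    define X where "X N = euler (\<lambda>i. real i * (T / real N)) N" for N
    have [measurable]: "X N \<in> borel_measurable M" for N
    proof -
      have "mono (\<lambda>i. real i * (T / real N))" using T by (auto simp: mono_def intro!: divide_right_mono mult_right_mono)
      from euler_adapted_square_integrable[OF _ this, of N] T show ?thesis
        unfolding X_def by (auto intro: measurable_G_M[of "real N * (T / real N)"])
    qed
    note [measurable] = F_measurable[OF T]
    obtain K where K: "\<And>N. 0 < N \<Longrightarrow> integrable M (\<lambda>w. (norm (F T w - X N w))\<^sup>2) \<and>
      (\<integral>w. (norm (F T w - X N w))\<^sup>2 \<partial>M) \<le> K / real N"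
      using euler_convergence[OF T] unfolding X_def by blast
    \<comment> \<open>The square of a 2p-th power is a moment of exponent 2(2p), so the Euler limit
      at 2p supplies the bound \<open>C\<close>; the summand 1 in \<open>C\<close> turns that limit
      into an eventual strict bound.\<close>
    have p2: "1 \<le> 2 * p" using p by simp
    note lim1 = euler_row_moment_limit[OF p T0, of i, folded X_def]
    note lim2 = euler_row_moment_limit[OF p2 T0, of i, folded X_def]
    define C where "C = exp (2 * p * (2 * p + 1) * T / 2) + 1"
    have "\<forall>\<^sub>F N in sequentially. (\<integral>w. norm (X N w $ i) powr (2 * (2 * p)) \<partial>M) < C"
      using lim2(2) unfolding C_def by (rule order_tendstoD) simp
    from eventually_conj[OF this eventually_conj[OF lim2(1) eventually_gt_at_top[of 0]]]
    obtain N0 where N0: "\<And>N. N0 \<le> N \<Longrightarrow> (\<integral>w. norm (X N w $ i) powr (2 * (2 * p)) \<partial>M) < C \<and>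
        integrable M (\<lambda>w. norm (X N w $ i) powr (2 * (2 * p))) \<and> 0 < N"
      by (auto simp: eventually_sequentially)
    have KN: "integrable M (\<lambda>w. (norm (F T w - X (m + N0) w))\<^sup>2)"
      "(\<integral>w. (norm (F T w - X (m + N0) w))\<^sup>2 \<partial>M) \<le> K / real (m + N0)" for m
      using K[of "m + N0"] N0[of "m + N0"] by simp_all
    have "(\<lambda>m. K / real (m + N0)) \<longlonglongrightarrow> 0" by (rule LIMSEQ_ignore_initial_segment) (rule lim_const_over_n)
    then have "(\<lambda>m. \<integral>w. norm ((norm (F T w - X (m + N0) w))\<^sup>2) \<partial>M) \<longlonglongrightarrow> 0"
      by (rule Lim_null_comparison[rotated]) (use KN(2) in \<open>auto intro!: always_eventually simp del: of_nat_add\<close>)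
    from tendsto_L1_AE_subseq[OF KN(1) this] obtain \<rho> :: "nat \<Rightarrow> nat" where \<rho>: "strict_mono \<rho>"
      "AE w in M. (\<lambda>l. (norm (F T w - X (\<rho> l + N0) w))\<^sup>2) \<longlonglongrightarrow> 0" by auto
    define f where "f l w = norm (X (\<rho> l + N0) w $ i) powr (2 * p)" for l w
    have [measurable]: "f l \<in> borel_measurable M" for l unfolding f_def by measurable
    have conv: "AE w in M. (\<lambda>l. f l w) \<longlonglongrightarrow> norm (F T w $ i) powr (2 * p)"
      using \<rho>(2)
    proof eventually_elim
      case (elim w)
      then have "(\<lambda>l. sqrt ((norm (F T w - X (\<rho> l + N0) w))\<^sup>2)) \<longlonglongrightarrow> sqrt 0" by (rule tendsto_real_sqrt)
      then have "(\<lambda>l. F T w - X (\<rho> l + N0) w) \<longlonglongrightarrow> 0" by (simp add: tendsto_norm_zero_iff)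
      from tendsto_diff[OF tendsto_const[of "F T w"] this]
      have "(\<lambda>l. X (\<rho> l + N0) w) \<longlonglongrightarrow> F T w" by simp
      then have "(\<lambda>l. norm (X (\<rho> l + N0) w $ i)) \<longlonglongrightarrow> norm (F T w $ i)"
        by (intro tendsto_norm tendsto_vec_nth)
      then show ?case unfolding f_def by (rule tendsto_powr') (use p in auto)
    qed
    have sq: "(f l w)\<^sup>2 = norm (X (\<rho> l + N0) w $ i) powr (2 * (2 * p))" for l w
      by (simp add: f_def power2_eq_square powr_add[symmetric])
    have r: "integrable M (\<lambda>w. (f l w)\<^sup>2)" "(\<integral>w. (f l w)\<^sup>2 \<partial>M) \<le> C" for l
      unfolding sq using N0[of "\<rho> l + N0"] by auto
    note U = tendsto_integral_bounded_second_moment[OF _ _ conv r]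
    have i: "integrable M (\<lambda>w. norm (F T w $ i) powr (2 * p))" by (rule U(1)) measurable
    have 1: "(\<lambda>l. \<integral>w. f l w \<partial>M) \<longlonglongrightarrow> (\<integral>w. norm (F T w $ i) powr (2 * p) \<partial>M)" by (rule U(2)) measurable
    have "(\<lambda>l. \<integral>w. f l w \<partial>M) \<longlonglongrightarrow> exp (p * (p + 1) * T / 2)"
      using LIMSEQ_subseq_LIMSEQ[OF LIMSEQ_ignore_initial_segment[OF lim1(2), of N0] \<rho>(1)]
      by (simp add: f_def o_def)
    with 1 have "(\<integral>w. norm (F T w $ i) powr (2 * p) \<partial>M) = exp (p * (p + 1) * T / 2)"
      by (rule LIMSEQ_unique)
    with i show ?thesis by blast
  qed
  then show "integrable M (\<lambda>w. norm (F T w $ i) powr (2 * p))"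
    and "(\<integral>w. norm (F T w $ i) powr (2 * p) \<partial>M) = exp (p * (p + 1) * T / 2)" by auto
qed

text \<open>No joint law of the two rows is needed: the norm is at least that of the first row and
  at most twice the larger row norm. In 2^(2p+1), the power 2^(2p) comes from that doubling and one
  more 2 from replacing the maximum by the sum over both rows.\<close>

lemma frobenius_moment_bounds:
  fixes p :: real
  assumes p: "1 \<le> p" and T: "0 \<le> T"
  shows "integrable M (\<lambda>w. frobenius_norm (F T w) powr (2 * p))"
    and "exp (p * (p + 1) * T / 2) \<le> (\<integral>w. frobenius_norm (F T w) powr (2 * p) \<partial>M)"
    and "(\<integral>w. frobenius_norm (F T w) powr (2 * p) \<partial>M) \<le> 2 powr (2 * p + 1) * exp (p * (p + 1) * T / 2)"
proof -
  note [measurable] = F_measurable[OF T]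
  note row = F_row_moment[OF p T]
  have lower: "norm (A $ 1) powr (2 * p) \<le> norm A powr (2 * p)" for A :: mat2
    using p by (intro powr_mono2 Finite_Cartesian_Product.norm_nth_le) auto
  have upper: "norm A powr (2 * p) \<le> 2 powr (2 * p) * (norm (A $ 1) powr (2 * p) + norm (A $ 2) powr (2 * p))" for A :: mat2
  proof -
    define c where "c = max (norm (A $ 1)) (norm (A $ 2))"
    have "norm A \<le> norm (A $ 1) + norm (A $ 2)"
      by (simp add: norm_vec_def[of A] L2_set_def sum_2 sqrt_sum_squares_le_sum)
    also have "\<dots> \<le> 2 * c" by (simp add: c_def)
    finally have "norm A powr (2 * p) \<le> (2 * c) powr (2 * p)" using p by (intro powr_mono2) auto
    also have "\<dots> = 2 powr (2 * p) * c powr (2 * p)" by (simp add: powr_mult c_def)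
    also have "c powr (2 * p) \<le> norm (A $ 1) powr (2 * p) + norm (A $ 2) powr (2 * p)" by (simp add: c_def max_def)
    finally show ?thesis by simp
  qed
  let ?b = "\<lambda>w. 2 powr (2 * p) * (norm (F T w $ 1) powr (2 * p) + norm (F T w $ 2) powr (2 * p))"
  have bi: "integrable M ?b" using row(1) by simp
  have i: "integrable M (\<lambda>w. norm (F T w) powr (2 * p))"
    by (rule Bochner_Integration.integrable_bound[OF bi]) (auto intro!: AE_I2 upper)
  show "integrable M (\<lambda>w. frobenius_norm (F T w) powr (2 * p))" using i by (simp add: frobenius_norm_eq_norm)
  show "exp (p * (p + 1) * T / 2) \<le> (\<integral>w. frobenius_norm (F T w) powr (2 * p) \<partial>M)"
    using integral_mono[OF row(1) i lower] row(2)[of 1] by (simp add: frobenius_norm_eq_norm)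
  have "(\<integral>w. norm (F T w) powr (2 * p) \<partial>M) \<le> integral\<^sup>L M ?b" by (rule integral_mono[OF i bi upper])
  also have "\<dots> = 2 powr (2 * p + 1) * exp (p * (p + 1) * T / 2)" using row by (simp add: powr_add)
  finally show "(\<integral>w. frobenius_norm (F T w) powr (2 * p) \<partial>M) \<le> 2 powr (2 * p + 1) * exp (p * (p + 1) * T / 2)"
    by (simp add: frobenius_norm_eq_norm)
qed

end

theorem lemma2:
  fixes p :: real
  assumes "1 \<le> p"
  shows "\<exists>C::real. 1 \<le> C \<and>
    (\<forall>(M :: 'w measure) G B F. geometric_brownian_motion_SL2 M G B F \<longrightarrow>
      (\<forall>\<tau>\<ge>0.
        integrable M (\<lambda>w. frobenius_norm (F \<tau> w) powr (2 * p)) \<and>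
        inverse C * exp (p * (p + 1) * \<tau> / 2)
          \<le> (\<integral>w. frobenius_norm (F \<tau> w) powr (2 * p) \<partial>M) \<and>
        (\<integral>w. frobenius_norm (F \<tau> w) powr (2 * p) \<partial>M)
          \<le> C * exp (p * (p + 1) * \<tau> / 2)))"
proof -
  \<comment> \<open>The upper bound dictates \<open>C\<close>, which depends on p alone and not on
    the process. The lower bound holds with constant 1, so \<open>inverse C\<close> merely weakens
    it.\<close>
  define C :: real where "C = 2 powr (2 * p + 1)"
  have C: "1 \<le> C" unfolding C_def using assms by (intro ge_one_powr_ge_zero) auto
  have inv: "inverse C * exp x \<le> exp x" for x
    using C by (simp add: mult_left_le_one_le inverse_le_1_iff)
  show ?thesis
    using C inv geometric_brownian_motion_SL2.frobenius_moment_bounds[OF _ assms] order_trans[OF inv]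
    unfolding C_def by blast
qed

end
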